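(* Let $u$ be an $l\times l$ matrix-valued polynomial satisfying $$u(1/\bar z)^*\,u(z)=\bigl(u(1/z)^*\,u(\bar z)\bigr)^*,\qquad z\in\mathbb C\setminus\{0\},$$ and such that (i) $u(z)$ is invertible on $(\overline{\mathbb D}\setminus\mathbb R)\cup\{0\}$; (ii) all zeros of $u$ on $\overline{\mathbb D}\cap\mathbb R$ are simple; (iii) $\displaystyle\sum_j w_j+\frac2\pi\int_0^\pi\sin^2\theta\,\bigl[u(e^{i\theta})^*u(e^{i\theta})\bigr]^{-1}d\theta=\mathbf 1$ for some $w_j\ge\mathbf 0$ with $\operatorname{Ran}w_j=\ker u(z_j)$, one for each zero $z_j$ of $u$ in $\mathbb D\cap\mathbb R$. Then $u$ is the Jost function of a block Jacobi matrix (whose spectral measure has the weights $w_j$ at the points $z_j+z_j^{-1}$) with exponentially converging parameters. This block Jacobi matrix satisfies $\mathbf 1-A_nA_n^*=B_n=\mathbf 0$ for all large $n$ if and only if all the weights $w_j$ are canonical.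
   Context: Here $\mathbb{D}$ is the open unit disk; $\mathbf 1,\mathbf 0$ are the $l\times l$ identity and zero matrices; ${}^*$ is Hermitian conjugation. All analytic/meromorphic matrix functions are assumed to have determinant not identically zero. A zero of a matrix-valued function $f$ is a pole of $f^{-1}$; it is simple if that pole has order $1$. A weight $w_j$ attached to a zero $z_j\in\mathbb D\cap\mathbb R$ of $u$ (with $\operatorname{Ran}w_j=\ker u(z_j)$) is canonical if $$\frac{z_j}{z_j^{-1}-z_j}\,w_j\,u(1/\bar z_j)^*=-(z_j-z_j^{-1})\lim_{z\to z_j}(z-z_j)u(z)^{-1}.$$ A block Jacobi matrix $\mathcal J$ with parameters $\{A_n,B_n\}_{n\ge1}$ ($A_n$ invertible, $B_n$ Hermitian $l\times l$ matrices, bounded) is the semi-infinite block tridiagonal matrix with diagonal blocks $B_1,B_2,\dots$, superdiagonal blocks $A_1,A_2,\dots$ and subdiagonal blocks $A_1^*,A_2^*,\dots$. Its spectral measure $\mu$ is the $l\times l$ positive semidefinite matrix-valued compactly supported measure on $\mathbb R$, $\mu(\mathbb R)=\mathbf 1$, such that $\int\frac{d\mu(x)}{x-E}$ is the upper-left $l\times l$ block of $(\mathcal J-E)^{-1}$. The Jost solution of $\mathcal J$ is the (unique if it exists) solution $(u_n(z;\mathcal J))_{n\ge0}$ of $$u_{n+1}A_n^*+u_n\bigl(B_n-(z+z^{-1})\mathbf 1\bigr)+u_{n-1}A_{n-1}=\mathbf 0,\quad n\ge1,\ A_0=\mathbf 1,$$ with $z^{-n}u_n(z;\mathcal J)\to\mathbf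 1$ as $n\to\infty$ ($0<|z|<1$). The Jost function is $u(z;\mathcal J)=u_0(z;\mathcal J)$; "$u$ is the Jost function of $\mathcal J$" means that the Jost solution exists and $u_0(z;\mathcal J)=u(z)$. "Exponentially converging parameters" means $\limsup_{n\to\infty}\bigl(\|B_n\|+\|\mathbf 1-A_nA_n^*\|\bigr)^{\frac1{2n}}\le r^{-1}$ for some $r>1$. *)

theory Defs
  imports "HOL-Analysis.Analysis" "HOL-Complex_Analysis.Complex_Analysis"
begin

definition herm :: "complex^'n^'m \<Rightarrow> complex^'m^'n"  ("_\<^sup>\<dagger>" [1000] 999)
  where "M\<^sup>\<dagger> = map_matrix cnj (transpose M)"

definition cscale :: "complex \<Rightarrow> complex^'n^'m \<Rightarrow> complex^'n^'m"  (infixr "*\<^sub>M" 75)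
  where "c *\<^sub>M M = map_matrix ((*) c) M"

definition qform :: "complex^'l^'l \<Rightarrow> complex^'l \<Rightarrow> complex"
  where "qform M v = (\<Sum>i\<in>UNIV. cnj (v $ i) * (M *v v) $ i)"

definition psd :: "complex^'l^'l \<Rightarrow> bool"
  where "psd M \<longleftrightarrow> M\<^sup>\<dagger> = M \<and> (\<forall>v. 0 \<le> Re (qform M v))"

definition eval_mat :: "complex poly^'l^'l \<Rightarrow> complex \<Rightarrow> complex^'l^'l"
  where "eval_mat p z = map_matrix (\<lambda>q. poly q z) p"

text \<open>\<^const>\<open>is_pole\<close> says that the norm of the matrix tends to infinity; for a
  meromorphic matrix function this means that some entry has a pole.  The order of the pole
  is the largest order among the entries having one (\<^const>\<open>zorder\<close> is \<open>-k\<close> at a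
  pole of order \<open>k\<close>).  Both notions ignore the value at the point itself, so it does not
  matter that \<^const>\<open>matrix_inv\<close> is unspecified at singular matrices.\<close>

definition mat_zero :: "(complex \<Rightarrow> complex^'l^'l) \<Rightarrow> complex \<Rightarrow> bool"
  where "mat_zero f z \<longleftrightarrow> is_pole (\<lambda>s. matrix_inv (f s)) z"

definition simple_mat_zero :: "(complex \<Rightarrow> complex^'l^'l) \<Rightarrow> complex \<Rightarrow> bool"
  where "simple_mat_zero f z \<longleftrightarrow> mat_zero f z \<and>
    (\<forall>i j. is_pole (\<lambda>s. matrix_inv (f s) $ i $ j) z \<longrightarrow>
           zorder (\<lambda>s. matrix_inv (f s) $ i $ j) z = -1)"

definition real_zeros :: "(complex \<Rightarrow> complex^'l^'l) \<Rightarrow> real set"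
  where "real_zeros f = {x. -1 < x \<and> x < 1 \<and> mat_zero f (of_real x)}"

definition canonical :: "(complex \<Rightarrow> complex^'l^'l) \<Rightarrow> complex \<Rightarrow> complex^'l^'l \<Rightarrow> bool"
  where "canonical f z w \<longleftrightarrow>
    (z / (inverse z - z)) *\<^sub>M (w ** (f (1 / cnj z))\<^sup>\<dagger>) =
    - ((z - inverse z) *\<^sub>M Lim (at z) (\<lambda>s. (s - z) *\<^sub>M matrix_inv (f s)))"

text \<open>The parameters are \<open>A n\<close>, \<open>B n\<close> for \<open>n \<ge> 1\<close>; the values at
  \<open>0\<close> play no role anywhere.\<close>

definition block_jacobi :: "(nat \<Rightarrow> complex^'l^'l) \<Rightarrow> (nat \<Rightarrow> complex^'l^'l) \<Rightarrow> bool"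
  where "block_jacobi A B \<longleftrightarrow>
    (\<forall>n\<ge>1. invertible (A n) \<and> (B n)\<^sup>\<dagger> = B n) \<and> bounded (A ` {1..}) \<and> bounded (B ` {1..})"

text \<open>Square-summable vector sequences indexed by \<open>n \<ge> 1\<close>, extended by \<open>0\<close> at
  \<open>n = 0\<close>; this makes the general row formula valid in the first row too.\<close>

definition ell2 :: "(nat \<Rightarrow> complex^'l) set"
  where "ell2 = {\<phi>. \<phi> 0 = 0 \<and> summable (\<lambda>n. (norm (\<phi> n))\<^sup>2)}"

definition jacobi_op ::
    "(nat \<Rightarrow> complex^'l^'l) \<Rightarrow> (nat \<Rightarrow> complex^'l^'l) \<Rightarrow> (nat \<Rightarrow> complex^'l) \<Rightarrow> nat \<Rightarrow> complex^'l"
  where "jacobi_op A B \<phi> n = (if n = 0 then 0 else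
    (A (n - 1))\<^sup>\<dagger> *v \<phi> (n - 1) + B n *v \<phi> n + A n *v \<phi> (n + 1))"

definition resolvent ::
    "(nat \<Rightarrow> complex^'l^'l) \<Rightarrow> (nat \<Rightarrow> complex^'l^'l) \<Rightarrow> complex \<Rightarrow> (nat \<Rightarrow> complex^'l) \<Rightarrow> nat \<Rightarrow> complex^'l"
  where "resolvent A B E = the_inv_into ell2 (\<lambda>\<phi> n. jacobi_op A B \<phi> n - E *s \<phi> n)"

definition resolvent_block ::
    "(nat \<Rightarrow> complex^'l^'l) \<Rightarrow> (nat \<Rightarrow> complex^'l^'l) \<Rightarrow> complex \<Rightarrow> complex^'l^'l"
  where "resolvent_block A B E =
    (\<chi> i j. resolvent A B E (\<lambda>n. if n = 1 then axis j 1 else 0) 1 $ i)"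

text \<open>Positive semidefinite matrix-valued Borel measures are represented by set functions
  (with arbitrary values on non-Borel sets).\<close>

definition matrix_measure :: "(real set \<Rightarrow> complex^'l^'l) \<Rightarrow> bool"
  where "matrix_measure \<mu> \<longleftrightarrow> (\<forall>S\<in>sets borel. psd (\<mu> S)) \<and>
    (\<forall>F :: nat \<Rightarrow> real set. range F \<subseteq> sets borel \<and> disjoint_family F \<longrightarrow>
      (\<lambda>n. \<mu> (F n)) sums \<mu> (\<Union>n. F n))"

definition quad_measure :: "(real set \<Rightarrow> complex^'l^'l) \<Rightarrow> complex^'l \<Rightarrow> real measure"
  where "quad_measure \<mu> v = measure_of UNIV (sets borel) (\<lambda>S. ennreal (Re (qform (\<mu> S) v)))"

text \<open>\<open>\<integral> f d\<mu> = G\<close> for scalar \<open>f\<close>; by polarization the matrix \<open>G\<close>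
  is determined by its quadratic form.\<close>

definition has_matrix_integral ::
    "(real set \<Rightarrow> complex^'l^'l) \<Rightarrow> (real \<Rightarrow> complex) \<Rightarrow> complex^'l^'l \<Rightarrow> bool"
  where "has_matrix_integral \<mu> f G \<longleftrightarrow>
    (\<forall>v. integrable (quad_measure \<mu> v) f \<and> qform G v = (\<integral>x. f x \<partial>quad_measure \<mu> v))"

text \<open>The resolvent identity is imposed at all non-real \<open>E\<close>, which lie in the resolvent
  set because the operator is bounded and self-adjoint, and which determine the measure.\<close>

definition spectral_measure ::
    "(nat \<Rightarrow> complex^'l^'l) \<Rightarrow> (nat \<Rightarrow> complex^'l^'l) \<Rightarrow> (real set \<Rightarrow> complex^'l^'l) \<Rightarrow> bool"
  where "spectral_measure A B \<mu> \<longleftrightarrow> matrix_measure \<mu> \<and>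
    (\<exists>K. compact K \<and> \<mu> (- K) = 0) \<and> \<mu> UNIV = mat 1 \<and>
    (\<forall>E. E \<notin> \<real> \<longrightarrow> has_matrix_integral \<mu> (\<lambda>x. 1 / (of_real x - E)) (resolvent_block A B E))"

text \<open>\<open>A(0 := mat 1)\<close> is the convention \<open>A\<^sub>0 = 1\<close>.\<close>

definition jost_solution ::
    "(nat \<Rightarrow> complex^'l^'l) \<Rightarrow> (nat \<Rightarrow> complex^'l^'l) \<Rightarrow> (nat \<Rightarrow> complex \<Rightarrow> complex^'l^'l) \<Rightarrow> bool"
  where "jost_solution A B U \<longleftrightarrow> (\<forall>z. 0 < norm z \<and> norm z < 1 \<longrightarrow>
    (\<forall>n\<ge>1. U (n + 1) z ** (A n)\<^sup>\<dagger> + U n z ** (B n - (z + inverse z) *\<^sub>M mat 1)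
            + U (n - 1) z ** (A(0 := mat 1)) (n - 1) = 0) \<and>
    (\<lambda>n. inverse (z ^ n) *\<^sub>M U n z) \<longlonglongrightarrow> mat 1)"

definition jost_function ::
    "(nat \<Rightarrow> complex^'l^'l) \<Rightarrow> (nat \<Rightarrow> complex^'l^'l) \<Rightarrow> (complex \<Rightarrow> complex^'l^'l) \<Rightarrow> bool"
  where "jost_function A B u \<longleftrightarrow>
    (\<exists>U. jost_solution A B U \<and> (\<forall>z. 0 < norm z \<and> norm z < 1 \<longrightarrow> U 0 z = u z))"

text \<open>The choice of matrix norm does not affect the limit superior, as constant factors
  disappear under the \<open>2n\<close>-th root.\<close>

definition exp_converging ::
    "(nat \<Rightarrow> complex^'l^'l) \<Rightarrow> (nat \<Rightarrow> complex^'l^'l) \<Rightarrow> bool"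
  where "exp_converging A B \<longleftrightarrow> (\<exists>r>1.
    limsup (\<lambda>n. ereal (root (2 * n) (norm (B n) + norm (mat 1 - A n ** (A n)\<^sup>\<dagger>)))) \<le> ereal (1 / r))"

end

theory Submission
  imports Defs
begin

text \<open>Write \<open>u\<^sup>#(z)\<close> for the Hermitian conjugate of \<open>u\<close> at the conjugate of \<open>z\<close>. For large \<open>n\<close> the Jost
  solution has the closed form \<open>u\<^sub>n(z) = z\<^sup>n Y\<^sub>n(z) C\<^sub>n\<close> with constant \<open>C\<^sub>n\<close> and
  \<open>Y\<^sub>n(z) = 1 + (\<Sum>b. X\<^sub>n(b) / (1 - b z))\<close>, where \<open>b\<close> runs over the zeros of \<open>u\<close> in \<open>(-1, 1)\<close>. The
  coefficients solve the finite linear system \<open>X\<^sub>n(a) = a\<^sup>2\<^sup>n T(a) Y\<^sub>n(a)\<close>, which is a small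
  perturbation of the identity, and \<open>T(a) = 0\<close> means that the weight at \<open>a\<close> is canonical. The choice of
  \<open>T\<close> makes \<open>(u\<^sup>#(1/z) z\<^sup>n Y\<^sub>n(z) - u\<^sup>#(z) z\<^sup>-\<^sup>n Y\<^sub>n(1/z)) / (z - 1/z)\<close> a matrix polynomial in \<open>z + 1/z\<close> with
  leading coefficient \<open>u(0)\<^sup>\<dagger>\<close>, and it makes the residues at the zeros cancel against the point masses.
  By the residue theorem this polynomial is therefore orthogonal to all lower degrees, and its
  Cauchy transform is \<open>- u(z)\<^sup>-\<^sup>1 z\<^sup>n Y\<^sub>n(z)\<close>. So it is, up to normalization, the orthogonal polynomial of the
  measure, the Jost function of the resulting Jacobi matrix is \<open>u\<close>, and the parameters converge
  exponentially because \<open>X\<^sub>n\<close> decays exponentially.\<close>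

section \<open>Matrices\<close>

text \<open>The origin of \<open>T\<close>: in the second term of the quotient, Y_n(1/z) has a pole
  at each zero a. The condition u^#(a) T(a) = 0 removes it, and the finite part left behind,
  multiplied by w(a), is governed by the product of w(a), the adjoint of u'(a), and T(a). This
  product has to supply the defect by which w(a) fails to be canonical, since only then does the
  point mass at a act on the polynomial like a residue of the inverse of u. Simplicity of the zeros
  makes both conditions solvable at once: if R(a) is the residue of the inverse, R(a) u'(a) is the
  identity on ker u(a).

  The closed form is available for large n only. Therefore the monic polynomials are built from the
  measure for every n and merely identified with the closed form beyond some index; below it the
  Jost solution is continued backwards by the recurrence. For real z the point z + 1/z may be an
  eigenvalue, so identities that pass through Cauchy transforms are proved off the real axis and
  extended by continuity.\<close>

no_notation fps_nth (infixl "$" 75)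

lemma herm_nth [simp]: "(M\<^sup>\<dagger>) $ i $ j = cnj (M $ j $ i)"
  by (simp add: herm_def map_matrix_def transpose_def)

lemma cscale_nth [simp]: "(c *\<^sub>M M) $ i $ j = c * M $ i $ j"
  by (simp add: cscale_def map_matrix_def)

lemma eval_mat_nth [simp]: "eval_mat p z $ i $ j = poly (p $ i $ j) z"
  by (simp add: eval_mat_def map_matrix_def)

lemma mat_eqI: "(\<And>i j. A $ i $ j = B $ i $ j) \<Longrightarrow> (A :: complex^'n^'m) = B"
  by (simp add: vec_eq_iff)

lemma matrix_mul_nth: "(A ** B) $ i $ j = (\<Sum>k\<in>UNIV. A $ i $ k * B $ k $ j)"
  by (simp add: matrix_matrix_mult_def)

lemma mat_nth: "mat c $ i $ j = (if i = j then c else 0)"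
  by (simp add: mat_def)

lemma herm_herm [simp]: "(M\<^sup>\<dagger>)\<^sup>\<dagger> = M"
  by (rule mat_eqI) simp

lemma herm_mult: "(A ** B)\<^sup>\<dagger> = B\<^sup>\<dagger> ** A\<^sup>\<dagger>"
  by (rule mat_eqI) (simp add: matrix_mul_nth mult.commute)

lemma herm_mat_1 [simp]: "(mat 1)\<^sup>\<dagger> = mat 1"
  by (rule mat_eqI) (simp add: mat_nth)

lemma herm_cscale: "(c *\<^sub>M A)\<^sup>\<dagger> = cnj c *\<^sub>M A\<^sup>\<dagger>"
  by (rule mat_eqI) simp

text \<open>The norm of \<open>complex^'n^'m\<close> is the Frobenius norm. It is submultiplicative
  and invariant under \<open>herm\<close>, but \<open>norm (mat 1)\<close> exceeds 1 in dimension
  two and higher.\<close>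

lemma norm_matrix_sq: "(norm (A :: complex^'n^'m))\<^sup>2 = (\<Sum>i\<in>UNIV. \<Sum>j\<in>UNIV. (cmod (A $ i $ j))\<^sup>2)"
  by (simp add: norm_vec_def L2_set_def sum_nonneg)

lemma norm_herm [simp]: "norm (A\<^sup>\<dagger>) = norm A"
proof -
  have "(norm (A\<^sup>\<dagger>))\<^sup>2 = (norm A)\<^sup>2"
    unfolding norm_matrix_sq by (subst sum.swap) simp
  thus ?thesis by simp
qed

lemma bounded_linear_herm: "bounded_linear (herm :: complex^'n^'m \<Rightarrow> complex^'m^'n)"
  by (rule bounded_linear_intro[where K = 1]) (auto intro!: mat_eqI)

lemmas herm_add = linear_add[OF bounded_linear.linear[OF bounded_linear_herm]]
lemmas herm_diff = linear_diff[OF bounded_linear.linear[OF bounded_linear_herm]]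
lemmas herm_zero [simp] = linear_0[OF bounded_linear.linear[OF bounded_linear_herm]]
lemmas herm_sum = linear_sum[OF bounded_linear.linear[OF bounded_linear_herm]]
lemmas herm_scaleR = linear_scale[OF bounded_linear.linear[OF bounded_linear_herm]]

lemma norm_matrix_mult: "norm (A ** B) \<le> norm A * norm (B :: complex^'n^'k)"
proof -
  have *: "(cmod (\<Sum>k\<in>UNIV. A $ i $ k * B $ k $ j))\<^sup>2
      \<le> (\<Sum>k\<in>UNIV. (cmod (A $ i $ k))\<^sup>2) * (\<Sum>k\<in>UNIV. (cmod (B $ k $ j))\<^sup>2)" for i j
  proof -
    have "cmod (\<Sum>k\<in>UNIV. A $ i $ k * B $ k $ j) \<le> (\<Sum>k\<in>UNIV. cmod (A $ i $ k) * cmod (B $ k $ j))"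
      by (rule order_trans[OF norm_sum]) (simp add: norm_mult)
    hence "(cmod (\<Sum>k\<in>UNIV. A $ i $ k * B $ k $ j))\<^sup>2
       \<le> (\<Sum>k\<in>UNIV. cmod (A $ i $ k) * cmod (B $ k $ j))\<^sup>2"
      by (intro power_mono) auto
    also have "\<dots> \<le> (\<Sum>k\<in>UNIV. (cmod (A $ i $ k))\<^sup>2) * (\<Sum>k\<in>UNIV. (cmod (B $ k $ j))\<^sup>2)"
      by (rule Cauchy_Schwarz_ineq_sum)
    finally show ?thesis .
  qed
  have "(norm (A ** B))\<^sup>2 \<le> (\<Sum>i\<in>UNIV. \<Sum>j\<in>UNIV. (\<Sum>k\<in>UNIV. (cmod (A $ i $ k))\<^sup>2) * (\<Sum>k\<in>UNIV. (cmod (B $ k $ j))\<^sup>2))"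
    unfolding norm_matrix_sq matrix_mul_nth by (intro sum_mono *)
  also have "\<dots> = (norm A)\<^sup>2 * (norm B)\<^sup>2"
    unfolding norm_matrix_sq sum_product[symmetric]
    by (subst sum.swap[of "\<lambda>k j. (cmod (B $ k $ j))\<^sup>2"]) simp
  finally have "(norm (A ** B))\<^sup>2 \<le> (norm A * norm B)\<^sup>2" by (simp add: power_mult_distrib)
  thus ?thesis by (rule power2_le_imp_le) simp
qed

text \<open>Viewing the products as bounded bilinear maps supplies the later rules for limits,
  continuity, sums, series and integrals in one stroke.\<close>

interpretation mm: bounded_bilinear "(**) :: complex^'k^'m \<Rightarrow> complex^'n^'k \<Rightarrow> complex^'n^'m"
proof
  show "\<exists>K. \<forall>a b. norm ((a :: complex^'k^'m) ** (b :: complex^'n^'k)) \<le> norm a * norm b * K"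
    by (intro exI[of _ 1]) (simp add: norm_matrix_mult)
qed (auto intro!: mat_eqI simp: matrix_mul_nth distrib_left distrib_right sum.distrib scaleR_sum_right)

lemma norm_cscale [simp]: "norm (c *\<^sub>M A) = cmod c * norm A"
proof -
  have "(norm (c *\<^sub>M A))\<^sup>2 = (cmod c * norm A)\<^sup>2"
    unfolding power_mult_distrib norm_matrix_sq
    by (simp add: norm_mult power_mult_distrib sum_distrib_left)
  thus ?thesis by (simp add: power2_eq_iff_nonneg)
qed

interpretation cs: bounded_bilinear "cscale :: complex \<Rightarrow> complex^'n^'m \<Rightarrow> complex^'n^'m"
proof
  show "\<exists>K. \<forall>a b. norm (a *\<^sub>M (b :: complex^'n^'m)) \<le> norm a * norm b * K"
    by (intro exI[of _ 1]) simp
qed (auto intro!: mat_eqI simp: algebra_simps)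

lemma cscale_cscale [simp]: "a *\<^sub>M b *\<^sub>M A = (a * b) *\<^sub>M A"
  by (rule mat_eqI) simp
lemma cscale_one [simp]: "1 *\<^sub>M A = A"
  by (rule mat_eqI) simp
lemma cscale_of_real: "of_real r *\<^sub>M A = r *\<^sub>R A"
  by (rule mat_eqI) (simp only: cscale_nth vector_scaleR_component, simp add: scaleR_conv_of_real)
lemma cscale_mult_left: "(c *\<^sub>M A) ** B = c *\<^sub>M (A ** B)"
  by (rule mat_eqI) (simp add: matrix_mul_nth sum_distrib_left mult.assoc)
lemma cscale_mult_right: "A ** (c *\<^sub>M B) = c *\<^sub>M (A ** B)"
  by (rule mat_eqI) (simp add: matrix_mul_nth sum_distrib_left mult_ac)
lemma cscale_eq_0_iff [simp]: "c *\<^sub>M A = 0 \<longleftrightarrow> c = 0 \<or> A = 0"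
  by (metis norm_cscale norm_eq_zero mult_eq_0_iff)
lemma cscale_cancel: "c \<noteq> 0 \<Longrightarrow> c *\<^sub>M A = c *\<^sub>M B \<longleftrightarrow> A = B"
  by (metis cs.diff_right cscale_eq_0_iff right_minus_eq)

lemmas cs_simps = cscale_mult_left cscale_mult_right

lemma mm_vec: "(A ** B) *v x = A *v (B *v x)"
  by (simp add: matrix_vector_mul_assoc)

lemma norm_mult_vec: "norm (a *v b) \<le> norm a * norm (b :: complex^'k)" for a :: "complex^'k^'m"
proof -
  \<comment> \<open>A vector becomes a matrix with one column, so that
    \<open>norm_matrix_mult\<close> applies.\<close>
  define M where "M = (\<chi> i (j::unit). b $ i)"
  have nM: "norm M = norm b" "norm (a ** M) = norm (a *v b)"
  proof -
    have "(norm M)\<^sup>2 = (norm b)\<^sup>2" "(norm (a ** M))\<^sup>2 = (norm (a *v b))\<^sup>2"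
      unfolding norm_matrix_sq
      by (simp_all add: M_def norm_vec_def L2_set_def sum_nonneg matrix_mul_nth
          matrix_vector_mult_def UNIV_unit)
    thus "norm M = norm b" "norm (a ** M) = norm (a *v b)" by simp_all
  qed
  show ?thesis using norm_matrix_mult[of a M] by (simp add: nM)
qed

interpretation mv: bounded_bilinear "(*v) :: complex^'k^'m \<Rightarrow> complex^'k \<Rightarrow> complex^'m"
proof
  show "\<exists>K. \<forall>a b. norm ((a :: complex^'k^'m) *v b) \<le> norm a * norm b * K"
    by (intro exI[of _ 1]) (simp add: norm_mult_vec)
qed (auto simp: vec_eq_iff matrix_vector_mult_def distrib_left distrib_right sum.distrib scaleR_sum_right)

lemma cscale_vec: "(c *\<^sub>M A) *v x = c *s (A *v x)"
  by (simp add: vec_eq_iff matrix_vector_mult_def sum_distrib_left mult.assoc)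

lemma mat_eq_vecI: "(\<And>x. A *v x = B *v x) \<Longrightarrow> A = (B :: complex^'n^'m)"
  by (simp add: matrix_eq)

lemma cancel_right_inv: "B ** C = mat 1 \<Longrightarrow> A ** B ** C = A"
  by (simp add: matrix_mul_assoc[symmetric])

lemma matrix_inv_both:
  assumes "invertible (A::complex^'n^'n)"
  shows "A ** matrix_inv A = mat 1 \<and> matrix_inv A ** A = mat 1"
  using assms unfolding invertible_def matrix_inv_def by (rule someI_ex)

lemma mat_inv_r: "invertible (A::complex^'n^'n) \<Longrightarrow> A ** matrix_inv A = mat 1"
  and mat_inv_l: "invertible (A::complex^'n^'n) \<Longrightarrow> matrix_inv A ** A = mat 1"
  using matrix_inv_both by blast+

lemma invertible_iff_r: "invertible (A::complex^'n^'n) \<longleftrightarrow> (\<exists>B. A ** B = mat 1)"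
  unfolding invertible_def using matrix_left_right_inverse by blast

lemma matrix_inv_eqI: "(A::complex^'n^'n) ** B = mat 1 \<Longrightarrow> matrix_inv A = B"
proof -
  assume AB: "A ** B = mat 1"
  hence "invertible A" by (auto simp: invertible_iff_r)
  hence "matrix_inv A ** (A ** B) = B" by (simp add: matrix_mul_assoc mat_inv_l)
  thus ?thesis by (simp add: AB)
qed

lemma invertible_herm: "invertible (A::complex^'n^'n) \<Longrightarrow> invertible (A\<^sup>\<dagger>)"
  unfolding invertible_iff_r[of "A\<^sup>\<dagger>"]
  by (intro exI[of _ "(matrix_inv A)\<^sup>\<dagger>"]) (simp add: herm_mult[symmetric] mat_inv_l)

lemma matrix_inv_herm: "invertible (A::complex^'n^'n) \<Longrightarrow> matrix_inv (A\<^sup>\<dagger>) = (matrix_inv A)\<^sup>\<dagger>"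
  by (rule matrix_inv_eqI) (simp add: herm_mult[symmetric] mat_inv_l)

lemma invertible_inv: "invertible (A::complex^'n^'n) \<Longrightarrow> invertible (matrix_inv A)"
  by (metis invertible_right_inverse mat_inv_l)

lemma matrix_inv_mult: "invertible (A::complex^'n^'n) \<Longrightarrow> invertible (B::complex^'n^'n) \<Longrightarrow>
    matrix_inv (A ** B) = matrix_inv B ** matrix_inv A"
  proof (rule matrix_inv_eqI)
  assume a: "invertible A" "invertible B"
  have "A ** B ** (matrix_inv B ** matrix_inv A) = A ** (B ** matrix_inv B) ** matrix_inv A"
    by (simp add: matrix_mul_assoc)
  thus "A ** B ** (matrix_inv B ** matrix_inv A) = mat 1" by (simp add: a mat_inv_r)
qed

lemma invertible_mult_cancel:
  assumes "invertible ((A::complex^'n^'n) ** (B::complex^'n^'n))" shows "invertible A" "invertible B"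
proof -
  obtain C where C: "A ** B ** C = mat 1" "C ** (A ** B) = mat 1"
    using assms by (meson invertible_def)
  show "invertible A" unfolding invertible_iff_r
    by (rule exI[of _ "B ** C"]) (use C in \<open>simp add: matrix_mul_assoc\<close>)
  have "(C ** A) ** B = mat 1" using C by (simp add: matrix_mul_assoc)
  thus "invertible B" unfolding invertible_iff_r using matrix_left_right_inverse by blast
qed

text \<open>The Hermitian inner product, conjugate linear in the first argument;
  \<open>inner\<close> on \<open>complex^'l\<close> is its real part.\<close>

definition cinner :: "complex^'l \<Rightarrow> complex^'l \<Rightarrow> complex"
  where "cinner x y = (\<Sum>i\<in>UNIV. cnj (x $ i) * y $ i)"

lemma qform_cinner: "qform M v = cinner v (M *v v)"
  by (simp add: qform_def cinner_def)

lemma norm_cinner_le: "cmod (cinner a b) \<le> norm a * norm b"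
proof -
  have "cmod (cinner a b) \<le> (\<Sum>i\<in>UNIV. cmod (a $ i) * cmod (b $ i))"
    unfolding cinner_def by (rule order_trans[OF norm_sum]) (simp add: norm_mult)
  also have "\<dots> \<le> norm a * norm b"
    unfolding norm_vec_def using L2_set_mult_ineq[of "\<lambda>i. cmod (a $ i)" "\<lambda>i. cmod (b $ i)" UNIV] by simp
  finally show ?thesis .
qed

interpretation cinner: bounded_bilinear "cinner :: complex^'l \<Rightarrow> complex^'l \<Rightarrow> complex"
proof
  show "\<exists>K. \<forall>a b. norm (cinner (a :: complex^'l) b) \<le> norm a * norm b * K"
    by (intro exI[of _ 1]) (simp add: norm_cinner_le)
qed (auto simp: cinner_def algebra_simps sum.distrib scaleR_sum_right)

lemma cinner_herm: "cinner x (M *v y) = cinner (M\<^sup>\<dagger> *v x) y"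
  unfolding cinner_def matrix_vector_mult_def
  by (simp add: sum_distrib_left sum_distrib_right mult_ac) (rule sum.swap)

lemma cinner_commute: "cnj (cinner x y) = cinner y x"
  by (simp add: cinner_def mult.commute)

lemma cinner_self: "cinner x x = of_real ((norm x)\<^sup>2)"
  unfolding cinner_def norm_vec_def L2_set_def
  by (simp add: sum_nonneg mult.commute[of "cnj _"] flip: complex_norm_square)

lemma cinner_cscale: "cinner x (c *s y) = c * cinner x y" "cinner (c *s x) y = cnj c * cinner x y"
  by (simp_all add: cinner_def sum_distrib_left mult_ac)

lemma qform_gram: "qform (B\<^sup>\<dagger> ** M ** B) v = qform M (B *v v)"
  by (simp add: qform_cinner mm_vec cinner_herm)

lemma psd_gram: "psd M \<Longrightarrow> psd (B\<^sup>\<dagger> ** M ** B)"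
  by (simp add: psd_def qform_gram herm_mult matrix_mul_assoc)

lemma qform_mat_1: "qform (mat 1) v = of_real ((norm v)\<^sup>2)"
  by (simp add: qform_cinner cinner_self)

lemma psd_self_herm: "psd (B\<^sup>\<dagger> ** B)"
  using psd_gram[of "mat 1" B] by (simp add: psd_def qform_mat_1)

lemma bounded_linear_qform: "bounded_linear (\<lambda>M :: complex^'l^'l. qform M v)"
  unfolding qform_cinner
  by (intro bounded_linear_compose[OF cinner.bounded_linear_right] mv.bounded_linear_left)

lemmas qform_add = linear_add[OF bounded_linear.linear[OF bounded_linear_qform]]
lemmas qform_zero [simp] = linear_0[OF bounded_linear.linear[OF bounded_linear_qform]]
lemmas qform_sum = linear_sum[OF bounded_linear.linear[OF bounded_linear_qform]]
lemmas qform_scaleR = linear_scale[OF bounded_linear.linear[OF bounded_linear_qform]]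

lemma psd_add: "psd A \<Longrightarrow> psd B \<Longrightarrow> psd (A + B)"
  by (simp add: psd_def herm_add qform_add)

lemma psd_scaleR: "psd A \<Longrightarrow> 0 \<le> r \<Longrightarrow> psd (r *\<^sub>R A)"
  by (simp add: psd_def herm_scaleR qform_scaleR)

lemma psd_0 [simp]: "psd 0"
  by (simp add: psd_def herm_zero qform_zero)

lemma herm_qform_real: "M\<^sup>\<dagger> = M \<Longrightarrow> qform M v \<in> \<real>"
  by (metis Reals_cnj_iff cinner_commute cinner_herm qform_cinner)

section \<open>Factorizations of positive semidefinite matrices\<close>

lemma qform_two:
  "qform K (axis j 1 + c *s axis i 1) =
    K $ j $ j + c * K $ j $ i + cnj c * K $ i $ j + cnj c * c * K $ i $ i"
proof -
  have *: "cinner (axis a 1) x = x $ a" for a and x :: "complex^'a"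
    by (simp add: cinner_def axis_def if_distrib if_distribR cong: if_cong)
  have **: "(K *v axis a 1) $ b = K $ b $ a" for a b
    by (simp add: matrix_vector_mult_def axis_def if_distrib if_distribR cong: if_cong)
  have "K *v (axis j 1 + c *s axis i 1) = K *v axis j 1 + c *s (K *v axis i 1)"
    by (simp add: vec_eq_iff matrix_vector_mult_def sum_distrib_left algebra_simps sum.distrib)
  thus ?thesis
    by (simp add: qform_cinner cinner.add_left cinner.add_right cinner_cscale * ** algebra_simps)
qed

text \<open>With a zero on the diagonal, the form at \<open>axis j 1 + c *s axis i 1\<close> is
  affine in c, so it can only stay nonnegative if the mixed coefficient vanishes.\<close>

lemma psd_zero_diag:
  assumes K: "psd K" and i: "K $ i $ i = 0"
  shows "K $ i $ j = 0"
proof (rule ccontr)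
  assume nz: "K $ i $ j \<noteq> 0"
  have herm: "K $ a $ b = cnj (K $ b $ a)" for a b
    using K unfolding psd_def by (metis herm_nth)
  define N where "N = (cmod (K $ i $ j))\<^sup>2"
  have N: "N > 0" using nz by (simp add: N_def)
  \<comment> \<open>Chosen so that the form takes the value - Re \<open>K $ j $ j\<close> - 2, which
    is negative.\<close>
  define t where "t = (Re (K $ j $ j) + 1) / N"
  have "0 \<le> Re (qform K (axis j 1 + (- of_real t * K $ i $ j) *s axis i 1))"
    using K by (simp add: psd_def)
  also have "qform K (axis j 1 + (- of_real t * K $ i $ j) *s axis i 1)
      = K $ j $ j - 2 * of_real t * (K $ i $ j * cnj (K $ i $ j))"
    unfolding qform_two i herm[of j i] by (simp add: algebra_simps)
  also have "\<dots> = K $ j $ j - of_real (2 * t * N)"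
    unfolding N_def by (simp flip: complex_norm_square)
  finally have "0 \<le> Re (K $ j $ j) - 2 * t * N" by simp
  moreover have "t * N = Re (K $ j $ j) + 1" using N by (simp add: t_def)
  moreover have "0 \<le> Re (K $ j $ j)"
    using K[unfolded psd_def] qform_two[of K j 0] by (metis add.right_neutral complex_cnj_zero mult_zero_left)
  ultimately show False by simp
qed

text \<open>Cholesky elimination: \<open>S\<close> contains the indices of all nonzero rows, and
  each step splits off a rank-one term that clears row i. What remains is the Schur complement,
  again positive semidefinite.\<close>

lemma psd_factor_aux:
  assumes "finite S"
  shows "psd K \<Longrightarrow> (\<And>i j. i \<notin> S \<Longrightarrow> K $ i $ j = 0) \<Longrightarrow>
    \<exists>v :: 'l \<Rightarrow> complex^'l. \<forall>a b. K $ a $ b = (\<Sum>i\<in>S. v i $ a * cnj (v i $ b))"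
  using assms
proof (induction S arbitrary: K rule: finite_induct)
  case empty
  thus ?case by auto
next
  case (insert i S)
  have herm: "K $ a $ b = cnj (K $ b $ a)" for a b
    using insert.prems unfolding psd_def by (metis herm_nth)
  show ?case
  proof (cases "K $ i $ i = 0")
    case True
    have "K $ a $ b = 0" if "a \<notin> S" for a b
      using insert.prems(2)[of a b] psd_zero_diag[OF insert.prems(1) True] that by (cases "a = i") auto
    from insert.IH[OF insert.prems(1) this] obtain v
      where v: "\<forall>a b. K $ a $ b = (\<Sum>i\<in>S. v i $ a * cnj (v i $ b))" by blast
    have "\<forall>a b. K $ a $ b = (\<Sum>k\<in>insert i S. (v(i := 0)) k $ a * cnj ((v(i := 0)) k $ b))"
      using v insert.hyps by (auto intro!: sum.cong)
    thus ?thesis by blast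
  next
    case False
    define k where "k = Re (K $ i $ i)"
    have Kii: "K $ i $ i = of_real k"
      using herm[of i i] by (metis Reals_cnj_iff complex_is_Real_iff complex_of_real_def complex_eq_iff
          Re_complex_of_real Im_complex_of_real k_def)
    have "0 \<le> k"
      using insert.prems(1)[unfolded psd_def] qform_two[of K i 0] unfolding k_def
      by (metis add.right_neutral complex_cnj_zero mult_zero_left)
    hence k: "k > 0" using False Kii by (cases "k = 0") auto
    \<comment> \<open>Right multiplication by \<open>B\<close> clears row i. The Schur complement
      \<open>K'\<close> is the congruence of \<open>K\<close> by \<open>B\<close>, which gives its
      positivity.\<close>
    define B where "B = (\<chi> a b. (if a = b then 1 else 0) - (if a = i then K $ i $ b / of_real k else 0))"
    define K' where "K' = (\<chi> a b. K $ a $ b - K $ a $ i * K $ i $ b / of_real k)"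
    have "K ** B = K'"
    proof (rule mat_eqI)
      fix a b
      have "(K ** B) $ a $ b =
          (\<Sum>c\<in>UNIV. (if c = b then K $ a $ c else 0) - (if c = i then K $ a $ c * K $ i $ b / of_real k else 0))"
        unfolding matrix_mul_nth B_def by (intro sum.cong refl) (auto simp: algebra_simps)
      also have "\<dots> = K' $ a $ b" by (simp add: sum_subtractf K'_def)
      finally show "(K ** B) $ a $ b = K' $ a $ b" .
    qed
    moreover have "B\<^sup>\<dagger> ** K' = K'"
    proof (rule mat_eqI)
      fix a b
      have z: "K' $ i $ b = 0" using k by (simp add: K'_def Kii)
      have "(B\<^sup>\<dagger> ** K') $ a $ b =
          (\<Sum>c\<in>UNIV. (if c = a then K' $ c $ b else 0) - (if c = i then cnj (K $ i $ a / of_real k) * K' $ c $ b else 0))"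
        unfolding matrix_mul_nth B_def by (intro sum.cong refl) (auto simp: algebra_simps)
      thus "(B\<^sup>\<dagger> ** K') $ a $ b = K' $ a $ b" by (simp add: sum_subtractf z)
    qed
    ultimately have "psd K'"
      using psd_gram[OF insert.prems(1), of B] by (simp add: matrix_mul_assoc[symmetric])
    moreover have "K' $ a $ b = 0" if "a \<notin> S" for a b
    proof (cases "a = i")
      case True thus ?thesis using k by (simp add: K'_def Kii)
    next
      case False thus ?thesis using insert.prems(2)[of a] that by (simp add: K'_def)
    qed
    ultimately obtain v where v: "\<forall>a b. K' $ a $ b = (\<Sum>i\<in>S. v i $ a * cnj (v i $ b))"
      using insert.IH by blast
    define v' where "v' = v(i := (\<chi> a. K $ a $ i / of_real (sqrt k)))"
    have "K $ a $ b = (\<Sum>k\<in>insert i S. v' k $ a * cnj (v' k $ b))" for a b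
    proof -
      have "(\<Sum>k\<in>insert i S. v' k $ a * cnj (v' k $ b)) = v' i $ a * cnj (v' i $ b) + K' $ a $ b"
        using v insert.hyps by (auto simp: v'_def intro!: sum.cong)
      also have "v' i $ a * cnj (v' i $ b) = K $ a $ i * cnj (K $ b $ i) / of_real (sqrt k * sqrt k)"
        unfolding of_real_mult by (simp add: v'_def del: real_sqrt_mult_self)
      also have "sqrt k * sqrt k = k" using k by simp
      finally show ?thesis using herm[of i b] by (simp add: K'_def)
    qed
    thus ?thesis by blast
  qed
qed

text \<open>Supplies the normalization of the orthogonal polynomials at the finitely many indices
  without a closed form.\<close>

lemma psd_factor:
  assumes "psd (K :: complex^'l^'l)" shows "\<exists>N :: complex^'l^'l. K = N\<^sup>\<dagger> ** N"
proof -
  from psd_factor_aux[OF finite_class.finite_UNIV assms] obtain v :: "'l \<Rightarrow> complex^'l"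
    where v: "\<forall>a b. K $ a $ b = (\<Sum>i\<in>UNIV. v i $ a * cnj (v i $ b))" by auto
  show ?thesis
    by (rule exI[of _ "\<chi> i a. cnj (v i $ a)"], rule mat_eqI) (simp add: v matrix_mul_nth)
qed

text \<open>The equation for s is the fixed point equation s = (E - s^2) / 2, a contraction on the
  Hermitian matrices of norm at most \<open>norm E\<close>. The bound on s lets the root inherit
  exponential decay from \<open>E\<close>.\<close>

lemma hermitian_sqrt_near_1:
  fixes E :: "complex^'l^'l"
  assumes herm: "E\<^sup>\<dagger> = E" and small: "norm E \<le> 1/2"
  shows "\<exists>s. s\<^sup>\<dagger> = s \<and> norm s \<le> norm E \<and> (mat 1 + s) ** (mat 1 + s) = mat 1 + E"
proof -
  define r where "r = norm E"
  define S where "S = cball (0 :: complex^'l^'l) r \<inter> {s. s\<^sup>\<dagger> = s}"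
  define f where "f = (\<lambda>s :: complex^'l^'l. (1/2) *\<^sub>R (E - s ** s))"
  have r: "0 \<le> r" "r \<le> 1/2" using small by (simp_all add: r_def)
  have cl: "closed {s :: complex^'l^'l. s\<^sup>\<dagger> = s}"
    by (intro closed_Collect_eq continuous_intros linear_continuous_on bounded_linear_herm)
  have "complete S" unfolding S_def by (intro closed_Int[THEN complete_eq_closed[THEN iffD2]] closed_cball cl)
  moreover have "0 \<in> S" using r by (simp add: S_def)
  hence "S \<noteq> {}" by blast
  moreover have "f ` S \<subseteq> S"
  proof
    fix t assume "t \<in> f ` S"
    then obtain s where s: "norm s \<le> r" "s\<^sup>\<dagger> = s" and t: "t = f s" by (auto simp: S_def)
    have "norm (E - s ** s) \<le> r + r * r"
      using norm_triangle_ineq4[of E "s ** s"] norm_matrix_mult[of s s] mult_mono[OF s(1) s(1)] r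
      by (simp add: r_def)
    also have "\<dots> \<le> 2 * r" using r mult_left_mono[of r "1/2" r] by simp
    finally have "norm t \<le> r" by (simp add: t f_def)
    moreover have "t\<^sup>\<dagger> = t"
      by (simp add: t f_def herm_scaleR herm_diff herm_mult s herm)
    ultimately show "t \<in> S" by (simp add: S_def)
  qed
  moreover have "dist (f s) (f t) \<le> 1/2 * dist s t" if "s \<in> S" "t \<in> S" for s t
  proof -
    have n: "norm s \<le> 1/2" "norm t \<le> 1/2" using that r by (auto simp: S_def)
    have "f s - f t = (1/2) *\<^sub>R ((t - s) ** t + s ** (t - s))"
      unfolding f_def by (simp add: mm.diff_left mm.diff_right flip: scaleR_diff_right)
    hence "norm (f s - f t) \<le> 1/2 * (norm (t - s) * norm t + norm s * norm (t - s))"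
      using norm_triangle_ineq[of "(t - s) ** t" "s ** (t - s)"]
        norm_matrix_mult[of "t - s" t] norm_matrix_mult[of s "t - s"] by simp
    also have "\<dots> \<le> 1/2 * (norm (t - s) * (1/2) + 1/2 * norm (t - s))"
      by (intro mult_left_mono add_mono mult_right_mono n) auto
    finally show ?thesis by (simp add: dist_norm norm_minus_commute)
  qed
  ultimately have "\<exists>!s. s \<in> S \<and> f s = s" by (intro Banach_fix[of S "1/2" f]) auto
  then obtain s where s: "s \<in> S" "f s = s" by auto
  have "2 *\<^sub>R s = E - s ** s"
    using arg_cong[OF s(2), of "\<lambda>x. 2 *\<^sub>R x"] by (simp add: f_def)
  hence "(mat 1 + s) ** (mat 1 + s) = mat 1 + E"
    by (simp add: mm.add_left mm.add_right scaleR_2 algebra_simps)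
  thus ?thesis using s(1) by (auto simp: S_def r_def)
qed

section \<open>Exponentially decaying sequences\<close>

text \<open>The rate is existential, so that sums of sequences with different rates stay in the
  class.\<close>

definition exp_decay :: "(nat \<Rightarrow> 'a::real_normed_vector) \<Rightarrow> bool"
  where "exp_decay f \<longleftrightarrow> (\<exists>q C. 0 < q \<and> q < 1 \<and> (\<forall>\<^sub>F n in sequentially. norm (f n) \<le> C * q ^ n))"

lemma expdecI: "0 < q \<Longrightarrow> q < 1 \<Longrightarrow> \<forall>\<^sub>F n in sequentially. norm (f n) \<le> C * q ^ n \<Longrightarrow> exp_decay f"
  by (auto simp: exp_decay_def)

lemma expdecE:
  assumes "exp_decay f"
  obtains q C where "0 < q" "q < 1" "0 \<le> C" "\<forall>\<^sub>F n in sequentially. norm (f n) \<le> C * q ^ n"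
proof -
  obtain q C where q: "0 < q" "q < 1" and ev: "\<forall>\<^sub>F n in sequentially. norm (f n) \<le> C * q ^ n"
    using assms by (auto simp: exp_decay_def)
  have "\<forall>\<^sub>F n in sequentially. norm (f n) \<le> \<bar>C\<bar> * q ^ n"
    using ev by eventually_elim (use q in \<open>meson abs_ge_self mult_right_mono order_trans zero_le_power less_imp_le\<close>)
  thus ?thesis using that[of q "\<bar>C\<bar>"] q by auto
qed

lemma exp_decay_le:
  assumes "exp_decay f" "\<forall>\<^sub>F n in sequentially. norm (g n) \<le> c * norm (f n)"
  shows "exp_decay g"
proof -
  obtain q C where q: "0 < q" "q < 1" "0 \<le> C" "\<forall>\<^sub>F n in sequentially. norm (f n) \<le> C * q ^ n"
    using assms(1) by (rule expdecE)
  have "\<forall>\<^sub>F n in sequentially. norm (g n) \<le> \<bar>c\<bar> * C * q ^ n"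
    using q(4) assms(2)
  proof eventually_elim
    case (elim n)
    have "norm (g n) \<le> \<bar>c\<bar> * norm (f n)"
      using elim(2) mult_right_mono[OF abs_ge_self[of c] norm_ge_zero[of "f n"]] by linarith
    also have "\<dots> \<le> \<bar>c\<bar> * (C * q ^ n)" by (intro mult_left_mono elim(1)) auto
    finally show ?case by (simp add: mult.assoc)
  qed
  thus ?thesis using q by (intro expdecI)
qed

lemma exp_decay_cong: "exp_decay f \<Longrightarrow> \<forall>\<^sub>F n in sequentially. g n = f n \<Longrightarrow> exp_decay g"
  by (rule exp_decay_le[where c = 1]) (auto elim: eventually_mono)

lemma exp_decay_zero [simp]: "exp_decay (\<lambda>_. 0)"
  by (rule expdecI[of "1/2" _ 0]) auto

lemma exp_decay_add:
  assumes "exp_decay f" "exp_decay g" shows "exp_decay (\<lambda>n. f n + g n)"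
proof -
  obtain q C where q: "0 < q" "q < 1" "0 \<le> C" "\<forall>\<^sub>F n in sequentially. norm (f n) \<le> C * q ^ n"
    using assms(1) by (rule expdecE)
  obtain p D where p: "0 < p" "p < 1" "0 \<le> D" "\<forall>\<^sub>F n in sequentially. norm (g n) \<le> D * p ^ n"
    using assms(2) by (rule expdecE)
  define m where "m = max p q"
  have "\<forall>\<^sub>F n in sequentially. norm (f n + g n) \<le> (C + D) * m ^ n"
    using q(4) p(4)
  proof eventually_elim
    case (elim n)
    have "q ^ n \<le> m ^ n" "p ^ n \<le> m ^ n" using q p by (auto intro!: power_mono simp: m_def)
    hence "C * q ^ n \<le> C * m ^ n" "D * p ^ n \<le> D * m ^ n" using q p by (auto intro: mult_left_mono)
    thus ?case using elim norm_triangle_ineq[of "f n" "g n"] by (simp add: algebra_simps)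
  qed
  thus ?thesis using p q by (intro expdecI[of m]) (auto simp: m_def)
qed

lemma exp_decay_minus: "exp_decay f \<Longrightarrow> exp_decay (\<lambda>n. - f n)"
  by (erule exp_decay_le[where c = 1]) auto

lemma exp_decay_diff: "exp_decay f \<Longrightarrow> exp_decay g \<Longrightarrow> exp_decay (\<lambda>n. f n - g n)"
  using exp_decay_add[OF _ exp_decay_minus, of f g] by simp

lemma exp_decay_sum: "(\<And>i. i \<in> I \<Longrightarrow> exp_decay (f i)) \<Longrightarrow> exp_decay (\<lambda>n. \<Sum>i\<in>I. f i n)"
  by (induction I rule: infinite_finite_induct) (auto intro: exp_decay_add)

lemma exp_decay_norm: "exp_decay f \<Longrightarrow> exp_decay (\<lambda>n. norm (f n))"
  by (erule exp_decay_le[where c = 1]) auto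

lemma exp_decay_cscale: "exp_decay f \<Longrightarrow> exp_decay (\<lambda>n. c *\<^sub>M f n)"
  by (erule exp_decay_le[where c = "cmod c"]) auto

lemma exp_decay_mult_bounded:
  fixes f g :: "nat \<Rightarrow> complex^'l^'l"
  assumes "exp_decay f" "Bseq g" shows "exp_decay (\<lambda>n. f n ** g n)" "exp_decay (\<lambda>n. g n ** f n)"
proof -
  obtain K where K: "\<And>n. norm (g n) \<le> K" using assms(2) by (auto simp: Bseq_def)
  have "norm (f n ** g n) \<le> K * norm (f n)" "norm (g n ** f n) \<le> K * norm (f n)" for n
    using norm_matrix_mult[of "f n" "g n"] norm_matrix_mult[of "g n" "f n"]
      mult_left_mono[OF K[of n] norm_ge_zero[of "f n"]] mult_right_mono[OF K[of n] norm_ge_zero[of "f n"]]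
    by (simp_all add: mult.commute)
  thus "exp_decay (\<lambda>n. f n ** g n)" "exp_decay (\<lambda>n. g n ** f n)"
    by (auto intro: exp_decay_le[OF assms(1), of _ K])
qed

lemma exp_decay_Suc: assumes "exp_decay f" shows "exp_decay (\<lambda>n. f (Suc n))"
proof -
  obtain q C where q: "0 < q" "q < 1" "0 \<le> C" "\<forall>\<^sub>F n in sequentially. norm (f n) \<le> C * q ^ n"
    using assms(1) by (rule expdecE)
  have "\<forall>\<^sub>F n in sequentially. norm (f (Suc n)) \<le> (C * q) * q ^ n"
    using eventually_all_ge_at_top[OF q(4)] by eventually_elim (simp add: mult.assoc, metis le_SucI le_refl power_Suc)
  thus ?thesis by (rule expdecI[OF q(1,2)])
qed

lemma exp_decay_Suc_iff: "exp_decay (\<lambda>n. f (Suc n)) \<longleftrightarrow> exp_decay f"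
proof
  assume "exp_decay (\<lambda>n. f (Suc n))"
  then obtain q C where q: "0 < q" "q < 1" "0 \<le> C" "\<forall>\<^sub>F n in sequentially. norm (f (Suc n)) \<le> C * q ^ n"
    by (rule expdecE)
  have "\<forall>\<^sub>F n in sequentially. norm (f n) \<le> (C / q) * q ^ n"
    using q(4) q(1) eventually_sequentially_Suc[of "\<lambda>n. norm (f n) \<le> (C / q) * q ^ n"] by simp
  thus "exp_decay f" by (rule expdecI[OF q(1,2)])
qed (rule exp_decay_Suc)

lemma exp_decay_tendsto: assumes "exp_decay f" shows "f \<longlonglongrightarrow> 0"
proof -
  obtain q C where q: "0 < q" "q < 1" "0 \<le> C" "\<forall>\<^sub>F n in sequentially. norm (f n) \<le> C * q ^ n"
    using assms(1) by (rule expdecE)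
  have "(\<lambda>n. C * q ^ n) \<longlonglongrightarrow> 0" using q by (intro tendsto_mult_right_zero LIMSEQ_power_zero) auto
  thus ?thesis by (rule Lim_null_comparison[OF q(4)])
qed

lemma exp_decay_pow: assumes "\<bar>a\<bar> < 1" shows "exp_decay (\<lambda>n. a ^ n :: real)"
proof (rule expdecI[of "max \<bar>a\<bar> (1/2)" _ 1])
  show "\<forall>\<^sub>F n in sequentially. norm (a ^ n) \<le> 1 * max \<bar>a\<bar> (1/2) ^ n"
    by (auto simp: power_abs intro!: always_eventually power_mono)
qed (use assms in auto)

text \<open>The root of order 2n turns q^n into sqrt q, so r = 1 / sqrt q works; constant factors
  disappear in the limit.\<close>

lemma exp_decay_limsup_root:
  assumes "exp_decay (f :: nat \<Rightarrow> real)" and nn: "\<And>n. 0 \<le> f n"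
  shows "\<exists>r>1. limsup (\<lambda>n. ereal (root (2 * n) (f n))) \<le> ereal (1 / r)"
proof -
  obtain q C where q: "0 < q" "q < 1" "0 \<le> C" "\<forall>\<^sub>F n in sequentially. norm (f n) \<le> C * q ^ n"
    using assms(1) by (rule expdecE)
  \<comment> \<open>Strictly positive even when \<open>C\<close> is 0, as the limit of the roots
    requires.\<close>
  define D where "D = C + 1"
  have D: "D > 0" using q by (simp add: D_def)
  have "(\<lambda>n. root n D) \<longlonglongrightarrow> 1" using D by (rule LIMSEQ_root_const)
  hence "(\<lambda>n. root (2 * n) D) \<longlonglongrightarrow> 1"
    by (rule filterlim_compose) (auto intro!: filterlim_subseq simp: strict_mono_def)
  hence lim: "(\<lambda>n. ereal (root (2 * n) D * sqrt q)) \<longlonglongrightarrow> ereal (1 * sqrt q)"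
    by (intro tendsto_intros)
  have "\<forall>\<^sub>F n in sequentially. ereal (root (2 * n) (f n)) \<le> ereal (root (2 * n) D * sqrt q)"
    using q(4) eventually_gt_at_top[of 0]
  proof eventually_elim
    case (elim n)
    have "f n \<le> C * q ^ n" using elim by simp
    also have "\<dots> \<le> D * q ^ n" using q by (intro mult_right_mono) (auto simp: D_def)
    finally have "f n \<le> D * q ^ n" .
    hence "f n \<le> D * sqrt q ^ (2 * n)" using q by (simp add: power_mult)
    hence "root (2 * n) (f n) \<le> root (2 * n) (D * sqrt q ^ (2 * n))"
      using elim by (intro real_root_le_mono) auto
    also have "\<dots> = root (2 * n) D * sqrt q"
      using elim q by (simp add: real_root_mult real_root_power_cancel)
    finally show ?case by simp
  qed
  hence "limsup (\<lambda>n. ereal (root (2 * n) (f n))) \<le> limsup (\<lambda>n. ereal (root (2 * n) D * sqrt q))"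
    by (rule Limsup_mono)
  also have "\<dots> = ereal (sqrt q)" using lim_imp_Limsup[OF _ lim] by simp
  finally show ?thesis using q by (intro exI[of _ "1 / sqrt q"]) simp
qed

text \<open>Neumann series: \<open>D m\<close> is the m-th iterate of the linear part applied to b.
  Row sums of at most 1/2 make it decay geometrically, which also gives the factor 2 in the
  bound.\<close>

lemma finite_linear_system:
  fixes M :: "'i \<Rightarrow> 'i \<Rightarrow> complex^'l^'l" and b :: "'i \<Rightarrow> complex^'l^'l"
  assumes J: "finite J" and M: "\<And>i. i \<in> J \<Longrightarrow> (\<Sum>k\<in>J. norm (M i k)) \<le> 1/2"
    and b: "\<And>i. i \<in> J \<Longrightarrow> norm (b i) \<le> \<beta>"
  shows "\<exists>X. \<forall>i\<in>J. X i = b i + (\<Sum>k\<in>J. M i k ** X k) \<and> norm (X i) \<le> 2 * \<beta>"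
proof -
  define D where "D = (\<lambda>m. ((\<lambda>d i. \<Sum>k\<in>J. M i k ** d k) ^^ m) b)"
  have DS: "D (Suc m) i = (\<Sum>k\<in>J. M i k ** D m k)" for m i by (simp add: D_def)
  have D0: "D 0 = b" by (simp add: D_def)
  have dens: "\<forall>i\<in>J. norm (D m i) \<le> (1/2) ^ m * \<beta>" for m
  proof (induction m)
    case (Suc m)
    show ?case
    proof
      fix i assume i: "i \<in> J"
      have \<beta>: "0 \<le> \<beta>" using b[OF i] norm_ge_zero[of "b i"] by linarith
      have "norm (D (Suc m) i) \<le> (\<Sum>k\<in>J. norm (M i k) * ((1/2) ^ m * \<beta>))"
        unfolding DS using Suc.IH
        by (intro order_trans[OF norm_sum] sum_mono order_trans[OF norm_matrix_mult] mult_left_mono) auto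
      also have "\<dots> = (\<Sum>k\<in>J. norm (M i k)) * ((1/2) ^ m * \<beta>)" by (simp add: sum_distrib_right)
      also have "\<dots> \<le> 1/2 * ((1/2) ^ m * \<beta>)" using M[OF i] \<beta> by (intro mult_right_mono) auto
      finally show "norm (D (Suc m) i) \<le> (1/2) ^ Suc m * \<beta>" by simp
    qed
  qed (use b in \<open>simp add: D0\<close>)
  have geo: "(\<lambda>m. (1/2 :: real) ^ m * \<beta>) sums (2 * \<beta>)"
    using sums_mult2[OF geometric_sums[of "1/2 :: real"], of \<beta>] by simp
  have sm: "summable (\<lambda>m. D m i)" if "i \<in> J" for i
    by (rule summable_comparison_test[OF _ sums_summable[OF geo]]) (use dens that in auto)
  define X where "X = (\<lambda>i. \<Sum>m. D m i)"
  have "X i = b i + (\<Sum>k\<in>J. M i k ** X k)" if i: "i \<in> J" for i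
  proof -
    have "X i = D 0 i + (\<Sum>m. D (Suc m) i)"
      unfolding X_def using suminf_split_head[OF sm[OF i]] by simp
    also have "(\<Sum>m. D (Suc m) i) = (\<Sum>k\<in>J. \<Sum>m. M i k ** D m k)"
      unfolding DS by (rule suminf_sum) (intro bounded_linear.summable[OF mm.bounded_linear_right] sm)
    also have "\<dots> = (\<Sum>k\<in>J. M i k ** X k)"
      unfolding X_def by (intro sum.cong refl bounded_linear.suminf[OF mm.bounded_linear_right, symmetric] sm)
    finally show ?thesis by (simp add: D0)
  qed
  moreover have "norm (X i) \<le> 2 * \<beta>" if i: "i \<in> J" for i
  proof -
    have "norm (X i) \<le> (\<Sum>m. (1/2) ^ m * \<beta>)"
      unfolding X_def using dens i by (intro norm_suminf_le sums_summable[OF geo]) auto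
    thus ?thesis using sums_unique[OF geo] by simp
  qed
  ultimately show ?thesis by blast
qed

section \<open>Simple poles inside the unit circle\<close>

lemma circle_integral_simple_poles:
  assumes S: "open S" "cball 0 1 \<subseteq> S" and H: "H holomorphic_on S"
    and F: "finite F" "F \<subseteq> ball 0 1"
  shows "((\<lambda>z. H z / (\<Prod>a\<in>F. z - a)) has_contour_integral
    (2 * pi * \<i> * (\<Sum>a\<in>F. H a / (\<Prod>b\<in>F - {a}. a - b)))) (circlepath 0 1)"
proof -
  obtain e where e: "e > 0" "(\<Union>x\<in>cball 0 1. cball x e) \<subseteq> S"
    using compact_subset_open_imp_cball_epsilon_subset[OF compact_cball S] by blast
  \<comment> \<open>\<open>S\<close> may be disconnected. The residue theorem needs a connected
    domain outside of which the winding number of the circle vanishes, and a slightly larger disk is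
    one.\<close>
  define T where "T = ball (0::complex) (1 + e)"
  have TS: "T \<subseteq> S"
  proof
    fix z assume z: "z \<in> T"
    show "z \<in> S"
    proof (cases "norm z \<le> 1")
      case True thus ?thesis using S by auto
    next
      case False
      have "dist (z / of_real (norm z)) z = norm z - 1"
      proof -
        have "z / of_real (norm z) - z = z / of_real (norm z) * (1 - of_real (norm z))"
          using False by (auto simp: right_diff_distrib)
        hence "norm (z / of_real (norm z) - z) = norm (1 - of_real (norm z) :: complex)"
          using False by (auto simp: norm_mult norm_divide)
        also have "\<dots> = \<bar>1 - norm z\<bar>" by (metis norm_of_real of_real_1 of_real_diff)
        finally show ?thesis using False by (simp add: dist_norm)
      qed
      moreover have "z / of_real (norm z) \<in> cball 0 1" using False by (auto simp: norm_divide)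
      ultimately show ?thesis using e z by (fastforce simp: T_def)
    qed
  qed
  define f where "f = (\<lambda>z. H z / (\<Prod>a\<in>F. z - a))"
  have HT: "H holomorphic_on T" using H TS by (rule holomorphic_on_subset)
  have holo: "f holomorphic_on T - F"
    unfolding f_def using F by (intro holomorphic_intros holomorphic_on_subset[OF HT]) auto
  have pi: "path_image (circlepath 0 1) \<subseteq> T - F"
    using F e by (auto simp: T_def path_image_circlepath)
  have wn: "winding_number (circlepath 0 1) a = 1" if "a \<in> F" for a
    using F that by (intro winding_number_circlepath) auto
  have res: "residue f a = H a / (\<Prod>b\<in>F - {a}. a - b)" if a: "a \<in> F" for a
  proof -
    define G where "G = (\<lambda>z. H z / (\<Prod>b\<in>F - {a}. z - b))"
    have "f = (\<lambda>z. G z / (z - a))"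
      unfolding f_def G_def using prod.remove[OF F(1) a, of "\<lambda>b. _ - b"] by (auto simp: fun_eq_iff)
    moreover have "residue (\<lambda>z. G z / (z - a)) a = G a"
    proof (rule residue_simple)
      show "open (T - (F - {a}))" using F by (intro open_Diff finite_imp_closed) (auto simp: T_def)
      show "a \<in> T - (F - {a})" using F a e by (auto simp: T_def)
      show "G holomorphic_on T - (F - {a})" unfolding G_def using F
        by (intro holomorphic_intros holomorphic_on_subset[OF HT]) auto
    qed
    ultimately show ?thesis by (simp add: G_def)
  qed
  have "contour_integral (circlepath 0 1) f = 2 * pi * \<i> * (\<Sum>a\<in>F. winding_number (circlepath 0 1) a * residue f a)"
  proof (rule Residue_theorem[OF _ _ F(1) holo _ _ pi])
    show "\<forall>z. z \<notin> T \<longrightarrow> winding_number (circlepath 0 1) z = 0"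
      using e by (auto intro!: winding_number_zero_outside[of _ "cball 0 1"] simp: T_def path_image_circlepath)
  qed (auto simp: T_def)
  also have "\<dots> = 2 * pi * \<i> * (\<Sum>a\<in>F. H a / (\<Prod>b\<in>F - {a}. a - b))"
    by (simp add: wn res)
  finally have *: "contour_integral (circlepath 0 1) f = \<dots>" .
  have "f contour_integrable_on circlepath 0 1"
    using F e by (intro contour_integrable_holomorphic_simple[OF holo _ _ pi]) 
      (auto simp: T_def intro!: open_Diff finite_imp_closed)
  thus ?thesis using * has_contour_integral_integral unfolding f_def by fastforce
qed

section \<open>Matrix polynomials of a real variable\<close>

text \<open>The Chebyshev polynomial of the second kind U_(n-1) at x/2. The shifted index keeps the
  degree of \<open>cheb n\<close> below n.\<close>

fun cheb :: "nat \<Rightarrow> real \<Rightarrow> real" where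
  "cheb 0 x = 0"
| "cheb (Suc 0) x = 1"
| "cheb (Suc (Suc n)) x = x * cheb (Suc n) x - cheb n x"

lemma cheb_eq:
  fixes z :: complex
  assumes "z \<noteq> 0" "z + inverse z = of_real x"
  shows "of_real (cheb n x) * (z - inverse z) = z ^ n - inverse z ^ n"
  using assms
proof (induction n x rule: cheb.induct)
  case (3 n x)
  have "of_real (cheb (Suc (Suc n)) x) * (z - inverse z)
      = of_real x * (of_real (cheb (Suc n) x) * (z - inverse z)) - of_real (cheb n x) * (z - inverse z)"
    by (simp add: algebra_simps)
  also have "\<dots> = (z + inverse z) * (z ^ Suc n - inverse z ^ Suc n) - (z ^ n - inverse z ^ n)"
    unfolding 3(1)[OF 3(3,4)] 3(2)[OF 3(3,4)] 3(4) ..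
  also have "\<dots> = z ^ Suc (Suc n) - inverse z ^ Suc (Suc n)"
    using 3(3) by (simp add: algebra_simps) (simp add: mult.assoc[symmetric])
  finally show ?case .
qed auto

text \<open>A predicate on functions instead of a type of matrix polynomials, since the arguments of
  the integrals below are functions. Coefficients are arbitrary matrices, and
  \<open>deg_lt 0\<close> leaves only the zero function.\<close>

definition deg_lt :: "nat \<Rightarrow> (real \<Rightarrow> complex^'l^'l) \<Rightarrow> bool"
  where "deg_lt n F \<longleftrightarrow> (\<exists>c :: nat \<Rightarrow> complex^'l^'l. \<forall>x. F x = (\<Sum>k<n. x ^ k *\<^sub>R c k))"

lemma deg_lt_zero [simp]: "deg_lt n (\<lambda>_. 0)"
  unfolding deg_lt_def by (rule exI[of _ "\<lambda>_. 0"]) simp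

lemma deg_lt_0D: "deg_lt 0 F \<Longrightarrow> F x = 0"
  by (auto simp: deg_lt_def)

lemma deg_lt_monom: "k < n \<Longrightarrow> deg_lt n (\<lambda>x. x ^ k *\<^sub>R C)"
  unfolding deg_lt_def
  by (rule exI[of _ "\<lambda>i. if i = k then C else 0"]) (simp add: if_distrib cong: if_cong)

lemma deg_lt_const: "0 < n \<Longrightarrow> deg_lt n (\<lambda>_. C)"
  using deg_lt_monom[of 0 n C] by simp

lemma deg_lt_mono: "deg_lt m F \<Longrightarrow> m \<le> n \<Longrightarrow> deg_lt n F"
proof -
  assume "deg_lt m F" "m \<le> n"
  then obtain c where c: "\<forall>x. F x = (\<Sum>k<m. x ^ k *\<^sub>R c k)" by (auto simp: deg_lt_def)
  have "F x = (\<Sum>k<n. x ^ k *\<^sub>R (if k < m then c k else 0))" for x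
    unfolding c[rule_format] using \<open>m \<le> n\<close> by (intro sum.mono_neutral_cong_left) auto
  thus ?thesis unfolding deg_lt_def by (intro exI[of _ "\<lambda>k. if k < m then c k else 0"]) auto
qed

lemma deg_lt_add: "deg_lt n F \<Longrightarrow> deg_lt n G \<Longrightarrow> deg_lt n (\<lambda>x. F x + G x)"
proof -
  assume "deg_lt n F" "deg_lt n G"
  then obtain c d where "\<forall>x. F x = (\<Sum>k<n. x ^ k *\<^sub>R c k)" "\<forall>x. G x = (\<Sum>k<n. x ^ k *\<^sub>R d k)"
    by (auto simp: deg_lt_def)
  thus ?thesis unfolding deg_lt_def
    by (intro exI[of _ "\<lambda>k. c k + d k"]) (simp add: scaleR_add_right sum.distrib)
qed

lemma deg_lt_linear:
  assumes "bounded_linear f" "deg_lt n F" shows "deg_lt n (\<lambda>x. f (F x))"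
proof -
  interpret bounded_linear f by fact
  obtain c where "\<forall>x. F x = (\<Sum>k<n. x ^ k *\<^sub>R c k)" using assms(2) by (auto simp: deg_lt_def)
  thus ?thesis unfolding deg_lt_def by (intro exI[of _ "\<lambda>k. f (c k)"]) (simp add: sum scaleR)
qed

lemma deg_lt_mult_right: "deg_lt n F \<Longrightarrow> deg_lt n (\<lambda>x. F x ** C)"
  by (rule deg_lt_linear[OF mm.bounded_linear_left])

lemma deg_lt_minus: "deg_lt n F \<Longrightarrow> deg_lt n (\<lambda>x. - F x)"
  by (rule deg_lt_linear[OF bounded_linear_minus[OF bounded_linear_ident]])

lemma deg_lt_diff: "deg_lt n F \<Longrightarrow> deg_lt n G \<Longrightarrow> deg_lt n (\<lambda>x. F x - G x)"
  using deg_lt_add[OF _ deg_lt_minus, of n F G] by simp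

lemma deg_lt_sum: "(\<And>i. i \<in> I \<Longrightarrow> deg_lt n (F i)) \<Longrightarrow> deg_lt n (\<lambda>x. \<Sum>i\<in>I. F i x)"
  by (induction I rule: infinite_finite_induct) (auto intro: deg_lt_add)

lemma deg_lt_X: "deg_lt n F \<Longrightarrow> deg_lt (Suc n) (\<lambda>x. x *\<^sub>R F x)"
proof -
  assume "deg_lt n F"
  then obtain c where c: "\<forall>x. F x = (\<Sum>k<n. x ^ k *\<^sub>R c k)" by (auto simp: deg_lt_def)
  show ?thesis unfolding deg_lt_def
  proof (intro exI[of _ "\<lambda>k. if k = 0 then 0 else c (k - 1)"] allI)
    fix x show "x *\<^sub>R F x = (\<Sum>k<Suc n. x ^ k *\<^sub>R (if k = 0 then 0 else c (k - 1)))"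
      unfolding c[rule_format] by (subst sum.lessThan_Suc_shift) (simp add: scaleR_sum_right)
  qed
qed

lemma deg_lt_continuous: assumes "deg_lt n F" shows "continuous_on A F"
proof -
  obtain c where "\<And>x. F x = (\<Sum>k<n. x ^ k *\<^sub>R c k)" using assms by (auto simp: deg_lt_def)
  hence "F = (\<lambda>x. \<Sum>k<n. x ^ k *\<^sub>R c k)" by auto
  thus ?thesis by (simp only:) (intro continuous_intros)
qed

lemma deg_lt_cheb: "deg_lt n (\<lambda>x. cheb n x *\<^sub>R C)"
proof (induction n rule: induct_nat_012)
  case (ge2 n)
  have "deg_lt (Suc (Suc n)) (\<lambda>x. x *\<^sub>R (cheb (Suc n) x *\<^sub>R C) - cheb n x *\<^sub>R C)"
    using ge2 by (intro deg_lt_diff deg_lt_X) (auto elim: deg_lt_mono)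
  thus ?case by (simp add: scaleR_diff_left)
qed (auto intro: deg_lt_const)

lemma deg_lt_cheb_lead: "deg_lt n (\<lambda>x. cheb (Suc n) x *\<^sub>R C - x ^ n *\<^sub>R C)"
proof (induction n)
  case (Suc n)
  have "deg_lt (Suc n) (\<lambda>x. x *\<^sub>R (cheb (Suc n) x *\<^sub>R C - x ^ n *\<^sub>R C) - cheb n x *\<^sub>R C)"
    using Suc by (intro deg_lt_diff[OF deg_lt_X deg_lt_mono[OF deg_lt_cheb]]) auto
  thus ?case by (simp add: scaleR_diff_left scaleR_diff_right algebra_simps)
qed simp

text \<open>A component with \<open>v $ i\<close> nonzero turns \<open>F x *v v\<close> into a
  scalar polynomial with leading coefficient \<open>v $ i\<close>. This later excludes a degenerate
  Gram matrix.\<close>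

lemma monic_finite_zeros:
  fixes F :: "real \<Rightarrow> complex^'l^'l"
  assumes F: "deg_lt n (\<lambda>x. F x - x ^ n *\<^sub>R mat 1)" and v: "v \<noteq> 0"
  shows "finite {x. F x *v v = 0}"
proof -
  obtain c where c: "\<And>x. F x - x ^ n *\<^sub>R mat 1 = (\<Sum>k<n. x ^ k *\<^sub>R c k)"
    using F by (auto simp: deg_lt_def)
  obtain i where i: "v $ i \<noteq> 0" using v by (metis vec_eq_iff zero_index)
  define d where "d k = (if k = n then v $ i else (c k *v v) $ i)" for k
  have eq: "(F x *v v) $ i = (\<Sum>k\<le>n. d k * of_real x ^ k)" for x
  proof -
    have "F x = (\<Sum>k<n. x ^ k *\<^sub>R c k) + x ^ n *\<^sub>R mat 1" using c[of x] by (simp add: algebra_simps)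
    hence "F x *v v = (\<Sum>k<n. x ^ k *\<^sub>R (c k *v v)) + x ^ n *\<^sub>R v"
      by (simp add: mv.add_left mv.sum_left mv.scaleR_left)
    hence "(F x *v v) $ i = (\<Sum>k<n. of_real x ^ k * (c k *v v) $ i) + of_real x ^ n * v $ i"
      by (simp add: scaleR_conv_of_real[where 'a = complex])
    also have "\<dots> = (\<Sum>k\<le>n. d k * of_real x ^ k)"
      by (simp add: lessThan_Suc_atMost[symmetric] d_def mult.commute)
    finally show ?thesis .
  qed
  have "finite {z. (\<Sum>k\<le>n. d k * z ^ k) = 0}"
    unfolding polyfun_finite_roots using i by (intro exI[of _ n]) (simp add: d_def)
  hence "finite (complex_of_real -` {z. (\<Sum>k\<le>n. d k * z ^ k) = 0})"
    by (rule finite_vimageI) (auto intro: injI)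
  thus ?thesis by (rule rev_finite_subset) (auto simp flip: eq)
qed

section \<open>Zeros of the Jost function\<close>

lemma eventually_not_in_finite:
  fixes a :: "'a::t1_space"
  assumes "finite A" shows "\<forall>\<^sub>F s in at a. s \<notin> A"
proof -
  have "open (- (A - {a}))" using assms by (intro open_Compl finite_imp_closed) auto
  thus ?thesis unfolding eventually_at_topological by (intro exI[of _ "- (A - {a})"]) auto
qed

lemma tendsto_matI:
  "(\<And>i j. ((\<lambda>x. f x $ i $ j) \<longlongrightarrow> l $ i $ j) F) \<Longrightarrow> (f \<longlongrightarrow> (l :: complex^'n^'m)) F"
  by (intro vec_tendstoI)

lemma tendsto_mat_nth:
  "(f \<longlongrightarrow> (l :: complex^'n^'m)) F \<Longrightarrow> ((\<lambda>x. f x $ i $ j) \<longlongrightarrow> l $ i $ j) F"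
  by (intro tendsto_vec_nth)

lemma det_poly: "poly (det (F :: complex poly^'l^'l)) z = det (eval_mat F z)"
  unfolding det_def by (simp add: poly_sum poly_prod)

locale jost_data =
  fixes p :: "complex poly^'l^'l"
    and u :: "complex \<Rightarrow> complex^'l^'l"
    and w :: "real \<Rightarrow> complex^'l^'l"
  assumes u_poly: "u = eval_mat p"
    and u_sym: "\<And>z. z \<noteq> 0 \<Longrightarrow>
      (u (1 / cnj z))\<^sup>\<dagger> ** u z = ((u (1 / z))\<^sup>\<dagger> ** u (cnj z))\<^sup>\<dagger>"
    and u_inv: "\<And>z. z \<in> (cball 0 1 - \<real>) \<union> {0} \<Longrightarrow> invertible (u z)"
    and u_simple: "\<And>z. z \<in> cball 0 1 \<inter> \<real> \<Longrightarrow> mat_zero u z \<Longrightarrow> simple_mat_zero u z"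
    and weights: "\<And>x. x \<in> real_zeros u \<Longrightarrow>
      psd (w x) \<and> range ((*v) (w x)) = {v. u (of_real x) *v v = 0}"
    and total: "(\<Sum>x\<in>real_zeros u. w x) + (2 / pi) *\<^sub>R
      integral {0..pi} (\<lambda>\<theta>. (sin \<theta>)\<^sup>2 *\<^sub>R matrix_inv ((u (cis \<theta>))\<^sup>\<dagger> ** u (cis \<theta>))) = mat 1"
begin

abbreviation "det_u \<equiv> det p"

lemma det_u_eval: "poly det_u z = det (u z)"
  by (simp add: det_poly u_poly)

lemma inv_iff: "invertible (u z) \<longleftrightarrow> poly det_u z \<noteq> 0"
  by (simp add: det_u_eval invertible_det_nz)

lemma det_u_nz: "det_u \<noteq> 0"
  using u_inv[of 0] inv_iff[of 0] by auto

lemma finite_singular: "finite {z. \<not> invertible (u z)}"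
  using poly_roots_finite[OF det_u_nz] by (simp add: inv_iff)

lemma ev_invertible: "\<forall>\<^sub>F s in at a. invertible (u s)"
  using eventually_not_in_finite[OF finite_singular, of a] by simp

lemma tendsto_u: "(u \<longlongrightarrow> u a) (at a)"
  by (intro tendsto_matI) (auto simp: u_poly intro!: tendsto_intros)

text \<open>Numerators of Cramer's rule. They show the entries of the inverse of \<open>u\<close> to
  be rational functions, hence without essential singularities.\<close>

definition cof :: "'l \<Rightarrow> 'l \<Rightarrow> complex poly" where
  "cof k j = det (\<chi> i' j'. if j' = k then axis j 1 $ i' else p $ i' $ j')"

lemma inv_entry:
  assumes "invertible (u z)"
  shows "matrix_inv (u z) $ k $ j = poly (cof k j) z / poly det_u z"
proof -
  have d: "det (u z) \<noteq> 0" using assms by (simp add: invertible_det_nz)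
  have "u z *v (matrix_inv (u z) *v axis j 1) = axis j 1"
    by (simp add: matrix_vector_mul_assoc mat_inv_r[OF assms])
  hence "matrix_inv (u z) *v axis j 1 = (\<chi> k. det (\<chi> i' j'. if j' = k then axis j 1 $ i' else u z $ i' $ j') / det (u z))"
    using cramer[OF d] by blast
  moreover have "(matrix_inv (u z) *v axis j 1) $ k = matrix_inv (u z) $ k $ j"
    by (simp add: matrix_vector_mult_def axis_def if_distrib cong: if_cong)
  ultimately have "matrix_inv (u z) $ k $ j = det (\<chi> i' j'. if j' = k then axis j 1 $ i' else u z $ i' $ j') / det (u z)"
    by simp
  also have "(\<chi> i' j'. if j' = k then axis j 1 $ i' else u z $ i' $ j')
      = eval_mat (\<chi> i' j'. if j' = k then axis j 1 $ i' else p $ i' $ j') z"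
    by (rule mat_eqI) (simp add: u_poly axis_def)
  finally show ?thesis by (simp add: cof_def det_poly u_poly)
qed

lemma holo_inv: "(\<lambda>z. matrix_inv (u z) $ i $ j) holomorphic_on {z. invertible (u z)}"
proof -
  have "(\<lambda>z. poly (cof i j) z / poly det_u z) holomorphic_on {z. invertible (u z)}"
    by (intro holomorphic_intros) (simp add: inv_iff)
  thus ?thesis by (rule holomorphic_transform) (simp add: inv_entry)
qed

lemma open_inv: "open {z. invertible (u z)}"
proof -
  have "{z. invertible (u z)} = - {z. \<not> invertible (u z)}" by auto
  thus ?thesis using finite_singular by (simp add: finite_imp_closed open_Compl)
qed

lemma tendsto_inv:
  assumes "invertible (u z)"
  shows "((\<lambda>s. matrix_inv (u s)) \<longlongrightarrow> matrix_inv (u z)) (at z)"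
proof (rule tendsto_matI)
  fix i j
  have "continuous (at z) (\<lambda>z. matrix_inv (u z) $ i $ j)"
    using holomorphic_on_imp_continuous_on[OF holo_inv] assms open_inv
    by (simp add: continuous_on_eq_continuous_at)
  thus "((\<lambda>s. matrix_inv (u s) $ i $ j) \<longlongrightarrow> matrix_inv (u z) $ i $ j) (at z)"
    by (simp add: isCont_def)
qed

text \<open>If v is a unit of measure in the kernel of \<open>u z\<close>, the inverse has norm at
  least \<open>norm v / norm (u s *v v)\<close>, which tends to infinity. At an invertible value the
  inverse is continuous.\<close>

lemma mat_zero_iff: "mat_zero u z \<longleftrightarrow> \<not> invertible (u z)"
proof
  assume "mat_zero u z"
  show "\<not> invertible (u z)"
  proof
    assume iz: "invertible (u z)"
    note tendsto_inv[OF iz]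
    hence "\<not> filterlim (\<lambda>s. matrix_inv (u s)) at_infinity (at z)"
      using not_tendsto_and_filterlim_at_infinity[OF at_neq_bot] by blast
    thus False using \<open>mat_zero u z\<close> by (simp add: mat_zero_def is_pole_def)
  qed
next
  assume "\<not> invertible (u z)"
  then obtain v where v: "v \<noteq> 0" "u z *v v = 0"
    by (metis invertible_left_inverse matrix_left_invertible_ker invertible_def)
  have "filterlim (\<lambda>s. norm (matrix_inv (u s))) at_top (at z)"
  proof (rule filterlim_at_top_mono[where f = "\<lambda>s. norm v / norm (u s *v v)"])
    have "((\<lambda>s. norm (u s *v v)) \<longlongrightarrow> norm (u z *v v)) (at z)"
      by (intro tendsto_norm mv.tendsto tendsto_u tendsto_const)
    hence lim: "((\<lambda>s. norm (u s *v v)) \<longlongrightarrow> 0) (at z)" using v by simp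
    have "\<forall>\<^sub>F s in at z. norm (u s *v v) \<noteq> 0"
      using ev_invertible
    proof eventually_elim
      case (elim s)
      show ?case
      proof
        assume "norm (u s *v v) = 0"
        hence "matrix_inv (u s) *v (u s *v v) = 0" by simp
        thus False using v elim by (simp add: matrix_vector_mul_assoc mat_inv_l)
      qed
    qed
    hence "filterlim (\<lambda>s. norm (u s *v v)) (at_right 0) (at z)"
      using lim by (simp add: filterlim_at eventually_mono)
    thus "filterlim (\<lambda>s. norm v / norm (u s *v v)) at_top (at z)"
      unfolding divide_inverse using v
      by (intro filterlim_tendsto_pos_mult_at_top[OF tendsto_const]
          filterlim_compose[OF filterlim_inverse_at_top_right]) auto
    show "\<forall>\<^sub>F s in at z. norm v / norm (u s *v v) \<le> norm (matrix_inv (u s))"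
      using ev_invertible
    proof eventually_elim
      case (elim s)
      have "v = matrix_inv (u s) *v (u s *v v)"
        using elim by (simp add: matrix_vector_mul_assoc mat_inv_l)
      hence "norm v \<le> norm (matrix_inv (u s)) * norm (u s *v v)"
        using norm_mult_vec by metis
      thus ?case by (cases "u s *v v = 0") (simp_all add: field_simps)
    qed
  qed
  thus "mat_zero u z" unfolding mat_zero_def is_pole_def
    by (simp add: filterlim_at_infinity_conv_norm_at_top)
qed

text \<open>Entrywise, a rational function has a pole or a finite limit. In the first case the pole
  is simple by hypothesis, in the second the factor s - a makes the limit 0.\<close>

lemma residue_exists:
  assumes a: "a \<in> cball 0 1" "\<not> invertible (u a)"
  shows "\<exists>R. ((\<lambda>s. (s - a) *\<^sub>M matrix_inv (u s)) \<longlongrightarrow> R) (at a)"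
proof -
  have "a \<in> \<real>" using a u_inv by blast
  hence smp: "simple_mat_zero u a" using a u_simple by (auto simp: mat_zero_iff)
  have ex: "\<exists>l. ((\<lambda>s. (s - a) * matrix_inv (u s) $ i $ j) \<longlongrightarrow> l) (at a)" for i j
  proof (cases "is_pole (\<lambda>s. matrix_inv (u s) $ i $ j) a")
    case True
    hence zo: "zorder (\<lambda>s. matrix_inv (u s) $ i $ j) a = -1"
      using smp by (simp add: simple_mat_zero_def)
    define S where "S = - ({z. \<not> invertible (u z)} - {a})"
    have S: "open S" "a \<in> S"
      using open_Compl[OF finite_imp_closed[OF finite_Diff[OF finite_singular, of "{a}"]]]
      by (simp_all only: S_def) auto
    have holo: "(\<lambda>s. matrix_inv (u s) $ i $ j) holomorphic_on S - {a}"
      by (rule holomorphic_on_subset[OF holo_inv]) (auto simp: S_def)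
    from zorder_exist_pole[OF holo S True] obtain r g where r: "r > 0"
      and g: "g holomorphic_on cball a r"
      and eq: "\<forall>z\<in>cball a r - {a}. matrix_inv (u z) $ i $ j = g z / (z - a) ^ nat (- zorder (\<lambda>s. matrix_inv (u s) $ i $ j) a)"
      by blast
    have "(g \<longlongrightarrow> g a) (at a)"
      using holomorphic_on_imp_continuous_on[OF g] r
      by (metis ball_subset_cball centre_in_ball continuous_on_interior isCont_def interior_cball)
    moreover have "\<forall>\<^sub>F s in at a. g s = (s - a) * matrix_inv (u s) $ i $ j"
      unfolding eventually_at
      by (intro exI[of _ r]) (use eq zo r in \<open>auto simp: dist_commute\<close>)
    ultimately have "((\<lambda>s. (s - a) * matrix_inv (u s) $ i $ j) \<longlongrightarrow> g a) (at a)"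
      by (rule Lim_transform_eventually)
    thus ?thesis by blast
  next
    case False
    have an: "(\<lambda>s. poly P s) analytic_on {a}" for P :: "complex poly"
      by (rule holomorphic_on_imp_analytic_at[of _ UNIV]) (auto intro!: holomorphic_intros)
    have ne: "not_essential (\<lambda>s. poly (cof i j) s / poly det_u s) a"
      by (intro not_essential_divide not_essential_analytic isolated_singularity_at_analytic an)
    have ev: "\<forall>\<^sub>F s in at a. poly (cof i j) s / poly det_u s = matrix_inv (u s) $ i $ j"
      using ev_invertible[of a] by eventually_elim (simp add: inv_entry)
    have "\<not> is_pole (\<lambda>s. poly (cof i j) s / poly det_u s) a"
      using False is_pole_cong[OF ev refl] by simp
    then obtain l where "((\<lambda>s. poly (cof i j) s / poly det_u s) \<longlongrightarrow> l) (at a)"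
      using ne by (auto simp: not_essential_def)
    hence "((\<lambda>s. matrix_inv (u s) $ i $ j) \<longlongrightarrow> l) (at a)"
      using ev by (rule Lim_transform_eventually)
    hence "((\<lambda>s. (s - a) * matrix_inv (u s) $ i $ j) \<longlongrightarrow> (a - a) * l) (at a)"
      by (intro tendsto_intros)
    thus ?thesis by blast
  qed
  define R where "R = (\<chi> i j. SOME l. ((\<lambda>s. (s - a) * matrix_inv (u s) $ i $ j) \<longlongrightarrow> l) (at a))"
  have "((\<lambda>s. (s - a) * matrix_inv (u s) $ i $ j) \<longlongrightarrow> R $ i $ j) (at a)" for i j
    unfolding R_def using someI_ex[OF ex] by simp
  thus ?thesis by (intro exI[of _ R] tendsto_matI) simp
qed

abbreviation "Z \<equiv> real_zeros u"

lemma Z_iff: "a \<in> Z \<longleftrightarrow> -1 < a \<and> a < 1 \<and> \<not> invertible (u (of_real a))"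
  by (simp add: real_zeros_def mat_zero_iff)

lemma Z_props:
  assumes "a \<in> Z"
  shows "\<bar>a\<bar> < 1" "a \<noteq> 0" "\<not> invertible (u (of_real a))" "complex_of_real a \<in> ball 0 1" "a\<^sup>2 < 1"
    "of_real a - inverse (of_real a) \<noteq> (0::complex)"
proof -
  show 1: "\<bar>a\<bar> < 1" "\<not> invertible (u (of_real a))" using assms by (auto simp: Z_iff)
  show 2: "a \<noteq> 0" using 1(2) u_inv[of 0] by (metis UnCI insertI1 of_real_0)
  show "complex_of_real a \<in> ball 0 1" using 1 by simp
  show a2: "a\<^sup>2 < 1" using 1 by (simp add: abs_square_less_1)
  show "of_real a - inverse (of_real a) \<noteq> (0::complex)"
  proof
    assume "of_real a - inverse (of_real a) = (0::complex)"
    hence "complex_of_real (a * a) = 1" using 2 by (simp add: field_simps)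
    hence "a * a = 1" by (metis of_real_eq_1_iff)
    thus False using a2 by (simp add: power2_eq_square)
  qed
qed

lemma finite_Z: "finite Z"
proof -
  have "Z \<subseteq> complex_of_real -` {z. \<not> invertible (u z)}" by (auto simp: Z_iff)
  moreover have "finite (complex_of_real -` {z. \<not> invertible (u z)})"
    by (rule finite_vimageI[OF finite_singular]) (auto intro: injI)
  ultimately show ?thesis by (rule finite_subset)
qed

lemma singular_cball: "z \<in> cball 0 1 \<Longrightarrow> \<not> invertible (u z) \<Longrightarrow>
    z = 1 \<or> z = -1 \<or> (\<exists>a\<in>Z. z = of_real a)"
proof -
  assume z: "z \<in> cball 0 1" "\<not> invertible (u z)"
  hence "z \<in> \<real>" using u_inv by blast
  then obtain a where a: "z = of_real a" by (auto elim: Reals_cases)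
  hence "\<bar>a\<bar> \<le> 1" using z by simp
  thus ?thesis using z a by (cases "\<bar>a\<bar> < 1") (auto simp: Z_iff abs_if split: if_splits)
qed

section \<open>Holomorphic extension of the inverse of \<open>u\<close> across the closed
  disk\<close>

definition pZ :: "complex \<Rightarrow> complex" where "pZ z = (\<Prod>a\<in>of_real ` Z. z - a)"
definition q :: "complex \<Rightarrow> complex" where "q z = (z\<^sup>2 - 1) * pZ z"
text \<open>\<open>q\<close> vanishes at every zero that \<open>u\<close> can have in the closed
  disk, including 1 and -1. All zeros are simple, so the product has removable singularities there,
  and the limit fills them in.\<close>

definition L :: "complex \<Rightarrow> complex^'l^'l" where "L z = Lim (at z) (\<lambda>s. q s *\<^sub>M matrix_inv (u s))"
definition R :: "real \<Rightarrow> complex^'l^'l" where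
  "R a = Lim (at (of_real a)) (\<lambda>s. (s - of_real a) *\<^sub>M matrix_inv (u s))"
text \<open>Nothing is assumed about zeros of \<open>u\<close> outside the closed disk. Omitting
  these finitely many points leaves an open neighbourhood of the disk.\<close>

definition S0 :: "complex set" where "S0 = {z. invertible (u z)} \<union> cball 0 1"

lemma pZ_0_iff: "pZ z = 0 \<longleftrightarrow> z \<in> of_real ` Z"
  using finite_Z by (auto simp: pZ_def)

lemma q_holo [holomorphic_intros]: "q holomorphic_on A"
  unfolding q_def pZ_def by (intro holomorphic_intros)

lemma q_cont: "isCont q z"
  using holomorphic_on_imp_continuous_on[OF q_holo[of UNIV]] by (simp add: continuous_on_eq_continuous_at)

lemma S0_open: "open S0"
proof -
  have "S0 = - ({z. \<not> invertible (u z)} - cball 0 1)" by (auto simp: S0_def)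
  thus ?thesis by (simp only:) (intro open_Compl finite_imp_closed finite_Diff finite_singular)
qed

lemma tendsto_R:
  assumes "a \<in> Z"
  shows "((\<lambda>s. (s - of_real a) *\<^sub>M matrix_inv (u s)) \<longlongrightarrow> R a) (at (of_real a))"
proof -
  from residue_exists[of "of_real a"] Z_props[OF assms]
  obtain R' where R': "((\<lambda>s. (s - of_real a) *\<^sub>M matrix_inv (u s)) \<longlongrightarrow> R') (at (of_real a))" by auto
  have "R a = R'" unfolding R_def by (rule tendsto_Lim[OF at_neq_bot R'])
  thus ?thesis using R' by simp
qed

lemma q_factor:
  assumes "a \<in> cball 0 1" "\<not> invertible (u a)"
  shows "\<exists>g. isCont g a \<and> (\<forall>s. q s = g s * (s - a))"
proof -
  consider "a = 1" | "a = -1" | b where "b \<in> Z" "a = of_real b" using singular_cball[OF assms] by blast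
  thus ?thesis
  proof cases
    case 1
    have "q s = ((s + 1) * pZ s) * (s - a)" for s by (simp add: q_def 1 power2_eq_square algebra_simps)
    thus ?thesis by (intro exI[of _ "\<lambda>s. (s + 1) * pZ s"]) (auto simp: pZ_def intro!: continuous_intros)
  next
    case 2
    have "q s = ((s - 1) * pZ s) * (s - a)" for s by (simp add: q_def 2 power2_eq_square algebra_simps)
    thus ?thesis by (intro exI[of _ "\<lambda>s. (s - 1) * pZ s"]) (auto simp: pZ_def intro!: continuous_intros)
  next
    case 3
    have "q s = ((s\<^sup>2 - 1) * (\<Prod>c\<in>of_real ` Z - {a}. s - c)) * (s - a)" for s
      unfolding q_def pZ_def using 3 finite_Z by (subst prod.remove[of _ a]) auto
    thus ?thesis by (intro exI[of _ "\<lambda>s. (s\<^sup>2 - 1) * (\<Prod>c\<in>of_real ` Z - {a}. s - c)"])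
      (auto intro!: continuous_intros)
  qed
qed

lemma tendsto_L:
  assumes "z \<in> S0" shows "((\<lambda>s. q s *\<^sub>M matrix_inv (u s)) \<longlongrightarrow> L z) (at z)"
proof -
  have "\<exists>l. ((\<lambda>s. q s *\<^sub>M matrix_inv (u s)) \<longlongrightarrow> l) (at z)"
  proof (cases "invertible (u z)")
    case True
    thus ?thesis using cs.tendsto[OF q_cont[unfolded isCont_def] tendsto_inv] by blast
  next
    case False
    hence z: "z \<in> cball 0 1" using assms by (auto simp: S0_def)
    obtain g where g: "isCont g z" "\<And>s. q s = g s * (s - z)" using q_factor[OF z False] by blast
    obtain R' where "((\<lambda>s. (s - z) *\<^sub>M matrix_inv (u s)) \<longlongrightarrow> R') (at z)"
      using residue_exists[OF z False] by blast
    hence "((\<lambda>s. g s *\<^sub>M (s - z) *\<^sub>M matrix_inv (u s)) \<longlongrightarrow> g z *\<^sub>M R') (at z)"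
      using g(1) by (intro cs.tendsto) (simp_all add: isCont_def)
    thus ?thesis by (auto simp: g(2))
  qed
  then obtain l where l: "((\<lambda>s. q s *\<^sub>M matrix_inv (u s)) \<longlongrightarrow> l) (at z)" by blast
  have "L z = l" unfolding L_def by (rule tendsto_Lim[OF at_neq_bot l])
  thus ?thesis using l by simp
qed

lemma L_eq: "invertible (u z) \<Longrightarrow> L z = q z *\<^sub>M matrix_inv (u z)"
  unfolding L_def by (intro tendsto_Lim at_neq_bot cs.tendsto q_cont[unfolded isCont_def] tendsto_inv)

lemma L_holo: "(\<lambda>z. L z $ i $ j) holomorphic_on S0"
proof (rule no_isolated_singularity'[OF _ _ S0_open])
  show "finite (S0 \<inter> {z. \<not> invertible (u z)})" using finite_singular by simp
  show "(\<lambda>z. L z $ i $ j) holomorphic_on S0 - (S0 \<inter> {z. \<not> invertible (u z)})"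
  proof (rule holomorphic_transform)
    show "(\<lambda>z. q z * matrix_inv (u z) $ i $ j) holomorphic_on S0 - (S0 \<inter> {z. \<not> invertible (u z)})"
      by (intro holomorphic_intros holomorphic_on_subset[OF holo_inv]) auto
  qed (auto simp: L_eq)
next
  fix z assume "z \<in> S0 \<inter> {z. \<not> invertible (u z)}"
  hence z: "z \<in> S0" by simp
  have "((\<lambda>s. q s * matrix_inv (u s) $ i $ j) \<longlongrightarrow> L z $ i $ j) (at z)"
    using tendsto_mat_nth[OF tendsto_L[OF z]] by simp
  moreover have "\<forall>\<^sub>F s in at z. q s * matrix_inv (u s) $ i $ j = L s $ i $ j"
    using ev_invertible by eventually_elim (simp add: L_eq)
  ultimately have "((\<lambda>s. L s $ i $ j) \<longlongrightarrow> L z $ i $ j) (at z)"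
    by (rule Lim_transform_eventually)
  thus "((\<lambda>z. L z $ i $ j) \<longlongrightarrow> L z $ i $ j) (at z within S0)"
    by (rule tendsto_within_subset) auto
qed


lemma tendsto_unique_at:
  "(f \<longlongrightarrow> l) (at (a::complex)) \<Longrightarrow> (f \<longlongrightarrow> (m :: complex^'n^'m)) (at a) \<Longrightarrow> l = m"
  by (rule tendsto_unique[OF at_neq_bot])

section \<open>Residues at the zeros and canonical weights\<close>

lemma L_at_Z:
  assumes a: "a \<in> Z"
  shows "L (of_real a) = ((of_real a ^ 2 - 1) * (\<Prod>b\<in>of_real ` Z - {of_real a}. of_real a - b)) *\<^sub>M R a"
proof -
  define g where "g = (\<lambda>s. (s ^ 2 - 1) * (\<Prod>b\<in>of_real ` Z - {complex_of_real a}. s - b))"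
  have q: "q s = g s * (s - of_real a)" for s
    unfolding q_def pZ_def g_def using a finite_Z by (subst prod.remove[of _ "of_real a"]) auto
  have "isCont g (of_real a)" unfolding g_def by (intro continuous_intros)
  hence "((\<lambda>s. g s *\<^sub>M (s - of_real a) *\<^sub>M matrix_inv (u s)) \<longlongrightarrow> g (of_real a) *\<^sub>M R a) (at (of_real a))"
    by (intro cs.tendsto tendsto_R[OF a]) (simp add: isCont_def)
  hence "((\<lambda>s. q s *\<^sub>M matrix_inv (u s)) \<longlongrightarrow> g (of_real a) *\<^sub>M R a) (at (of_real a))"
    by (simp add: q)
  moreover have "of_real a \<in> S0" using Z_props[OF a] by (simp add: S0_def)
  ultimately show ?thesis using tendsto_L tendsto_unique_at unfolding g_def by blast
qed

lemma u_R:
  assumes a: "a \<in> Z" shows "u (of_real a) ** R a = 0" "R a ** u (of_real a) = 0"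
proof -
  let ?a = "complex_of_real a"
  have lim0: "((\<lambda>s. (s - ?a) *\<^sub>M mat 1 :: complex^'l^'l) \<longlongrightarrow> 0) (at ?a)"
  proof -
    have "((\<lambda>s. (s - ?a) *\<^sub>M mat 1 :: complex^'l^'l) \<longlongrightarrow> (?a - ?a) *\<^sub>M mat 1) (at ?a)"
      by (intro cs.tendsto tendsto_intros)
    thus ?thesis by (simp add: cs.zero_left)
  qed
  have "((\<lambda>s. u s ** ((s - ?a) *\<^sub>M matrix_inv (u s))) \<longlongrightarrow> u ?a ** R a) (at ?a)"
    by (intro mm.tendsto tendsto_u tendsto_R a)
  moreover have "\<forall>\<^sub>F s in at ?a. u s ** ((s - ?a) *\<^sub>M matrix_inv (u s)) = (s - ?a) *\<^sub>M mat 1"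
    using ev_invertible by eventually_elim (simp add: cs_simps mat_inv_r)
  ultimately have "((\<lambda>s. (s - ?a) *\<^sub>M mat 1) \<longlongrightarrow> u ?a ** R a) (at ?a)"
    by (rule Lim_transform_eventually)
  thus "u ?a ** R a = 0" using lim0 tendsto_unique_at by blast
  have "((\<lambda>s. ((s - ?a) *\<^sub>M matrix_inv (u s)) ** u s) \<longlongrightarrow> R a ** u ?a) (at ?a)"
    by (intro mm.tendsto tendsto_u tendsto_R a)
  moreover have "\<forall>\<^sub>F s in at ?a. ((s - ?a) *\<^sub>M matrix_inv (u s)) ** u s = (s - ?a) *\<^sub>M mat 1"
    using ev_invertible by eventually_elim (simp add: cs_simps mat_inv_l)
  ultimately have "((\<lambda>s. (s - ?a) *\<^sub>M mat 1) \<longlongrightarrow> R a ** u ?a) (at ?a)"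
    by (rule Lim_transform_eventually)
  thus "R a ** u ?a = 0" using lim0 tendsto_unique_at by blast
qed

definition D :: "complex \<Rightarrow> complex^'l^'l" where "D z = eval_mat (map_matrix pderiv p) z"

lemma tendsto_D: "((\<lambda>s. inverse (s - z) *\<^sub>M (u s - u z)) \<longlongrightarrow> D z) (at z)"
proof (rule tendsto_matI)
  fix i j
  have "((\<lambda>s. (poly (p $ i $ j) s - poly (p $ i $ j) z) / (s - z)) \<longlongrightarrow> poly (pderiv (p $ i $ j)) z) (at z)"
    using poly_DERIV[of "p $ i $ j" z] by (simp add: has_field_derivative_iff)
  thus "((\<lambda>s. (inverse (s - z) *\<^sub>M (u s - u z)) $ i $ j) \<longlongrightarrow> D z $ i $ j) (at z)"
    by (simp add: D_def u_poly map_matrix_def divide_inverse mult.commute)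
qed

text \<open>The product of the inverse of \<open>u s\<close> with \<open>u s - u a\<close>, applied
  to \<open>W\<close>, is \<open>W\<close> for every s near a; a factor s - a can be shifted from
  one side to the other before passing to the limit.\<close>

lemma R_D:
  assumes a: "a \<in> Z" and W: "u (of_real a) ** W = 0"
  shows "R a ** D (of_real a) ** W = W"
proof -
  let ?a = "complex_of_real a"
  have "((\<lambda>s. ((s - ?a) *\<^sub>M matrix_inv (u s)) ** (inverse (s - ?a) *\<^sub>M (u s - u ?a)) ** W)
      \<longlongrightarrow> R a ** D ?a ** W) (at ?a)"
    by (intro mm.tendsto tendsto_D tendsto_R a tendsto_const)
  moreover have "\<forall>\<^sub>F s in at ?a.
      ((s - ?a) *\<^sub>M matrix_inv (u s)) ** (inverse (s - ?a) *\<^sub>M (u s - u ?a)) ** W = W"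
    using ev_invertible eventually_neq_at_within[of ?a ?a UNIV]
  proof eventually_elim
    case (elim s)
    have "matrix_inv (u s) ** (u s - u ?a) ** W = matrix_inv (u s) ** u s ** W - matrix_inv (u s) ** (u ?a ** W)"
      by (simp add: mm.diff_left mm.diff_right matrix_mul_assoc)
    thus ?case using elim by (simp add: cs_simps mat_inv_l W)
  qed
  ultimately have "((\<lambda>s. W) \<longlongrightarrow> R a ** D ?a ** W) (at ?a)"
    by (rule Lim_transform_eventually)
  thus ?thesis using tendsto_const tendsto_unique_at by blast
qed

lemma w_props:
  assumes a: "a \<in> Z"
  shows "psd (w a)" "(w a)\<^sup>\<dagger> = w a" "u (of_real a) ** w a = 0"
proof -
  show "psd (w a)" using weights[OF a] by simp
  thus "(w a)\<^sup>\<dagger> = w a" by (simp add: psd_def)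
  have "u (of_real a) *v (w a *v x) = 0" for x using weights[OF a] by blast
  thus "u (of_real a) ** w a = 0" by (intro mat_eq_vecI) (simp add: mm_vec)
qed

text \<open>The range of \<open>w a\<close> is the whole kernel of \<open>u a\<close>, so each
  column of \<open>M\<close> can be lifted separately. Both \<open>Q a\<close> and
  \<open>R a\<close> are factored in this way.\<close>

lemma w_range:
  fixes M :: "complex^'l^'l"
  assumes a: "a \<in> Z" and M: "u (of_real a) ** M = 0"
  shows "\<exists>G. M = w a ** G"
proof -
  have "\<exists>y. M *v axis j 1 = w a *v y" for j
  proof -
    have "u (of_real a) *v (M *v axis j 1) = 0" by (simp add: matrix_vector_mul_assoc M)
    hence "M *v axis j 1 \<in> range ((*v) (w a))" using weights[OF a] by blast
    thus ?thesis by auto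
  qed
  then obtain y where y: "\<And>j. M *v axis j 1 = w a *v y j" by metis
  have col: "(A *v axis j 1) $ i = A $ i $ j" for A :: "complex^'l^'l" and i j
    by (simp add: matrix_vector_mult_def axis_def if_distrib cong: if_cong)
  have "M = w a ** (\<chi> i j. y j $ i)"
  proof (rule mat_eqI)
    fix i j
    have "M $ i $ j = (w a *v y j) $ i" using col[of M j i] unfolding y by simp
    thus "M $ i $ j = (w a ** (\<chi> i j. y j $ i)) $ i $ j"
      by (simp add: matrix_vector_mult_def matrix_mul_nth)
  qed
  thus ?thesis by blast
qed

section \<open>Defect of the weights and the correction \<open>T\<close>\<close>

definition u_sharp :: "complex \<Rightarrow> complex^'l^'l" where "u_sharp z = (u (cnj z))\<^sup>\<dagger>"

lemma u_sharp_of_real: "u_sharp (of_real x) = (u (of_real x))\<^sup>\<dagger>"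
  by (simp add: u_sharp_def)

text \<open>The difference of the two sides of the canonical equation, multiplied by (1/a - a) / a.
  In this scaling the first term is what appears when the polynomials are evaluated at a +
  1/a.\<close>

definition Q :: "real \<Rightarrow> complex^'l^'l" where
  "Q a = w a ** u_sharp (1 / of_real a) - ((of_real a - inverse (of_real a))\<^sup>2 / of_real a) *\<^sub>M R a"

lemma canonical_iff:
  assumes a: "a \<in> Z" shows "canonical u (of_real a) (w a) \<longleftrightarrow> Q a = 0"
proof -
  define z where "z = complex_of_real a"
  have z0: "z \<noteq> 0" and z1: "z - inverse z \<noteq> 0" using Z_props[OF a] by (auto simp: z_def)
  hence z2: "inverse z - z \<noteq> 0" by auto
  have u_sharp: "(u (1 / cnj z))\<^sup>\<dagger> = u_sharp (1 / z)" by (simp add: u_sharp_def z_def)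
  have "canonical u z (w a) \<longleftrightarrow>
      (z / (inverse z - z)) *\<^sub>M (w a ** u_sharp (1 / z)) = - ((z - inverse z) *\<^sub>M R a)"
    by (simp add: canonical_def u_sharp R_def flip: z_def)
  also have "\<dots> \<longleftrightarrow> ((inverse z - z) / z) *\<^sub>M (z / (inverse z - z)) *\<^sub>M (w a ** u_sharp (1 / z))
      = ((inverse z - z) / z) *\<^sub>M - ((z - inverse z) *\<^sub>M R a)"
    using z0 z2 by (subst cscale_cancel) auto
  also have "((inverse z - z) / z) *\<^sub>M (z / (inverse z - z)) *\<^sub>M (w a ** u_sharp (1 / z)) = w a ** u_sharp (1 / z)"
    using z0 z2 by simp
  also have "((inverse z - z) / z) *\<^sub>M - ((z - inverse z) *\<^sub>M R a) = ((z - inverse z)\<^sup>2 / z) *\<^sub>M R a"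
    by (simp add: cs.minus_right cs.minus_left[symmetric] power2_eq_square algebra_simps)
  finally show ?thesis by (simp add: Q_def z_def)
qed

lemma u_Q: "a \<in> Z \<Longrightarrow> u (of_real a) ** Q a = 0"
  by (simp add: Q_def mm.diff_right matrix_mul_assoc w_props cs_simps u_R)

definition G :: "real \<Rightarrow> complex^'l^'l" where "G a = (SOME G. Q a = w a ** G)"

lemma Q_G: "a \<in> Z \<Longrightarrow> Q a = w a ** G a"
  unfolding G_def by (rule someI_ex[OF w_range[OF _ u_Q]])

text \<open>A common solution of the two equations required of the correction:
  \<open>u_sharp a ** T a = 0\<close>, because \<open>R a ** u a = 0\<close>, and
  \<open>w a ** herm (D a) ** T a = (1/a) Q a\<close>, because \<open>R a ** D a\<close> fixes
  \<open>w a\<close>.\<close>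

definition T :: "real \<Rightarrow> complex^'l^'l" where
  "T a = (1 / of_real a) *\<^sub>M ((R a)\<^sup>\<dagger> ** G a)"

lemma u_sharp_T: "a \<in> Z \<Longrightarrow> u_sharp (of_real a) ** T a = 0"
  using u_R(2)[of a] by (simp add: u_sharp_of_real T_def cs_simps matrix_mul_assoc flip: herm_mult)

lemma w_D_T:
  assumes a: "a \<in> Z" shows "w a ** (D (of_real a))\<^sup>\<dagger> ** T a = (1 / of_real a) *\<^sub>M Q a"
proof -
  have "w a ** (D (of_real a))\<^sup>\<dagger> ** (R a)\<^sup>\<dagger> = (R a ** D (of_real a) ** w a)\<^sup>\<dagger>"
    by (simp add: herm_mult w_props[OF a] matrix_mul_assoc)
  also have "\<dots> = w a" by (simp add: R_D[OF a w_props(3)[OF a]] w_props[OF a])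
  finally show ?thesis by (simp add: T_def cs_simps matrix_mul_assoc Q_G[OF a])
qed

section \<open>The linear system for the coefficients \<open>X\<close>\<close>

definition bX :: "nat \<Rightarrow> real \<Rightarrow> complex^'l^'l" where "bX n a = (a ^ (2 * n)) *\<^sub>R T a"
text \<open>Inserting the partial fractions of \<open>Y n\<close> into X(a) = a^(2n) T(a) Y_n(a)
  gives a system with right-hand side \<open>bX\<close> and matrix \<open>mX\<close>. Both carry the
  factor a^(2n), so the system is solvable for large n and its solution decays.\<close>

definition mX :: "nat \<Rightarrow> real \<Rightarrow> real \<Rightarrow> complex^'l^'l" where
  "mX n a b = (a ^ (2 * n) / (1 - a * b)) *\<^sub>R T a"
text \<open>The matrices \<open>X n a\<close> are meaningful for large \<open>n\<close> only, when the system is solvable.\<close>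

definition X :: "nat \<Rightarrow> real \<Rightarrow> complex^'l^'l" where
  "X n = (SOME X. \<forall>i\<in>Z. X i = bX n i + (\<Sum>k\<in>Z. mX n i k ** X k) \<and>
     norm (X i) \<le> 2 * (\<Sum>i\<in>Z. norm (bX n i)))"

lemma exp_decay_pow2:
  assumes "a \<in> Z" shows "exp_decay (\<lambda>n. (a ^ (2 * n)) *\<^sub>R (M :: complex^'l^'l))"
proof -
  have "exp_decay (\<lambda>n. (a\<^sup>2) ^ n)" using Z_props(5)[OF assms] by (intro exp_decay_pow) simp
  thus ?thesis by (rule exp_decay_le[of _ _ "norm M"]) (simp add: power_mult)
qed

lemma X_ev: "\<forall>\<^sub>F n in sequentially. \<forall>i\<in>Z. X n i = bX n i + (\<Sum>k\<in>Z. mX n i k ** X n k) \<and>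
     norm (X n i) \<le> 2 * (\<Sum>i\<in>Z. norm (bX n i))"
proof -
  have "\<forall>\<^sub>F n in sequentially. \<forall>i\<in>Z. (\<Sum>k\<in>Z. norm (mX n i k)) < 1/2"
  proof (intro eventually_ball_finite finite_Z ballI)
    fix i assume i: "i \<in> Z"
    have "(\<lambda>n. \<Sum>k\<in>Z. norm ((i ^ (2 * n)) *\<^sub>R ((1 / (1 - i * k)) *\<^sub>R T i))) \<longlonglongrightarrow> 0"
      by (intro tendsto_null_sum tendsto_norm_zero exp_decay_tendsto exp_decay_pow2 i)
    thus "\<forall>\<^sub>F n in sequentially. (\<Sum>k\<in>Z. norm (mX n i k)) < 1/2"
      by (intro order_tendstoD(2)[of _ 0]) (simp_all add: mX_def)
  qed
  thus ?thesis
  proof eventually_elim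
    case (elim n)
    have "\<exists>X. \<forall>i\<in>Z. X i = bX n i + (\<Sum>k\<in>Z. mX n i k ** X k) \<and>
     norm (X i) \<le> 2 * (\<Sum>i\<in>Z. norm (bX n i))"
      using elim by (intro finite_linear_system finite_Z)
        (auto intro: less_imp_le member_le_sum finite_Z)
    from someI_ex[OF this] show ?case unfolding X_def .
  qed
qed

lemma exp_decay_X: assumes a: "a \<in> Z" shows "exp_decay (\<lambda>n. X n a)"
proof (rule exp_decay_le)
  show "exp_decay (\<lambda>n. \<Sum>i\<in>Z. norm (bX n i))"
    unfolding bX_def by (intro exp_decay_sum exp_decay_norm exp_decay_pow2)
  show "\<forall>\<^sub>F n in sequentially. norm (X n a) \<le> 2 * norm (\<Sum>i\<in>Z. norm (bX n i))"
    using X_ev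
  proof eventually_elim
    case (elim n)
    have "norm (X n a) \<le> 2 * (\<Sum>i\<in>Z. norm (bX n i))" using bspec[OF elim a] by blast
    thus ?case by (simp add: sum_nonneg)
  qed
qed

definition Y :: "nat \<Rightarrow> complex \<Rightarrow> complex^'l^'l" where
  "Y n z = mat 1 + (\<Sum>b\<in>Z. (1 / (1 - z * of_real b)) *\<^sub>M X n b)"

lemma X_eq: "\<forall>\<^sub>F n in sequentially. \<forall>a\<in>Z. X n a = of_real (a ^ (2 * n)) *\<^sub>M (T a ** Y n (of_real a))"
  using X_ev
proof eventually_elim
  case (elim n)
  show ?case
  proof
    fix a assume a: "a \<in> Z"
    have "mX n a k ** M = of_real (a ^ (2 * n)) *\<^sub>M (T a ** ((1 / (1 - of_real a * of_real k)) *\<^sub>M M))"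
      for k and M :: "complex^'l^'l"
      unfolding mX_def cscale_of_real[symmetric] by (simp add: cs_simps)
    hence "bX n a + (\<Sum>k\<in>Z. mX n a k ** X n k) = of_real (a ^ (2 * n)) *\<^sub>M T a + (\<Sum>k\<in>Z. of_real (a ^ (2 * n)) *\<^sub>M (T a ** ((1 / (1 - of_real a * of_real k)) *\<^sub>M X n k)))"
      by (simp add: bX_def flip: cscale_of_real)
    also have "\<dots> = of_real (a ^ (2 * n)) *\<^sub>M (T a ** Y n (of_real a))"
      by (simp add: Y_def mm.add_right mm.sum_right cs.add_right cs.sum_right)
    finally show "X n a = \<dots>" using elim a by metis
  qed
qed

lemma exp_decay_Y: "exp_decay (\<lambda>n. Y n z - mat 1)"
  unfolding Y_def by (simp, intro exp_decay_sum exp_decay_cscale exp_decay_X)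


section \<open>The polynomials attached to the finite-rank correction\<close>

definition d :: nat where "d = (\<Sum>i\<in>UNIV. \<Sum>j\<in>UNIV. degree (p $ i $ j))"
definition C :: "nat \<Rightarrow> complex^'l^'l" where "C k = (\<chi> i j. cnj (coeff (p $ j $ i) k))"

lemma u_nth: "u z $ i $ j = poly (p $ i $ j) z"
  by (simp add: u_poly)

lemma degree_le_d: "degree (p $ i $ j) \<le> d"
proof -
  have "degree (p $ i $ j) \<le> (\<Sum>j\<in>UNIV. degree (p $ i $ j))" by (intro member_le_sum) auto
  also have "\<dots> \<le> d" unfolding d_def by (rule member_le_sum[of i UNIV "\<lambda>i. \<Sum>j\<in>UNIV. degree (p $ i $ j)"]) auto
  finally show ?thesis .
qed

lemma u_sharp_sum: "u_sharp z = (\<Sum>k\<le>d. z ^ k *\<^sub>M C k)"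
proof (rule mat_eqI)
  fix i j
  have "poly (p $ j $ i) (cnj z) = (\<Sum>k\<le>d. coeff (p $ j $ i) k * cnj z ^ k)"
    unfolding poly_altdef by (intro sum.mono_neutral_left) (auto simp: degree_le_d coeff_eq_0)
  thus "u_sharp z $ i $ j = (\<Sum>k\<le>d. z ^ k *\<^sub>M C k) $ i $ j"
    by (simp add: u_sharp_def u_nth C_def mult.commute)
qed

lemma u_sharp_0: "u_sharp 0 = (u 0)\<^sup>\<dagger>" by (simp add: u_sharp_def)
lemma C_0: "C 0 = u_sharp 0"
  by (simp add: u_sharp_sum power_0_left if_distrib if_distribR cs.zero_left cong: if_cong)

text \<open>Polynomial division by s - a with the quotient written out, so that the degree bound
  \<open>d\<close>, common to all zeros, remains visible.\<close>

lemma u_sharp_factor: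
  fixes M :: "complex^'l^'l"
  assumes "u_sharp a ** M = 0"
  shows "\<exists>r :: nat \<Rightarrow> complex^'l^'l. \<forall>s. u_sharp s ** M = (s - a) *\<^sub>M (\<Sum>m<d. s ^ m *\<^sub>M r m)"
proof (intro exI allI)
  fix s
  have "u_sharp s ** M = u_sharp s ** M - u_sharp a ** M" by (simp add: assms)
  also have "\<dots> = (\<Sum>k\<le>d. (s ^ k - a ^ k) *\<^sub>M (C k ** M))"
    unfolding u_sharp_sum by (simp add: mm.sum_left cs_simps cs.diff_left sum_subtractf)
  also have "\<dots> = (s - a) *\<^sub>M (\<Sum>k\<le>d. \<Sum>m<k. (a ^ (k - Suc m) * s ^ m) *\<^sub>M (C k ** M))"
    unfolding power_diff_sumr2 by (simp add: cs.sum_right cs.sum_left sum_distrib_left)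
  also have "(\<Sum>k\<le>d. \<Sum>m<k. (a ^ (k - Suc m) * s ^ m) *\<^sub>M (C k ** M))
     = (\<Sum>k\<le>d. \<Sum>m<d. s ^ m *\<^sub>M (if m < k then a ^ (k - Suc m) *\<^sub>M (C k ** M) else 0))"
    by (intro sum.cong refl sum.mono_neutral_cong_left) (auto simp: mult.commute)
  also have "\<dots> = (\<Sum>m<d. s ^ m *\<^sub>M (\<Sum>k\<le>d. if m < k then a ^ (k - Suc m) *\<^sub>M (C k ** M) else 0))"
    by (subst sum.swap) (simp add: cs.sum_right)
  finally show "u_sharp s ** M = (s - a) *\<^sub>M
    (\<Sum>m<d. s ^ m *\<^sub>M (\<Sum>k\<le>d. if m < k then a ^ (k - Suc m) *\<^sub>M (C k ** M) else 0))" .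
qed

text \<open>The margin 2 in \<open>d + 2\<close> keeps the exponent n - 2 of the circle integrals
  from being truncated.\<close>

definition large :: "nat \<Rightarrow> bool" where
  "large n \<longleftrightarrow> d + 2 \<le> n \<and> (\<forall>a\<in>Z. X n a = of_real (a ^ (2 * n)) *\<^sub>M (T a ** Y n (of_real a)))"

lemma ev_large: "\<forall>\<^sub>F n in sequentially. large n"
  unfolding large_def using X_eq eventually_ge_at_top[of "d + 2"] by eventually_elim auto

lemma u_sharp_X: "large n \<Longrightarrow> a \<in> Z \<Longrightarrow> u_sharp (of_real a) ** X n a = 0"
  by (simp add: large_def cs_simps matrix_mul_assoc u_sharp_T)

lemma tendsto_u_sharp_D:
  "((\<lambda>s. inverse (s - of_real a) *\<^sub>M (u_sharp s - u_sharp (of_real a))) \<longlongrightarrow> (D (of_real a))\<^sup>\<dagger>) (at (of_real a))"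
proof -
  have "filterlim cnj (at (complex_of_real a)) (at (of_real a))"
    unfolding filterlim_at
  proof
    show "(cnj \<longlongrightarrow> complex_of_real a) (at (of_real a))"
      using tendsto_cnj[OF tendsto_ident_at, of "complex_of_real a" UNIV] by simp
    show "\<forall>\<^sub>F s in at (complex_of_real a). cnj s \<in> UNIV \<and> cnj s \<noteq> of_real a"
      using eventually_neq_at_within[of "complex_of_real a" "of_real a" UNIV]
      by eventually_elim (metis complex_cnj_cnj complex_cnj_complex_of_real UNIV_I)
  qed
  from filterlim_compose[OF tendsto_D this]
  have "((\<lambda>s. inverse (cnj s - of_real a) *\<^sub>M (u (cnj s) - u (of_real a))) \<longlongrightarrow> D (of_real a)) (at (of_real a))" .
  from bounded_linear.tendsto[OF bounded_linear_herm this] show ?thesis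
    by (simp add: herm_cscale herm_diff u_sharp_def)
qed

text \<open>The coefficients of the polynomial s -> u^#(s) Y_n(1/s): its apparent poles at the zeros
  a cancel because u^#(a) X_n(a) = 0. After multiplication by \<open>w a\<close>, which annihilates
  u^#(a), only the summand of a itself survives at s = a. Its value there is a derivative of u^#
  applied to X_n(a), which \<open>w_D_T\<close> converts into the defect \<open>Q a\<close>.\<close>

lemma Rc_exists:
  assumes n: "large n"
  shows "\<exists>Rc :: nat \<Rightarrow> complex^'l^'l. Rc 0 = u_sharp 0 \<and>
    (\<forall>z. z \<noteq> 0 \<longrightarrow> (\<forall>a\<in>Z. z * of_real a \<noteq> 1) \<longrightarrow>
       (\<Sum>k\<le>d. inverse z ^ k *\<^sub>M Rc k) = u_sharp (inverse z) ** Y n z) \<and>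
    (\<forall>a\<in>Z. w a ** (\<Sum>k\<le>d. of_real a ^ k *\<^sub>M Rc k) = of_real a ^ (2 * n) *\<^sub>M (Q a ** Y n (of_real a)))"
proof -
  have "\<forall>a\<in>Z. \<exists>r :: nat \<Rightarrow> complex^'l^'l. \<forall>s. u_sharp s ** X n a = (s - of_real a) *\<^sub>M (\<Sum>m<d. s ^ m *\<^sub>M r m)"
    using u_sharp_factor[OF u_sharp_X[OF n]] by blast
  then obtain r :: "real \<Rightarrow> nat \<Rightarrow> complex^'l^'l"
    where r: "\<And>a s. a \<in> Z \<Longrightarrow> u_sharp s ** X n a = (s - of_real a) *\<^sub>M (\<Sum>m<d. s ^ m *\<^sub>M r a m)"
    by metis
  define \<rho> where "\<rho> = (\<lambda>a s. \<Sum>m<d. s ^ m *\<^sub>M r a m)"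
  \<comment> \<open>With z = 1/s one has (s - a) / (1 - z a) = s. Each quotient thus enters
    multiplied by s, whence the shift by one.\<close>
  define Rc where "Rc = (\<lambda>k. C k + (if k = 0 then 0 else \<Sum>a\<in>Z. r a (k - 1)))"
  have sumR: "(\<Sum>k\<le>d. s ^ k *\<^sub>M Rc k) = u_sharp s + (\<Sum>a\<in>Z. s *\<^sub>M \<rho> a s)" for s
  proof -
    have "(\<Sum>k\<le>d. s ^ k *\<^sub>M Rc k) = u_sharp s + (\<Sum>k<Suc d. s ^ k *\<^sub>M (if k = 0 then 0 else \<Sum>a\<in>Z. r a (k - 1)))"
      unfolding Rc_def u_sharp_sum by (simp add: cs.add_right sum.distrib lessThan_Suc_atMost)
    also have "(\<Sum>k<Suc d. s ^ k *\<^sub>M (if k = 0 then 0 else \<Sum>a\<in>Z. r a (k - 1)))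
       = (\<Sum>k<d. s ^ Suc k *\<^sub>M (\<Sum>a\<in>Z. r a k))"
      by (subst sum.lessThan_Suc_shift) (simp add: cs.zero_right)
    also have "\<dots> = (\<Sum>a\<in>Z. s *\<^sub>M \<rho> a s)"
      unfolding \<rho>_def cs.sum_right by (subst sum.swap) simp
    finally show ?thesis .
  qed
  show ?thesis
  proof (intro exI[of _ Rc] conjI allI impI ballI)
    show "Rc 0 = u_sharp 0" by (simp add: Rc_def C_0)
  next
    fix z :: complex assume z: "z \<noteq> 0" "\<forall>a\<in>Z. z * of_real a \<noteq> 1"
    have "u_sharp (inverse z) ** ((1 / (1 - z * of_real a)) *\<^sub>M X n a) = inverse z *\<^sub>M \<rho> a (inverse z)" if a: "a \<in> Z" for a
    proof -
      have ne: "1 - z * of_real a \<noteq> 0" using z a by auto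
      have "u_sharp (inverse z) ** ((1 / (1 - z * of_real a)) *\<^sub>M X n a)
          = ((1 / (1 - z * of_real a)) * (inverse z - of_real a)) *\<^sub>M \<rho> a (inverse z)"
        by (simp add: cs_simps r[OF a] \<rho>_def)
      also have "(1 / (1 - z * of_real a)) * (inverse z - of_real a) = inverse z"
        using ne z by (simp add: divide_simps)
      finally show ?thesis .
    qed
    thus "(\<Sum>k\<le>d. inverse z ^ k *\<^sub>M Rc k) = u_sharp (inverse z) ** Y n z"
      by (simp add: sumR Y_def mm.add_right mm.sum_right)
  next
    fix a assume a: "a \<in> Z"
    let ?a = "complex_of_real a"
    have wus: "w a ** u_sharp ?a = 0"
      using w_props[OF a] herm_mult[of "u ?a" "w a"] by (simp add: u_sharp_of_real)
    have other: "w a ** \<rho> b ?a = 0" if b: "b \<in> Z" "b \<noteq> a" for b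
    proof -
      have "(?a - of_real b) *\<^sub>M (w a ** \<rho> b ?a) = w a ** u_sharp ?a ** X n b"
        using r[OF b(1), of ?a] by (simp add: \<rho>_def cs_simps flip: matrix_mul_assoc)
      thus ?thesis using b by (simp add: wus)
    qed
    have self: "\<rho> a ?a = (D ?a)\<^sup>\<dagger> ** X n a"
    proof -
      have "((\<lambda>s. inverse (s - ?a) *\<^sub>M (u_sharp s - u_sharp ?a) ** X n a) \<longlongrightarrow> (D ?a)\<^sup>\<dagger> ** X n a) (at ?a)"
        by (intro mm.tendsto tendsto_u_sharp_D tendsto_const)
      moreover have "\<forall>\<^sub>F s in at ?a. inverse (s - ?a) *\<^sub>M (u_sharp s - u_sharp ?a) ** X n a = \<rho> a s"
        using eventually_neq_at_within[of ?a ?a UNIV]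
        by eventually_elim (simp add: cs_simps mm.diff_left r[OF a] \<rho>_def cs.zero_left)
      ultimately have "(\<rho> a \<longlongrightarrow> (D ?a)\<^sup>\<dagger> ** X n a) (at ?a)"
        by (rule Lim_transform_eventually)
      moreover have "(\<rho> a \<longlongrightarrow> \<rho> a ?a) (at ?a)"
        unfolding \<rho>_def by (intro tendsto_sum cs.tendsto tendsto_intros)
      ultimately show ?thesis using tendsto_unique_at by blast
    qed
    have "w a ** (\<Sum>k\<le>d. ?a ^ k *\<^sub>M Rc k) = (\<Sum>b\<in>Z. ?a *\<^sub>M (w a ** \<rho> b ?a))"
      by (simp add: sumR mm.add_right mm.sum_right wus cs_simps)
    also have "\<dots> = (\<Sum>b\<in>Z. if b = a then ?a *\<^sub>M (w a ** \<rho> a ?a) else 0)"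
      by (intro sum.cong refl) (auto simp: other)
    also have "\<dots> = ?a *\<^sub>M (w a ** (D ?a)\<^sup>\<dagger> ** X n a)"
      using a finite_Z by (simp add: self matrix_mul_assoc)
    also have "X n a = ?a ^ (2 * n) *\<^sub>M (T a ** Y n ?a)"
      using n a by (simp add: large_def)
    also have "?a *\<^sub>M (w a ** (D ?a)\<^sup>\<dagger> ** (?a ^ (2 * n) *\<^sub>M (T a ** Y n ?a)))
       = ?a ^ (2 * n) *\<^sub>M (Q a ** Y n ?a)"
      using Z_props[OF a] by (simp add: cs_simps matrix_mul_assoc w_D_T[OF a])
    finally show "w a ** (\<Sum>k\<le>d. ?a ^ k *\<^sub>M Rc k) = ?a ^ (2 * n) *\<^sub>M (Q a ** Y n ?a)" .
  qed
qed

definition Rc :: "nat \<Rightarrow> nat \<Rightarrow> complex^'l^'l" where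
  "Rc n = (SOME Rc. Rc 0 = u_sharp 0 \<and>
    (\<forall>z. z \<noteq> 0 \<longrightarrow> (\<forall>a\<in>Z. z * of_real a \<noteq> 1) \<longrightarrow>
       (\<Sum>k\<le>d. inverse z ^ k *\<^sub>M Rc k) = u_sharp (inverse z) ** Y n z) \<and>
    (\<forall>a\<in>Z. w a ** (\<Sum>k\<le>d. of_real a ^ k *\<^sub>M Rc k) = of_real a ^ (2 * n) *\<^sub>M (Q a ** Y n (of_real a))))"

text \<open>Since \<open>cheb m (z + 1/z) = (z\<^sup>m - z\<^sup>-\<^sup>m) / (z - 1/z)\<close>, this is the quotient
  \<open>(u\<^sup>#(1/z) z\<^sup>n Y(z) - u\<^sup>#(z) z\<^sup>-\<^sup>n Y(1/z)) / (z - 1/z)\<close>; the truncated difference \<open>n - k\<close> is harmless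
  because only \<open>n \<ge> d\<close> is used.\<close>

definition opoly :: "nat \<Rightarrow> real \<Rightarrow> complex^'l^'l" where
  "opoly n x = (\<Sum>k\<le>d. cheb (n - k) x *\<^sub>R Rc n k)"

lemma Rc_props:
  assumes "large n"
  shows "Rc n 0 = u_sharp 0"
    "\<And>z. z \<noteq> 0 \<Longrightarrow> (\<And>a. a \<in> Z \<Longrightarrow> z * of_real a \<noteq> 1) \<Longrightarrow>
       (\<Sum>k\<le>d. inverse z ^ k *\<^sub>M Rc n k) = u_sharp (inverse z) ** Y n z"
    "\<And>a. a \<in> Z \<Longrightarrow> w a ** (\<Sum>k\<le>d. of_real a ^ k *\<^sub>M Rc n k) = of_real a ^ (2 * n) *\<^sub>M (Q a ** Y n (of_real a))"
  using someI_ex[OF Rc_exists[OF assms], folded Rc_def] by blast+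

text \<open>Only the summand k = 0 reaches degree n - 1, and its coefficient does not depend on
  n.\<close>

lemma opoly_lead:
  assumes "large n" shows "deg_lt (n - 1) (\<lambda>x. opoly n x - x ^ (n - 1) *\<^sub>R u_sharp 0)"
proof -
  have n: "d + 2 \<le> n" using assms by (simp add: large_def)
  have "deg_lt (n - 1) (\<lambda>x. (cheb (Suc (n - 1)) x *\<^sub>R Rc n 0 - x ^ (n - 1) *\<^sub>R Rc n 0)
     + (\<Sum>k\<in>{1..d}. cheb (n - k) x *\<^sub>R Rc n k))"
    by (intro deg_lt_add deg_lt_cheb_lead deg_lt_sum deg_lt_mono[OF deg_lt_cheb]) auto
  moreover have "opoly n x = cheb (Suc (n - 1)) x *\<^sub>R Rc n 0 + (\<Sum>k\<in>{1..d}. cheb (n - k) x *\<^sub>R Rc n k)" for x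
    unfolding opoly_def atMost_atLeast0 using n by (subst sum.atLeast_Suc_atMost) auto
  ultimately show ?thesis by (simp add: algebra_simps Rc_props(1)[OF assms])
qed

lemma opoly_eq:
  assumes n: "large n" and z: "z \<noteq> 0" "z + inverse z = of_real x"
  shows "(z - inverse z) *\<^sub>M opoly n x = z ^ n *\<^sub>M (\<Sum>k\<le>d. inverse z ^ k *\<^sub>M Rc n k)
     - inverse z ^ n *\<^sub>M (\<Sum>k\<le>d. z ^ k *\<^sub>M Rc n k)"
proof -
  have "(z - inverse z) *\<^sub>M opoly n x = (\<Sum>k\<le>d. (of_real (cheb (n - k) x) * (z - inverse z)) *\<^sub>M Rc n k)"
    by (simp add: opoly_def cs.sum_right mult.commute flip: cscale_of_real)
  also have "\<dots> = (\<Sum>k\<le>d. (z ^ n * inverse z ^ k - inverse z ^ n * z ^ k) *\<^sub>M Rc n k)"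
  proof (intro sum.cong refl)
    fix k assume "k \<in> {..d}"
    hence k: "k \<le> n" using n by (auto simp: large_def)
    have "z ^ (n - k) = z ^ n * inverse z ^ k" "inverse z ^ (n - k) = inverse z ^ n * z ^ k"
      using z k by (simp_all add: power_diff field_simps)
    thus "(of_real (cheb (n - k) x) * (z - inverse z)) *\<^sub>M Rc n k
        = (z ^ n * inverse z ^ k - inverse z ^ n * z ^ k) *\<^sub>M Rc n k"
      by (simp only: cheb_eq[OF z])
  qed
  also have "\<dots> = z ^ n *\<^sub>M (\<Sum>k\<le>d. inverse z ^ k *\<^sub>M Rc n k) - inverse z ^ n *\<^sub>M (\<Sum>k\<le>d. z ^ k *\<^sub>M Rc n k)"
    by (simp add: cs.sum_right cs.diff_left sum_subtractf)
  finally show ?thesis .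
qed

lemma Z_times_ne_1: "a \<in> Z \<Longrightarrow> cmod z \<le> 1 \<Longrightarrow> z * of_real a \<noteq> 1"
proof
  assume a: "a \<in> Z" "cmod z \<le> 1" "z * of_real a = 1"
  have "cmod z * \<bar>a\<bar> = 1" using arg_cong[OF a(3), of cmod] by (simp add: norm_mult)
  moreover have "cmod z * \<bar>a\<bar> \<le> 1 * \<bar>a\<bar>" using a by (intro mult_right_mono) auto
  ultimately show False using Z_props(1)[OF a(1)] by simp
qed

text \<open>The second term of \<open>opoly_eq\<close> contributes exactly - \<open>Q a\<close>,
  which replaces w(a) u^#(1/a) by a multiple of \<open>R a\<close>. The point mass thereby takes the
  form of a residue of the inverse of \<open>u\<close>, ready to cancel one from the contour
  integral.\<close>

lemma opoly_at_Z:
  assumes n: "large n" and a: "a \<in> Z"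
  shows "w a ** opoly n (a + inverse a) =
    (((of_real a - inverse (of_real a)) / of_real a) * of_real a ^ n) *\<^sub>M (R a ** Y n (of_real a))"
proof -
  define z where "z = complex_of_real a"
  have z0: "z \<noteq> 0" and z1: "z - inverse z \<noteq> 0" using Z_props[OF a] by (auto simp: z_def)
  have e: "z + inverse z = of_real (a + inverse a)" by (simp add: z_def)
  have "cmod z \<le> 1" using Z_props[OF a] by (simp add: z_def)
  hence P1: "(\<Sum>k\<le>d. inverse z ^ k *\<^sub>M Rc n k) = u_sharp (inverse z) ** Y n z"
    using Z_times_ne_1 by (intro Rc_props(2)[OF n z0]) auto
  have P2: "w a ** (\<Sum>k\<le>d. z ^ k *\<^sub>M Rc n k) = z ^ (2 * n) *\<^sub>M (Q a ** Y n z)"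
    using Rc_props(3)[OF n a] by (simp add: z_def)
  have "(z - inverse z) *\<^sub>M (w a ** opoly n (a + inverse a)) = w a ** ((z - inverse z) *\<^sub>M opoly n (a + inverse a))"
    by (simp add: cs_simps)
  also have "\<dots> = z ^ n *\<^sub>M (w a ** u_sharp (inverse z) ** Y n z) - (inverse z ^ n * z ^ (2 * n)) *\<^sub>M (Q a ** Y n z)"
    unfolding opoly_eq[OF n z0 e] P1 mm.diff_right cscale_mult_right P2 by (simp add: matrix_mul_assoc)
  also have "inverse z ^ n * z ^ (2 * n) = z ^ n"
    using z0 by (simp add: power_mult power2_eq_square field_simps flip: power_mult_distrib)
  also have "z ^ n *\<^sub>M (w a ** u_sharp (inverse z) ** Y n z) - z ^ n *\<^sub>M (Q a ** Y n z)
      = z ^ n *\<^sub>M ((w a ** u_sharp (inverse z) - Q a) ** Y n z)"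
    by (simp add: mm.diff_left cs.diff_right)
  also have "w a ** u_sharp (inverse z) - Q a = ((z - inverse z)\<^sup>2 / z) *\<^sub>M R a"
    by (simp add: Q_def z_def inverse_eq_divide)
  also have "z ^ n *\<^sub>M (((z - inverse z)\<^sup>2 / z) *\<^sub>M R a ** Y n z)
     = (z - inverse z) *\<^sub>M ((((z - inverse z) / z) * z ^ n) *\<^sub>M (R a ** Y n z))"
    by (simp add: cs_simps power2_eq_square mult_ac)
  finally show ?thesis unfolding cscale_cancel[OF z1] by (simp add: z_def)
qed

text \<open>The factor \<open>z\<^sup>2 - 1\<close> in \<open>L\<close> makes the weight continuous at \<open>\<theta> = 0\<close> and \<open>\<theta> = \<pi>\<close>, where \<open>u\<close> may be singular.\<close>

definition Lam :: "complex \<Rightarrow> complex^'l^'l" where "Lam z = (1 / pZ z) *\<^sub>M L z"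
definition Wt :: "real \<Rightarrow> complex^'l^'l" where
  "Wt \<theta> = (1 / (2 * pi)) *\<^sub>R (Lam (cis \<theta>) ** (Lam (cis \<theta>))\<^sup>\<dagger>)"

lemma continuous_matI:
  "(\<And>i j. continuous_on A (\<lambda>x. f x $ i $ j)) \<Longrightarrow> continuous_on A (f :: _ \<Rightarrow> complex^'n^'m)"
  unfolding continuous_on_def by (blast intro: tendsto_matI)

lemma L_cont: "continuous_on S0 L"
  by (intro continuous_matI holomorphic_on_imp_continuous_on L_holo)

lemma pZ_cis: "pZ (cis \<theta>) \<noteq> 0"
  using Z_props(4) by (auto simp: pZ_0_iff) (metis norm_cis norm_of_real less_irrefl)

lemma pZ_cont: "continuous_on A pZ" unfolding pZ_def by (intro continuous_intros)

lemma cis_S0: "cis \<theta> \<in> S0" by (simp add: S0_def)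

lemma cis_cont: "continuous_on A cis"
  unfolding cis_conv_exp by (intro continuous_intros)

lemma Lam_cont: "continuous_on A (\<lambda>\<theta>. Lam (cis \<theta>))"
  unfolding Lam_def
  by (intro cs.continuous_on continuous_intros continuous_on_compose2[OF L_cont cis_cont]
      continuous_on_compose2[OF pZ_cont[of UNIV] cis_cont]) (auto simp: cis_S0 pZ_cis)

lemma Wt_cont: "continuous_on A Wt"
  unfolding Wt_def
  by (intro continuous_intros mm.continuous_on Lam_cont bounded_linear.continuous_on[OF bounded_linear_herm])

lemma Wt_psd: "psd (Wt \<theta>)"
proof -
  have "psd (Lam (cis \<theta>) ** (Lam (cis \<theta>))\<^sup>\<dagger>)"
    using psd_self_herm[of "(Lam (cis \<theta>))\<^sup>\<dagger>"] by simp
  thus ?thesis unfolding Wt_def by (rule psd_scaleR) simp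
qed

lemma cis_inv: assumes "0 < \<theta>" "\<theta> < pi" shows "invertible (u (cis \<theta>))" "invertible (u (cis (- \<theta>)))"
proof -
  have "sin \<theta> > 0" using assms by (rule sin_gt_zero)
  hence "cis \<theta> \<notin> \<real>" "cis (- \<theta>) \<notin> \<real>" by (auto simp: complex_is_Real_iff)
  thus "invertible (u (cis \<theta>))" "invertible (u (cis (- \<theta>)))" by (auto intro!: u_inv)
qed

lemma Lam_eq: "invertible (u z) \<Longrightarrow> pZ z \<noteq> 0 \<Longrightarrow> Lam z = (z\<^sup>2 - 1) *\<^sub>M matrix_inv (u z)"
  by (simp add: Lam_def L_eq q_def)

lemma norm_cis_sq: "(cis \<theta>)\<^sup>2 - 1 = 2 * \<i> * of_real (sin \<theta>) * cis \<theta>"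
proof -
  have "sin (2 * \<theta>) = 2 * sin \<theta> * cos \<theta>" "cos (2 * \<theta>) = 1 - 2 * (sin \<theta>)\<^sup>2"
    by (rule sin_double) (rule cos_double_sin)
  moreover have "(cis \<theta>)\<^sup>2 = cis (2 * \<theta>)" using Complex.DeMoivre[of \<theta> 2] by simp
  ultimately show ?thesis by (simp add: complex_eq_iff power2_eq_square)
qed

text \<open>The second equation is the symmetry hypothesis restricted to the circle: the product of
  the adjoint of \<open>u\<close> with \<open>u\<close> agrees at z and at its conjugate.\<close>

lemma Lam_gram:
  assumes "0 < \<theta>" "\<theta> < pi"
  shows "Lam (cis \<theta>) ** (Lam (cis \<theta>))\<^sup>\<dagger>
      = (4 * (sin \<theta>)\<^sup>2) *\<^sub>R matrix_inv ((u (cis \<theta>))\<^sup>\<dagger> ** u (cis \<theta>))"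
    "Lam (cis (- \<theta>)) ** (Lam (cis (- \<theta>)))\<^sup>\<dagger> = Lam (cis \<theta>) ** (Lam (cis \<theta>))\<^sup>\<dagger>"
proof -
  have gen: "Lam (cis t) ** (Lam (cis t))\<^sup>\<dagger>
      = (4 * (sin t)\<^sup>2) *\<^sub>R matrix_inv ((u (cis t))\<^sup>\<dagger> ** u (cis t))" if i: "invertible (u (cis t))" for t
  proof -
    have "((cis t)\<^sup>2 - 1) * cnj ((cis t)\<^sup>2 - 1) = of_real (4 * (sin t)\<^sup>2)"
      unfolding norm_cis_sq complex_norm_square[symmetric]
      by (simp add: norm_mult power_mult_distrib)
    thus ?thesis
      using i by (simp add: Lam_eq pZ_cis herm_cscale cs_simps matrix_inv_mult invertible_herm
          matrix_inv_herm mult.commute flip: cscale_of_real)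
  qed
  show g1: "Lam (cis \<theta>) ** (Lam (cis \<theta>))\<^sup>\<dagger>
      = (4 * (sin \<theta>)\<^sup>2) *\<^sub>R matrix_inv ((u (cis \<theta>))\<^sup>\<dagger> ** u (cis \<theta>))"
    by (rule gen[OF cis_inv(1)[OF assms]])
  have "(u (cis \<theta>))\<^sup>\<dagger> ** u (cis \<theta>) = (u (cis (- \<theta>)))\<^sup>\<dagger> ** u (cis (- \<theta>))"
    using u_sym[of "cis \<theta>"] by (simp add: herm_mult cis_cnj cis_inverse divide_inverse)
  thus "Lam (cis (- \<theta>)) ** (Lam (cis (- \<theta>)))\<^sup>\<dagger> = Lam (cis \<theta>) ** (Lam (cis \<theta>))\<^sup>\<dagger>"
    by (simp add: g1 gen[OF cis_inv(2)[OF assms]])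
qed

lemma Wt_eq:
  assumes "0 < \<theta>" "\<theta> < pi"
  shows "Wt \<theta> = (2 / pi) *\<^sub>R (sin \<theta>)\<^sup>2 *\<^sub>R matrix_inv ((u (cis \<theta>))\<^sup>\<dagger> ** u (cis \<theta>))"
  using Lam_gram(1)[OF assms] by (simp add: Wt_def)

end

section \<open>The orthogonality integral\<close>

text \<open>The reflection t -> 2 pi - t is complex conjugation on the circle.\<close>

lemma has_integral_fold_circle:
  fixes g :: "real \<Rightarrow> complex"
  assumes g: "continuous_on {0..2 * pi} g" and I: "(g has_integral I) {0..2 * pi}"
  shows "((\<lambda>t. g t + g (2 * pi - t)) has_integral I) {0..pi}"
proof -
  have int: "g integrable_on {0..pi}" "g integrable_on {pi..2 * pi}"
    by (intro integrable_continuous_interval continuous_on_subset[OF g]; force)+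
  have "(g has_integral integral {pi..2 * pi} g) (cbox pi (2 * pi))"
    using int(2) by (simp add: integrable_integral)
  from has_integral_affinity[OF this, of "-1" "2 * pi"]
  have "((\<lambda>t. g (2 * pi - t)) has_integral integral {pi..2 * pi} g) ((\<lambda>x. 2 * pi - x) ` {pi..2 * pi})"
    by (simp add: algebra_simps)
  also have "(\<lambda>x. 2 * pi - x) ` {pi..2 * pi} = {0..pi}"
    by (auto simp: image_iff intro!: bexI[of _ "2 * pi - _"])
  finally have "((\<lambda>t. g t + g (2 * pi - t)) has_integral integral {0..pi} g + integral {pi..2 * pi} g) {0..pi}"
    using int(1) by (intro has_integral_add) (auto simp: integrable_integral)
  moreover have "integral {0..pi} g + integral {pi..2 * pi} g = integral {0..2 * pi} g"
    by (intro Henstock_Kurzweil_Integration.integral_combine integrable_continuous_interval g) auto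
  ultimately show ?thesis using I by (simp add: integral_unique)
qed

lemma has_integral_componentwise_mat:
  fixes f :: "real \<Rightarrow> complex^'n^'m"
  assumes "\<And>i j. ((\<lambda>t. f t $ i $ j) has_integral I $ i $ j) S"
  shows "(f has_integral I) S"
proof (subst has_integral_componentwise_iff, intro ballI)
  fix b :: "complex^'n^'m" assume "b \<in> Basis"
  then obtain i j c where b: "b = axis i (axis j c)" "c \<in> Basis"
    by (auto simp: Basis_vec_def)
  have ax: "x \<bullet> b = x $ i $ j \<bullet> c" for x :: "complex^'n^'m"
    by (simp add: b inner_axis)
  show "((\<lambda>x. f x \<bullet> b) has_integral I \<bullet> b) S"
    unfolding ax by (rule bspec[OF iffD1[OF has_integral_componentwise_iff assms] b(2)])
qed

context jost_data
begin

lemma opoly_circle: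
  assumes n: "large n"
  shows "(cis t - cis (- t)) *\<^sub>M opoly n (2 * cos t) =
     cis t ^ n *\<^sub>M ((u (cis t))\<^sup>\<dagger> ** Y n (cis t)) - cis (- t) ^ n *\<^sub>M ((u (cis (- t)))\<^sup>\<dagger> ** Y n (cis (- t)))"
proof -
  have inv: "inverse (cis t) = cis (- t)" "inverse (cis (- t)) = cis t" for t by simp_all
  have u_sharp: "u_sharp (cis (- t)) = (u (cis t))\<^sup>\<dagger>" for t by (simp add: u_sharp_def cis_cnj)
  have S: "(\<Sum>k\<le>d. inverse (cis s) ^ k *\<^sub>M Rc n k) = (u (cis s))\<^sup>\<dagger> ** Y n (cis s)" for s
    using Rc_props(2)[OF n, of "cis s"] Z_times_ne_1[of _ "cis s"] by (simp add: u_sharp)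
  have "cis t + inverse (cis t) = of_real (2 * cos t)"
    by (simp add: complex_eq_iff)
  from opoly_eq[OF n _ this] show ?thesis
    using S[of t] S[of "-t"] by simp
qed

text \<open>By the symmetry of \<open>u\<close> the weight turns \<open>opoly n\<close> into one function on the circle, summed over
  \<open>z\<close> and its conjugate; the integral over the half circle thus becomes a contour integral.\<close>

lemma Wt_opoly:
  assumes n: "large n" and t: "0 < t" "t < pi"
  shows "Wt t ** opoly n (2 * cos t) = of_real (- 1 / (2 * pi)) *\<^sub>M
     ((cis (- t) * cis t ^ n) *\<^sub>M (Lam (cis t) ** Y n (cis t)) +
      (cis t * cis (- t) ^ n) *\<^sub>M (Lam (cis (- t)) ** Y n (cis (- t))))"
proof -
  define c where "c = cis t - cis (- t)"
  have c: "c \<noteq> 0" using sin_gt_zero[OF t] by (simp add: c_def complex_eq_iff)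
  have LL: "Lam (cis s) ** (Lam (cis s))\<^sup>\<dagger> ** ((u (cis s))\<^sup>\<dagger> ** M) = cnj ((cis s)\<^sup>2 - 1) *\<^sub>M (Lam (cis s) ** M)"
    if i: "invertible (u (cis s))" for s and M :: "complex^'l^'l"
  proof -
    have "u (cis s) ** Lam (cis s) = ((cis s)\<^sup>2 - 1) *\<^sub>M mat 1"
      by (simp add: Lam_eq[OF i pZ_cis] cs_simps mat_inv_r[OF i])
    hence "(Lam (cis s))\<^sup>\<dagger> ** (u (cis s))\<^sup>\<dagger> = cnj ((cis s)\<^sup>2 - 1) *\<^sub>M mat 1"
      by (simp only: herm_mult[symmetric] herm_cscale herm_mat_1)
    hence "Lam (cis s) ** ((Lam (cis s))\<^sup>\<dagger> ** (u (cis s))\<^sup>\<dagger>) ** M = cnj ((cis s)\<^sup>2 - 1) *\<^sub>M (Lam (cis s) ** M)"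
      by (simp add: cs_simps del: complex_cnj_diff)
    thus ?thesis by (simp add: matrix_mul_assoc)
  qed
  have e1: "cnj ((cis t)\<^sup>2 - 1) = - c * cis (- t)" "cnj ((cis (- t))\<^sup>2 - 1) = c * cis t"
    by (simp_all add: c_def cis_cnj power2_eq_square algebra_simps cis_mult)
  have "c *\<^sub>M (Wt t ** opoly n (2 * cos t)) = (1 / (2 * pi)) *\<^sub>R (Lam (cis t) ** (Lam (cis t))\<^sup>\<dagger> ** (c *\<^sub>M opoly n (2 * cos t)))"
    by (simp add: Wt_def mm.scaleR_left cs_simps cs.scaleR_right)
  also have "c *\<^sub>M opoly n (2 * cos t) =
     cis t ^ n *\<^sub>M ((u (cis t))\<^sup>\<dagger> ** Y n (cis t)) - cis (- t) ^ n *\<^sub>M ((u (cis (- t)))\<^sup>\<dagger> ** Y n (cis (- t)))"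
    unfolding c_def by (rule opoly_circle[OF n])
  also have "Lam (cis t) ** (Lam (cis t))\<^sup>\<dagger> ** \<dots> =
      cis t ^ n *\<^sub>M (Lam (cis t) ** (Lam (cis t))\<^sup>\<dagger> ** ((u (cis t))\<^sup>\<dagger> ** Y n (cis t)))
    - cis (- t) ^ n *\<^sub>M (Lam (cis (- t)) ** (Lam (cis (- t)))\<^sup>\<dagger> ** ((u (cis (- t)))\<^sup>\<dagger> ** Y n (cis (- t))))"
    by (simp only: mm.diff_right cscale_mult_right Lam_gram(2)[OF t])
  also have "\<dots> = (cis t ^ n * (- c * cis (- t))) *\<^sub>M (Lam (cis t) ** Y n (cis t))
    - (cis (- t) ^ n * (c * cis t)) *\<^sub>M (Lam (cis (- t)) ** Y n (cis (- t)))"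
    by (simp only: LL[OF cis_inv(1)[OF t]] LL[OF cis_inv(2)[OF t]] e1 cscale_cscale)
  also have "(1 / (2 * pi)) *\<^sub>R \<dots> = c *\<^sub>M (of_real (- 1 / (2 * pi)) *\<^sub>M
     ((cis (- t) * cis t ^ n) *\<^sub>M (Lam (cis t) ** Y n (cis t)) +
      (cis t * cis (- t) ^ n) *\<^sub>M (Lam (cis (- t)) ** Y n (cis (- t)))))"
    by (rule mat_eqI) (simp add: scaleR_conv_of_real[where 'a = complex] field_simps)
  finally show ?thesis unfolding cscale_cancel[OF c] .
qed

text \<open>Integration against the prospective spectral measure; the continuous part is
  parametrized by x = 2 cos t.\<close>

definition wint :: "(real \<Rightarrow> complex^'l^'l) \<Rightarrow> complex^'l^'l" where
  "wint F = (\<Sum>a\<in>Z. w a ** F (a + inverse a)) + integral {0..pi} (\<lambda>t. Wt t ** F (2 * cos t))"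

definition SY :: "complex set" where "SY = S0 \<inter> {z. \<forall>a\<in>Z. z * of_real a \<noteq> 1}"

lemma SY_open: "open SY"
proof -
  have "SY = S0 \<inter> (\<Inter>a\<in>Z. - {z. z * of_real a = 1})" by (auto simp: SY_def)
  moreover have "open (\<Inter>a\<in>Z. - {z. z * complex_of_real a = 1})"
    by (intro open_INT finite_Z ballI open_Compl closed_Collect_eq continuous_intros)
  ultimately show ?thesis using S0_open by auto
qed

lemma SY_cball: "cball 0 1 \<subseteq> SY"
  using Z_times_ne_1 by (auto simp: SY_def S0_def)

lemma Y_holo: "(\<lambda>z. Y n z $ i $ j) holomorphic_on SY"
  unfolding Y_def by (simp, intro holomorphic_intros) (auto simp: SY_def)

lemma LY_holo: "(\<lambda>z. (L z ** Y n z) $ i $ j) holomorphic_on SY"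
  unfolding matrix_mul_nth
  by (intro holomorphic_intros Y_holo holomorphic_on_subset[OF L_holo]) (auto simp: SY_def)

text \<open>By \<open>Wt_opoly\<close> the integrand is - 1 / (2 pi) times z^(n-1) f
  \<open>Lam\<close> \<open>Y n\<close>, symmetrized under conjugation. As dz = i z dt, one power of
  z is lost, whence z^(n-2). The hypothesis on f and h says that the test function adds a single
  simple pole c: it is 0 for monomials and the spectral parameter for Cauchy kernels.\<close>

lemma ac_integral:
  assumes n: "large n" and c: "c \<in> ball 0 1" "c \<notin> of_real ` Z"
    and S: "open S" "cball 0 1 \<subseteq> S" and h: "h holomorphic_on S"
    and f: "\<And>t. f (2 * cos t) * cis t ^ (n - 2) = h (cis t) / (cis t - c)"
  shows "((\<lambda>t. Wt t ** (f (2 * cos t) *\<^sub>M opoly n (2 * cos t))) has_integral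
     - ((h c / pZ c) *\<^sub>M (L c ** Y n c) +
        (\<Sum>a\<in>Z. (h (of_real a) / ((of_real a - c) * (\<Prod>b\<in>of_real ` Z - {of_real a}. of_real a - b))) *\<^sub>M
            (L (of_real a) ** Y n (of_real a))))) {0..pi}"
    (is "(?F has_integral - ?I) _")
proof (rule has_integral_componentwise_mat)
  fix i j
  have n2: "n \<ge> 2" using n by (simp add: large_def)
  define F where "F = insert c (of_real ` Z)"
  define H where "H = (\<lambda>z. h z * (L z ** Y n z) $ i $ j)"
  have F: "finite F" "F \<subseteq> ball 0 1" using finite_Z Z_props(4) c by (auto simp: F_def)
  have PF: "(\<Prod>a\<in>F. z - a) = (z - c) * pZ z" for z
    using finite_Z c by (simp add: F_def pZ_def)
  have res: "(\<Sum>a\<in>F. H a / (\<Prod>b\<in>F - {a}. a - b)) = ?I $ i $ j"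
  proof -
    have Fc: "F - {c} = of_real ` Z" using c by (auto simp: F_def)
    have Fa: "(\<Prod>b\<in>F - {of_real a}. of_real a - b)
        = (of_real a - c) * (\<Prod>b\<in>of_real ` Z - {of_real a}. of_real a - b)" if "a \<in> Z" for a
    proof -
      have "F - {of_real a} = insert c (of_real ` Z - {of_real a})" using c that by (auto simp: F_def)
      thus ?thesis using finite_Z c by simp
    qed
    have "(\<Sum>a\<in>F. H a / (\<Prod>b\<in>F - {a}. a - b)) = H c / pZ c + (\<Sum>a\<in>of_real ` Z. H a / (\<Prod>b\<in>F - {a}. a - b))"
      unfolding sum.remove[OF F(1), of c, unfolded Fc, simplified F_def insertI1, OF TrueI, folded F_def] pZ_def
      by (simp add: Fc)
    also have "(\<Sum>a\<in>of_real ` Z. H a / (\<Prod>b\<in>F - {a}. a - b)) = (\<Sum>a\<in>Z. H (of_real a) / (\<Prod>b\<in>F - {of_real a}. of_real a - b))"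
      by (subst sum.reindex) (auto intro: inj_onI)
    also have "\<dots> = (\<Sum>a\<in>Z. (h (of_real a) / ((of_real a - c) * (\<Prod>b\<in>of_real ` Z - {of_real a}. of_real a - b))) *
            (L (of_real a) ** Y n (of_real a)) $ i $ j)"
      by (intro sum.cong refl) (simp add: Fa H_def)
    finally show ?thesis by (simp add: H_def)
  qed
  define \<Psi> where "\<Psi> = (\<lambda>z. H z / (\<Prod>a\<in>F. z - a))"
  have Hh: "H holomorphic_on S \<inter> SY" unfolding H_def
    by (intro holomorphic_intros holomorphic_on_subset[OF h] holomorphic_on_subset[OF LY_holo]) auto
  have "(\<Psi> has_contour_integral (2 * pi * \<i> * ?I $ i $ j)) (circlepath 0 1)"
    using circle_integral_simple_poles[OF _ _ Hh F] S SY_open SY_cball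
    unfolding \<Psi>_def res by auto
  hence \<Psi>_int: "((\<lambda>t. \<Psi> (cis t) * \<i> * cis t) has_integral 2 * pi * \<i> * ?I $ i $ j) {0..2 * pi}"
    unfolding circlepath_def by (subst (asm) has_contour_integral_part_circlepath_iff) auto
  define J where "J = ?I $ i $ j"
  have eqs: "(\<lambda>t. (- 1 / (2 * pi * \<i>)) * (\<Psi> (cis t) * \<i> * cis t)) = (\<lambda>t. - (1 / (2 * pi)) * (\<Psi> (cis t) * cis t))"
    "(- 1 / (2 * pi * \<i>)) * (2 * pi * \<i> * J) = - J" by (simp_all add: fun_eq_iff field_simps)
  from has_integral_mult_right[OF \<Psi>_int[folded J_def], of "- 1 / (2 * pi * \<i>)"]
  have int: "((\<lambda>t. - (1 / (2 * pi)) * (\<Psi> (cis t) * cis t)) has_integral - J) {0..2 * pi}"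
    unfolding eqs .
  have "continuous_on {0..2 * pi} (\<lambda>t. \<Psi> (cis t))"
  proof (rule continuous_on_compose2[OF _ cis_cont])
    show "continuous_on (S \<inter> SY - F) \<Psi>" unfolding \<Psi>_def using F
      by (intro continuous_intros continuous_on_subset[OF holomorphic_on_imp_continuous_on[OF Hh]]) auto
    have "cis t \<in> cball 0 1" "cis t \<notin> ball 0 1" for t by simp_all
    thus "cis ` {0..2 * pi} \<subseteq> S \<inter> SY - F" using F(2) S(2) SY_cball by blast
  qed
  hence "continuous_on {0..2 * pi} (\<lambda>t. - (1 / (2 * pi)) * (\<Psi> (cis t) * cis t))"
    by (intro continuous_intros cis_cont)
  from has_integral_fold_circle[OF this int]
  have fold: "((\<lambda>t. - (1 / (2 * pi)) * (\<Psi> (cis t) * cis t) + - (1 / (2 * pi)) * (\<Psi> (cis (2 * pi - t)) * cis (2 * pi - t)))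
      has_integral - J) {0..pi}" .
  have \<Psi>: "\<Psi> (cis t) * cis t = f (2 * cos t) * (cis (- t) * cis t ^ n) * (Lam (cis t) ** Y n (cis t)) $ i $ j" for t
  proof -
    have "cis (- t) * cis t ^ n = cis (- t) * cis t * cis t * cis t ^ (n - 2)"
      using n2 by (simp add: power_eq_if mult.assoc numeral_2_eq_2)
    also have "cis (- t) * cis t = 1" by (simp add: cis_mult)
    finally have pw: "cis (- t) * cis t ^ n = cis t * cis t ^ (n - 2)" by simp
    have "f (2 * cos t) * (cis (- t) * cis t ^ n) = cis t * (h (cis t) / (cis t - c))"
      unfolding pw f[symmetric] by simp
    thus ?thesis by (simp add: \<Psi>_def H_def PF Lam_def cs_simps)
  qed
  have "(((\<lambda>t. ?F t $ i $ j)) has_integral - J) (cbox 0 pi)"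
  \<comment> \<open>\<open>Wt_opoly\<close> divides by z - 1/z and fails at the endpoints, which are
    negligible.\<close>
  proof (rule has_integral_spike_interior[OF fold[folded cbox_interval]])
    fix t assume "t \<in> box 0 pi"
    hence t: "0 < t" "t < pi" by auto
    have "cis (2 * pi - t) = cis (- t)" by (simp add: complex_eq_iff)
    hence e1: "\<Psi> (cis (2 * pi - t)) * cis (2 * pi - t)
        = f (2 * cos t) * (cis t * cis (- t) ^ n) * (Lam (cis (- t)) ** Y n (cis (- t))) $ i $ j"
      using \<Psi>[of "- t"] by simp
    have e2: "?F t $ i $ j = f (2 * cos t) * (Wt t ** opoly n (2 * cos t)) $ i $ j"
      by (simp add: cs_simps)
    have e3: "(Wt t ** opoly n (2 * cos t)) $ i $ j = - (1 / (2 * pi)) *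
     ((cis (- t) * cis t ^ n) * (Lam (cis t) ** Y n (cis t)) $ i $ j +
      (cis t * cis (- t) ^ n) * (Lam (cis (- t)) ** Y n (cis (- t))) $ i $ j)"
      unfolding Wt_opoly[OF n t] by simp
    show "?F t $ i $ j = - (1 / (2 * pi)) * (\<Psi> (cis t) * cis t) + - (1 / (2 * pi)) * (\<Psi> (cis (2 * pi - t)) * cis (2 * pi - t))"
      unfolding e1 e2 e3 \<Psi>[of t] by (simp add: algebra_simps)
  qed
  thus "((\<lambda>t. ?F t $ i $ j) has_integral (- ?I) $ i $ j) {0..pi}"
    unfolding J_def by simp
qed

text \<open>The residues at the zeros of \<open>u\<close> and the point masses are both multiples of
  R(a) Y_n(a), by \<open>L_at_Z\<close> and \<open>opoly_at_Z\<close>, and cancel. Only the residue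
  at c is left.\<close>

lemma wint_opoly:
  assumes n: "large n" and c: "c \<in> ball 0 1" "c \<notin> of_real ` Z"
    and S: "open S" "cball 0 1 \<subseteq> S" and h: "h holomorphic_on S"
    and f: "\<And>z x. cmod z = 1 \<or> z \<in> of_real ` Z \<Longrightarrow> z + inverse z = of_real x \<Longrightarrow> f x * z ^ (n - 2) = h z / (z - c)"
    and ic: "invertible (u c)"
  shows "wint (\<lambda>x. f x *\<^sub>M opoly n x) = - (((c\<^sup>2 - 1) * h c) *\<^sub>M (matrix_inv (u c) ** Y n c))"
proof -
  have "integral {0..pi} (\<lambda>t. Wt t ** (f (2 * cos t) *\<^sub>M opoly n (2 * cos t))) =
     - ((h c / pZ c) *\<^sub>M (L c ** Y n c) +
        (\<Sum>a\<in>Z. (h (of_real a) / ((of_real a - c) * (\<Prod>b\<in>of_real ` Z - {of_real a}. of_real a - b))) *\<^sub>M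
            (L (of_real a) ** Y n (of_real a))))"
  proof (intro integral_unique ac_integral[OF n c S h])
    fix t show "f (2 * cos t) * cis t ^ (n - 2) = h (cis t) / (cis t - c)"
      by (rule f) (auto simp: complex_eq_iff)
  qed
  moreover have "w a ** (f (a + inverse a) *\<^sub>M opoly n (a + inverse a)) =
     (h (of_real a) / ((of_real a - c) * (\<Prod>b\<in>of_real ` Z - {of_real a}. of_real a - b))) *\<^sub>M
            (L (of_real a) ** Y n (of_real a))" if a: "a \<in> Z" for a
  proof -
    define z where "z = complex_of_real a"
    define e where "e = (\<Prod>b\<in>of_real ` Z - {z}. z - b)"
    have e: "e \<noteq> 0" unfolding e_def using finite_Z by auto
    have z: "z \<noteq> 0" using Z_props[OF a] by (simp add: z_def)
    have n2: "z ^ n = z * z * z ^ (n - 2)"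
      using n by (simp add: power_eq_if mult.assoc numeral_2_eq_2 large_def)
    have fz: "f (a + inverse a) * z ^ (n - 2) = h z / (z - c)" by (rule f) (auto simp: z_def a)
    have "f (a + inverse a) * (((z - inverse z) / z) * z ^ n) = (f (a + inverse a) * z ^ (n - 2)) * (z\<^sup>2 - 1)"
      unfolding n2 using z by (simp add: field_simps power2_eq_square)
    also have "\<dots> = (h z / ((z - c) * e)) * ((z\<^sup>2 - 1) * e)" unfolding fz using e by simp
    finally have "f (a + inverse a) *\<^sub>M ((((z - inverse z) / z) * z ^ n) *\<^sub>M (R a ** Y n z))
       = (h z / ((z - c) * e)) *\<^sub>M (((z\<^sup>2 - 1) * e) *\<^sub>M (R a ** Y n z))" by (simp only: cscale_cscale)
    thus ?thesis
      using opoly_at_Z[OF n a] L_at_Z[OF a] by (simp add: cscale_mult_right cscale_mult_left z_def e_def)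
  qed
  ultimately have "wint (\<lambda>x. f x *\<^sub>M opoly n x) = - ((h c / pZ c) *\<^sub>M (L c ** Y n c))"
    by (simp add: wint_def)
  also have "(h c / pZ c) *\<^sub>M (L c ** Y n c) = ((c\<^sup>2 - 1) * h c) *\<^sub>M (matrix_inv (u c) ** Y n c)"
    using c by (simp add: L_eq[OF ic] cs_simps q_def pZ_0_iff mult.commute)
  finally show ?thesis .
qed


section \<open>Monic orthogonal polynomials\<close>

text \<open>The matrix-valued inner product: the integral of \<open>herm F\<close> d mu
  \<open>H\<close>, with the measure between the two factors.\<close>

definition mform :: "(real \<Rightarrow> complex^'l^'l) \<Rightarrow> (real \<Rightarrow> complex^'l^'l) \<Rightarrow> complex^'l^'l" where
  "mform F H = (\<Sum>a\<in>Z. (F (a + inverse a))\<^sup>\<dagger> ** w a ** H (a + inverse a)) +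
     integral {0..pi} (\<lambda>t. (F (2 * cos t))\<^sup>\<dagger> ** Wt t ** H (2 * cos t))"

abbreviation "cont F \<equiv> continuous_on UNIV (F :: real \<Rightarrow> complex^'l^'l)"

lemma wint_mform: "wint F = mform (\<lambda>_. mat 1) F"
  by (simp add: wint_def mform_def)

lemma cont_cos: "cont F \<Longrightarrow> continuous_on A (\<lambda>t. F (2 * cos t))"
  by (rule continuous_on_compose2[of UNIV F]) (auto intro!: continuous_intros)

lemma mform_integrand_cont:
  "cont F \<Longrightarrow> cont H \<Longrightarrow> continuous_on A (\<lambda>t. (F (2 * cos t))\<^sup>\<dagger> ** Wt t ** H (2 * cos t))"
  by (intro mm.continuous_on bounded_linear.continuous_on[OF bounded_linear_herm] cont_cos Wt_cont)

lemma mform_integrable: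
  "cont F \<Longrightarrow> cont H \<Longrightarrow> (\<lambda>t. (F (2 * cos t))\<^sup>\<dagger> ** Wt t ** H (2 * cos t)) integrable_on {0..pi}"
  by (intro integrable_continuous_interval mform_integrand_cont)

lemma mform_add: "cont F \<Longrightarrow> cont H \<Longrightarrow> cont H' \<Longrightarrow> mform F (\<lambda>x. H x + H' x) = mform F H + mform F H'"
  by (simp add: mform_def mm.add_right sum.distrib integral_add mform_integrable)

lemma mform_right: "cont F \<Longrightarrow> cont H \<Longrightarrow> mform F (\<lambda>x. H x ** M) = mform F H ** M"
  unfolding mform_def mm.add_left mm.sum_left matrix_mul_assoc
  using integral_linear[OF mform_integrable mm.bounded_linear_left, of F H M] by (simp add: o_def)

lemma mform_diff: "cont F \<Longrightarrow> cont H \<Longrightarrow> cont H' \<Longrightarrow> mform F (\<lambda>x. H x - H' x) = mform F H - mform F H'"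
  by (simp add: mform_def mm.diff_right sum_subtractf integral_diff mform_integrable)

lemma mform_herm: "cont F \<Longrightarrow> cont H \<Longrightarrow> (mform F H)\<^sup>\<dagger> = mform H F"
proof -
  assume c: "cont F" "cont H"
  have "(Wt t)\<^sup>\<dagger> = Wt t" for t using Wt_psd by (simp add: psd_def)
  hence "(integral {0..pi} (\<lambda>t. (F (2 * cos t))\<^sup>\<dagger> ** Wt t ** H (2 * cos t)))\<^sup>\<dagger>
     = integral {0..pi} (\<lambda>t. (H (2 * cos t))\<^sup>\<dagger> ** Wt t ** F (2 * cos t))"
    using integral_linear[OF mform_integrable[OF c] bounded_linear_herm]
    by (simp add: o_def herm_mult matrix_mul_assoc)
  thus ?thesis
    by (simp add: mform_def herm_add herm_sum herm_mult w_props matrix_mul_assoc cong: sum.cong)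
qed

lemma mform_scaleR: "mform (\<lambda>x. f x *\<^sub>R F x) H = mform F (\<lambda>x. f x *\<^sub>R H x)"
  by (simp add: mform_def herm_scaleR mm.scaleR_left mm.scaleR_right)

lemma mform_zero [simp]: "mform F (\<lambda>_. 0) = 0" "mform (\<lambda>_. 0) F = 0"
  by (simp_all add: mform_def)

lemma mform_left: "cont F \<Longrightarrow> cont H \<Longrightarrow> mform (\<lambda>x. F x ** M) H = M\<^sup>\<dagger> ** mform F H"
  unfolding mform_def mm.add_right mm.sum_right herm_mult
  using integral_linear[OF mform_integrable mm.bounded_linear_right, of F H "M\<^sup>\<dagger>"]
  by (simp add: o_def matrix_mul_assoc)

lemma mform_add_left: "cont F \<Longrightarrow> cont F' \<Longrightarrow> cont H \<Longrightarrow> mform (\<lambda>x. F x + F' x) H = mform F H + mform F' H"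
  by (simp add: mform_def herm_add mm.add_left sum.distrib integral_add mform_integrable)

lemma cont_mult: "cont F \<Longrightarrow> cont (\<lambda>x. F x ** M)"
  by (intro mm.continuous_on continuous_on_const)

lemma cont_X: "cont F \<Longrightarrow> cont (\<lambda>x. x *\<^sub>R F x)"
  by (intro continuous_intros)

lemma mform_psd: "cont F \<Longrightarrow> psd (mform F F)"
  and qform_mform: "cont F \<Longrightarrow> qform (mform F F) v = (\<Sum>a\<in>Z. qform (w a) (F (a + inverse a) *v v)) +
     integral {0..pi} (\<lambda>t. qform (Wt t) (F (2 * cos t) *v v))"
proof -
  assume c: "cont F"
  show eq: "qform (mform F F) v = (\<Sum>a\<in>Z. qform (w a) (F (a + inverse a) *v v)) +
     integral {0..pi} (\<lambda>t. qform (Wt t) (F (2 * cos t) *v v))" for v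
    unfolding mform_def qform_add qform_sum qform_gram
    using integral_linear[OF mform_integrable[OF c c] bounded_linear_qform, of v]
    by (simp add: o_def qform_gram)
  have "0 \<le> Re (qform (mform F F) v)" for v
  proof -
    have "continuous_on {0..pi} (\<lambda>t. qform (Wt t) (F (2 * cos t) *v v))"
      unfolding qform_gram[symmetric]
      by (intro bounded_linear.continuous_on[OF bounded_linear_qform] mform_integrand_cont c)
    hence int: "(\<lambda>t. qform (Wt t) (F (2 * cos t) *v v)) integrable_on {0..pi}"
      by (rule integrable_continuous_interval)
    have "Re (integral {0..pi} (\<lambda>t. qform (Wt t) (F (2 * cos t) *v v)))
        = integral {0..pi} (\<lambda>t. Re (qform (Wt t) (F (2 * cos t) *v v)))"
      using integral_linear[OF int bounded_linear_Re] by (simp add: o_def)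
    also have "\<dots> \<ge> 0"
      using integrable_linear[OF int bounded_linear_Re] Wt_psd
      by (intro Henstock_Kurzweil_Integration.integral_nonneg) (auto simp: o_def psd_def)
    finally show ?thesis unfolding eq
      using w_props(1) by (auto simp: psd_def intro!: add_nonneg_nonneg sum_nonneg)
  qed
  thus "psd (mform F F)" using mform_herm[OF c c] by (simp add: psd_def)
qed

lemma Wt_pos:
  assumes t: "0 < t" "t < pi" and z: "qform (Wt t) y = 0" shows "y = 0"
proof -
  have i: "invertible (u (cis t))" by (rule cis_inv[OF t])
  have q: "qform (Wt t) y = of_real ((1 / (2 * pi)) * (norm ((Lam (cis t))\<^sup>\<dagger> *v y))\<^sup>2)"
    using qform_gram[of "(Lam (cis t))\<^sup>\<dagger>" "mat 1" y]
    by (simp add: Wt_def qform_scaleR qform_mat_1 scaleR_conv_of_real[where 'a = complex])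
  have L0: "(Lam (cis t))\<^sup>\<dagger> *v y = 0" using z unfolding q by simp
  have "Lam (cis t) ** u (cis t) = ((cis t)\<^sup>2 - 1) *\<^sub>M mat 1"
    by (simp add: Lam_eq[OF i pZ_cis] cs_simps mat_inv_l[OF i])
  hence "(u (cis t))\<^sup>\<dagger> ** (Lam (cis t))\<^sup>\<dagger> = cnj ((cis t)\<^sup>2 - 1) *\<^sub>M mat 1"
    by (simp only: herm_mult[symmetric] herm_cscale herm_mat_1)
  moreover have "((u (cis t))\<^sup>\<dagger> ** (Lam (cis t))\<^sup>\<dagger>) *v y = 0"
    by (simp add: mm_vec L0)
  ultimately have "cnj ((cis t)\<^sup>2 - 1) *s y = 0" by (simp add: cscale_vec)
  moreover have "(cis t)\<^sup>2 - 1 \<noteq> 0" using sin_gt_zero[OF t] unfolding norm_cis_sq by simp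
  ultimately show "y = 0"
    by (metis complex_cnj_zero_iff vector_mul_eq_0)
qed

text \<open>A null vector v of the Gram matrix would make \<open>F x *v v\<close> vanish on all of
  (-2, 2), because the density is positive definite there. A monic \<open>F\<close> allows only
  finitely many such x.\<close>

lemma mform_pos:
  assumes F: "deg_lt n (\<lambda>x. F x - x ^ n *\<^sub>R mat 1)" "cont F"
  shows "invertible (mform F F)"
proof (rule ccontr)
  assume "\<not> invertible (mform F F)"
  then obtain v where v: "v \<noteq> 0" "mform F F *v v = 0"
    by (metis invertible_left_inverse matrix_left_invertible_ker invertible_def)
  define g where "g = (\<lambda>t. Re (qform (Wt t) (F (2 * cos t) *v v)))"
  have c: "continuous_on {0..pi} (\<lambda>t. qform (Wt t) (F (2 * cos t) *v v))"
    unfolding qform_gram[symmetric]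
    by (intro bounded_linear.continuous_on[OF bounded_linear_qform] mform_integrand_cont F)
  have gc: "continuous_on {0..pi} g" unfolding g_def by (intro continuous_intros c)
  have g0: "0 \<le> g t" for t using Wt_psd by (simp add: g_def psd_def)
  have "0 = Re (qform (mform F F) v)" by (simp add: qform_cinner v cinner.zero_right)
  also have "\<dots> = (\<Sum>a\<in>Z. Re (qform (w a) (F (a + inverse a) *v v))) + integral {0..pi} g"
    unfolding qform_mform[OF F(2)] g_def
    using integral_linear[OF integrable_continuous_interval[OF c] bounded_linear_Re] by (simp add: o_def)
  finally have "(\<Sum>a\<in>Z. Re (qform (w a) (F (a + inverse a) *v v))) + integral {0..pi} g = 0" ..
  moreover have "(\<Sum>a\<in>Z. Re (qform (w a) (F (a + inverse a) *v v))) \<ge> 0"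
    using w_props(1) by (auto simp: psd_def intro!: sum_nonneg)
  moreover have "integral {0..pi} g \<ge> 0"
    by (intro Henstock_Kurzweil_Integration.integral_nonneg integrable_continuous_interval gc g0)
  ultimately have "integral {0..pi} g = 0" by linarith
  hence z: "\<forall>t\<in>{0..pi}. g t = 0" using integral_eq_0_iff[OF gc pi_gt_zero] g0 by simp
  have "F (2 * cos t) *v v = 0" if t: "0 < t" "t < pi" for t
  proof -
    have "(Wt t)\<^sup>\<dagger> = Wt t" using Wt_psd by (simp add: psd_def)
    from herm_qform_real[OF this] have "qform (Wt t) (F (2 * cos t) *v v) = of_real (g t)"
      unfolding g_def by (metis of_real_Re)
    thus ?thesis using z t by (intro Wt_pos[OF t]) auto
  qed
  hence "(\<lambda>t. 2 * cos t) ` {0<..<pi} \<subseteq> {x. F x *v v = 0}" by auto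
  moreover have "infinite ((\<lambda>t. 2 * cos t) ` {0<..<pi})"
  proof (subst finite_image_iff)
    show "inj_on (\<lambda>t. 2 * cos t) {0<..<pi}"
      by (rule inj_onI) (auto dest: cos_inj_pi[rotated 4])
    show "infinite {0<..<pi}" by (rule infinite_Ioo) simp
  qed
  ultimately show False using monic_finite_zeros[OF F(1) v(1)] finite_subset by blast
qed

text \<open>The Stieltjes procedure. The junk matrix \<open>matrix_inv (mform (P 0) (P 0))\<close> is multiplied by \<open>P 0 = 0\<close>.\<close>

fun P :: "nat \<Rightarrow> real \<Rightarrow> complex^'l^'l" where
  "P 0 = (\<lambda>_. 0)"
| "P (Suc 0) = (\<lambda>_. mat 1)"
| "P (Suc (Suc n)) = (\<lambda>x. x *\<^sub>R P (Suc n) x -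
     P (Suc n) x ** (matrix_inv (mform (P (Suc n)) (P (Suc n))) ** mform (P (Suc n)) (\<lambda>x. x *\<^sub>R P (Suc n) x)) -
     P n x ** (matrix_inv (mform (P n) (P n)) ** mform (P (Suc n)) (P (Suc n))))"

definition K :: "nat \<Rightarrow> complex^'l^'l" where "K n = mform (P n) (P n)"
definition bb :: "nat \<Rightarrow> complex^'l^'l" where "bb n = matrix_inv (K n) ** mform (P n) (\<lambda>x. x *\<^sub>R P n x)"
definition aa :: "nat \<Rightarrow> complex^'l^'l" where "aa n = matrix_inv (K (n - 1)) ** K n"

lemma P_rec: "P (Suc (Suc n)) x = x *\<^sub>R P (Suc n) x - P (Suc n) x ** bb (Suc n) - P n x ** aa (Suc n)"
  by (simp add: bb_def aa_def K_def)

lemma P_lead: "deg_lt n (\<lambda>x. P (Suc n) x - x ^ n *\<^sub>R mat 1)" "deg_lt (Suc n) (P (Suc n))" "deg_lt n (P n)"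
proof -
  have "deg_lt n (P n) \<and> deg_lt n (\<lambda>x. P (Suc n) x - x ^ n *\<^sub>R mat 1) \<and> deg_lt (Suc n) (P (Suc n))" for n
  proof (induction n)
    case 0 thus ?case by (auto intro: deg_lt_const)
  next
    case (Suc n)
    have "deg_lt (Suc n) (\<lambda>x. x *\<^sub>R (P (Suc n) x - x ^ n *\<^sub>R mat 1) - P (Suc n) x ** bb (Suc n) - P n x ** aa (Suc n))"
      using Suc by (intro deg_lt_diff[OF deg_lt_diff[OF deg_lt_X]] deg_lt_mult_right) (auto intro: deg_lt_mono)
    hence 1: "deg_lt (Suc n) (\<lambda>x. P (Suc (Suc n)) x - x ^ Suc n *\<^sub>R mat 1)"
      unfolding P_rec by (simp add: scaleR_diff_right algebra_simps)
    have "deg_lt (Suc (Suc n)) (\<lambda>x. (P (Suc (Suc n)) x - x ^ Suc n *\<^sub>R mat 1) + x ^ Suc n *\<^sub>R mat 1)"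
      by (intro deg_lt_add deg_lt_monom deg_lt_mono[OF 1]) auto
    thus ?case using 1 Suc by simp
  qed
  thus "deg_lt n (\<lambda>x. P (Suc n) x - x ^ n *\<^sub>R mat 1)" "deg_lt (Suc n) (P (Suc n))" "deg_lt n (P n)" by blast+
qed

lemma P_cont: "cont (P n)" by (rule deg_lt_continuous[OF P_lead(3)])

lemma K_inv: "n \<ge> 1 \<Longrightarrow> invertible (K n)"
  unfolding K_def using mform_pos[OF P_lead(1)[of "n - 1"]] P_cont by simp

lemma K_psd: "psd (K n)" unfolding K_def by (rule mform_psd[OF P_cont])
lemma K_herm: "(K n)\<^sup>\<dagger> = K n" using K_psd by (simp add: psd_def)

lemma xP: "x *\<^sub>R P (Suc n) x = P (Suc (Suc n)) x + P (Suc n) x ** bb (Suc n) + P n x ** aa (Suc n)"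
  unfolding P_rec by simp

text \<open>Multiplication by x can be moved to the factor of smaller index, where the recurrence
  produces only the indices m + 1, m and m - 1. The coefficients \<open>bb\<close> and
  \<open>aa\<close> are made to cancel the two cases in which one of these meets
  \<open>Suc k\<close>.\<close>

lemma P_orth_less: "m < n \<Longrightarrow> mform (P m) (P n) = 0"
proof (induction n arbitrary: m rule: less_induct)
  case (less n)
  have IH: "mform (P i) (P j) = 0" if "i \<noteq> j" "i < n" "j < n" for i j
  proof (cases "i < j")
    case True thus ?thesis using less.IH that by blast
  next
    case False
    hence "mform (P j) (P i) = 0" using less.IH that by simp
    thus ?thesis using mform_herm[OF P_cont P_cont, of j i] by simp
  qed
  consider "n = 1" | k where "n = Suc (Suc k)" using less.prems by (metis One_nat_def less_nat_zero_code not0_implies_Suc)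
  thus ?case
  proof cases
    case 1 thus ?thesis using less.prems by simp
  next
    case 2
    note c = P_cont cont_X cont_mult
    have main: "mform (P m) (P n) = mform (P m) (\<lambda>x. x *\<^sub>R P (Suc k) x) - mform (P m) (P (Suc k)) ** bb (Suc k)
       - mform (P m) (P k) ** aa (Suc k)"
      unfolding 2 P_rec
      by (subst mform_diff, (intro c continuous_intros)+, subst mform_diff, (intro c)+)
        (simp add: mform_right c)
    show ?thesis
    proof (cases m)
      case 0 thus ?thesis by simp
    next
      case (Suc i)
      have "mform (P m) (\<lambda>x. x *\<^sub>R P (Suc k) x) = mform (\<lambda>x. x *\<^sub>R P m x) (P (Suc k))"
        by (rule mform_scaleR[symmetric])
      also have "\<dots> = mform (P (Suc m)) (P (Suc k)) + (bb m)\<^sup>\<dagger> ** mform (P m) (P (Suc k)) + (aa m)\<^sup>\<dagger> ** mform (P i) (P (Suc k))"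
        unfolding Suc xP
        by (subst mform_add_left, (intro c continuous_intros)+, subst mform_add_left, (intro c)+)
          (simp add: mform_left c)
      also have "mform (P i) (P (Suc k)) = 0" using less.prems 2 Suc by (intro IH) auto
      finally have e: "mform (P m) (\<lambda>x. x *\<^sub>R P (Suc k) x) =
         mform (P (Suc m)) (P (Suc k)) + (bb m)\<^sup>\<dagger> ** mform (P m) (P (Suc k))" by simp
      consider "m = Suc k" | "m = k" | "m < k" using less.prems 2 by linarith
      thus ?thesis
      proof cases
        case a: 1
        have "mform (P m) (P k) = 0" using a 2 by (intro IH) auto
        thus ?thesis unfolding main
          by (simp add: a bb_def K_def[symmetric] matrix_mul_assoc mat_inv_r K_inv)
      next
        case a: 2
        have "mform (P m) (P (Suc k)) = 0" using a 2 by (intro IH) auto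
        \<comment> \<open>Here k = m is a successor, so \<open>K k\<close> is invertible;
          \<open>K 0\<close> is 0.\<close>
        moreover have "K k ** aa (Suc k) = K (Suc k)"
          using Suc a by (simp add: aa_def matrix_mul_assoc mat_inv_r K_inv)
        ultimately show ?thesis unfolding main e by (simp add: a K_def)
      next
        case a: 3
        have "mform (P m) (P (Suc k)) = 0" "mform (P m) (P k) = 0" "mform (P (Suc m)) (P (Suc k)) = 0"
          using a 2 by (auto intro!: IH)
        thus ?thesis unfolding main e by simp
      qed
    qed
  qed
qed

lemma P_orth: "m \<noteq> n \<Longrightarrow> mform (P m) (P n) = 0"
  using P_orth_less[of m n] P_orth_less[of n m] mform_herm[OF P_cont P_cont, of n m]
  by (metis herm_zero linorder_neqE_nat)

lemma deg_lt_reduce: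
  assumes "deg_lt (Suc m) F" shows "\<exists>c. deg_lt m (\<lambda>x. F x - P (Suc m) x ** c)"
proof -
  obtain c where c: "\<And>x. F x = (\<Sum>k<Suc m. x ^ k *\<^sub>R c k)" using assms by (auto simp: deg_lt_def)
  have 1: "deg_lt m (\<lambda>x. \<Sum>k<m. x ^ k *\<^sub>R c k)" by (intro deg_lt_sum deg_lt_monom) auto
  have "deg_lt m (\<lambda>x. (\<Sum>k<m. x ^ k *\<^sub>R c k) - (P (Suc m) x - x ^ m *\<^sub>R mat 1) ** c m)"
    by (intro deg_lt_diff 1 deg_lt_mult_right P_lead)
  moreover have "(\<Sum>k<m. x ^ k *\<^sub>R c k) - (P (Suc m) x - x ^ m *\<^sub>R mat 1) ** c m = F x - P (Suc m) x ** c m" for x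
    unfolding c by (simp add: mm.diff_left mm.scaleR_left)
  ultimately show ?thesis by auto
qed

lemma deg_lt_orth: "deg_lt m F \<Longrightarrow> m < n \<Longrightarrow> mform F (P n) = 0"
proof (induction m arbitrary: F)
  case 0 hence "F = (\<lambda>_. 0)" using deg_lt_0D by blast thus ?case by simp
next
  case (Suc m)
  obtain c where c: "deg_lt m (\<lambda>x. F x - P (Suc m) x ** c)" using deg_lt_reduce[OF Suc.prems(1)] by blast
  have "mform F (P n) = mform (\<lambda>x. (F x - P (Suc m) x ** c) + P (Suc m) x ** c) (P n)" by simp
  also have "\<dots> = 0 + c\<^sup>\<dagger> ** mform (P (Suc m)) (P n)"
    using Suc by (subst mform_add_left)
      (auto intro!: P_cont cont_mult deg_lt_continuous[OF c] simp: mform_left P_cont Suc.IH[OF c])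
  finally show ?case using Suc.prems by (simp add: P_orth)
qed

lemma deg_lt_orth_zero:
  "deg_lt m F \<Longrightarrow> (\<And>j. j < m \<Longrightarrow> mform (P (Suc j)) F = 0) \<Longrightarrow> F x = 0"
proof (induction m)
  case 0 thus ?case by (auto dest: deg_lt_0D)
next
  case (Suc m)
  obtain c where c: "deg_lt m (\<lambda>x. F x - P (Suc m) x ** c)" using deg_lt_reduce[OF Suc.prems(1)] by blast
  have "0 = mform (P (Suc m)) (\<lambda>x. (F x - P (Suc m) x ** c) + P (Suc m) x ** c)"
    using Suc.prems by simp
  also have "\<dots> = mform (P (Suc m)) (\<lambda>x. F x - P (Suc m) x ** c) + K (Suc m) ** c"
    by (subst mform_add) (auto intro!: P_cont cont_mult deg_lt_continuous[OF c] simp: mform_right P_cont K_def)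
  also have "mform (P (Suc m)) (\<lambda>x. F x - P (Suc m) x ** c) = 0"
    using deg_lt_orth[OF c, of "Suc m"] mform_herm[OF deg_lt_continuous[OF c] P_cont, of "Suc m"] by simp
  finally have "matrix_inv (K (Suc m)) ** (K (Suc m) ** c) = 0" by simp
  hence "c = 0" by (simp add: matrix_mul_assoc mat_inv_l K_inv)
  hence "deg_lt m F" using c by simp
  thus ?case using Suc by auto
qed


section \<open>Jacobi parameters\<close>

lemma opoly_deg_lt: "large n \<Longrightarrow> deg_lt n (opoly n)"
proof -
  assume n: "large n"
  have n1: "n \<ge> 1" using n by (simp add: large_def)
  have "deg_lt n (\<lambda>x. (opoly n x - x ^ (n - 1) *\<^sub>R u_sharp 0) + x ^ (n - 1) *\<^sub>R u_sharp 0)"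
    by (intro deg_lt_add deg_lt_monom deg_lt_mono[OF opoly_lead[OF n]]) (use n1 in auto)
  thus ?thesis by simp
qed

text \<open>Take c = 0 in \<open>wint_opoly\<close>. Since x z = z^2 + 1, the test function x^k
  leads to h(z) = (z^2 + 1)^k z^(n-1-k), and h(0) is nonzero only for k = n - 1.\<close>

lemma mform_opoly_monom:
  assumes n: "large n" and k: "k \<le> n - 1"
  shows "mform (\<lambda>x. x ^ k *\<^sub>R mat 1) (opoly n) = (if k = n - 1 then matrix_inv (u 0) ** Y n 0 else 0)"
proof -
  have n2: "n \<ge> 2" using n by (simp add: large_def)
  have "mform (\<lambda>x. x ^ k *\<^sub>R mat 1) (opoly n) = wint (\<lambda>x. of_real x ^ k *\<^sub>M opoly n x)"
    unfolding wint_mform mform_scaleR by (simp flip: cscale_of_real)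
  also have "\<dots> = - (((0\<^sup>2 - 1) * ((0\<^sup>2 + 1) ^ k * 0 ^ (n - 1 - k))) *\<^sub>M (matrix_inv (u 0) ** Y n 0))"
  proof (rule wint_opoly[OF n, of 0 UNIV "\<lambda>z. (z\<^sup>2 + 1) ^ k * z ^ (n - 1 - k)" "\<lambda>x. of_real x ^ k"])
    show "0 \<notin> complex_of_real ` Z" using Z_props(2) by auto
    show "(\<lambda>z. (z\<^sup>2 + 1) ^ k * z ^ (n - 1 - k)) holomorphic_on UNIV" by (intro holomorphic_intros)
    show "invertible (u 0)" by (rule u_inv) simp
    fix z :: complex and x assume z: "cmod z = 1 \<or> z \<in> of_real ` Z" "z + inverse z = of_real x"
    have z0: "z \<noteq> 0" using z(1) Z_props(2) by auto
    have x: "of_real x * z = z\<^sup>2 + 1" using z0 unfolding z(2)[symmetric] by (simp add: algebra_simps power2_eq_square)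
    have "n - 1 = k + (n - 1 - k)" using k by simp
    hence "z ^ (n - 1) = z ^ k * z ^ (n - 1 - k)" by (metis power_add)
    moreover have "z ^ (n - 1) = z * z ^ (n - 2)"
      using n2 by (metis Suc_1 Suc_diff_Suc Suc_le_lessD One_nat_def power_Suc)
    ultimately have zz: "z * z ^ (n - 2) = z ^ k * z ^ (n - 1 - k)" by simp
    have "of_real x ^ k * z ^ (n - 2) * z = of_real x ^ k * z ^ k * z ^ (n - 1 - k)"
      using zz by (simp add: mult_ac)
    also have "\<dots> = (z\<^sup>2 + 1) ^ k * z ^ (n - 1 - k)" by (simp add: x flip: power_mult_distrib)
    finally show "of_real x ^ k * z ^ (n - 2) = (z\<^sup>2 + 1) ^ k * z ^ (n - 1 - k) / (z - 0)"
      using z0 by (simp add: field_simps)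
  qed auto
  also have "\<dots> = (if k = n - 1 then matrix_inv (u 0) ** Y n 0 else 0)"
    using k by (auto simp: power_0_left cs.zero_left cs.minus_left)
  finally show ?thesis .
qed

lemma mform_monom_zero:
  assumes F: "deg_lt m F" and H: "cont H" and z: "\<And>k. k < m \<Longrightarrow> mform (\<lambda>x. x ^ k *\<^sub>R mat 1) H = 0"
  shows "mform F H = 0"
proof -
  obtain c where c: "\<And>x. F x = (\<Sum>k<m. x ^ k *\<^sub>R c k)" using F by (auto simp: deg_lt_def)
  have "mform (\<lambda>x. \<Sum>k<m. x ^ k *\<^sub>R c k) H = 0" using z
  proof (induction m)
    case (Suc m)
    have "mform (\<lambda>x. (\<Sum>k<m. x ^ k *\<^sub>R c k) + (x ^ m *\<^sub>R mat 1) ** c m) H = 0 + (c m)\<^sup>\<dagger> ** 0"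
      using Suc H by (subst mform_add_left) (auto intro!: continuous_intros cont_mult simp: mform_left continuous_intros)
    thus ?case by (simp add: mm.scaleR_left)
  qed simp
  thus ?thesis using c by presburger
qed

text \<open>Both sides have leading term x^(n-1) \<open>u_sharp 0\<close> and are orthogonal to all
  lower degrees. Their difference has lower degree and is orthogonal to itself.\<close>

lemma opoly_P:
  assumes n: "large n" shows "opoly n x = P n x ** u_sharp 0"
proof -
  have n2: "n \<ge> 2" using n by (simp add: large_def)
  obtain m where m: "n = Suc m" using n2 by (cases n) auto
  note sc = deg_lt_continuous[OF opoly_deg_lt[OF n]]
  have "deg_lt m (\<lambda>x. (opoly n x - x ^ (n - 1) *\<^sub>R u_sharp 0) - (P (Suc m) x - x ^ m *\<^sub>R mat 1) ** u_sharp 0)"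
    using deg_lt_diff[OF opoly_lead[OF n] deg_lt_mult_right[OF P_lead(1)]] by (simp add: m)
  hence deg_lt: "deg_lt m (\<lambda>x. opoly n x - P n x ** u_sharp 0)"
    by (simp add: m mm.diff_left mm.scaleR_left)
  have "mform (P (Suc j)) (\<lambda>x. opoly n x - P n x ** u_sharp 0) = 0" if j: "j < m" for j
  proof -
    have "mform (P (Suc j)) (opoly n) = 0"
      by (rule mform_monom_zero[OF P_lead(3) sc]) (subst mform_opoly_monom[OF n]; use j m in auto)
    moreover have "mform (P (Suc j)) (P n) = 0" using j m by (intro P_orth) auto
    ultimately show ?thesis by (simp add: mform_diff P_cont sc cont_mult mform_right)
  qed
  from deg_lt_orth_zero[OF deg_lt this, of x] show ?thesis by simp
qed

lemma u0_inv: "invertible (u 0)" "invertible (u_sharp 0)"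
  using u_inv[of 0] by (auto simp: u_sharp_0 intro: invertible_herm)

text \<open>By orthogonality the first argument of the form may be replaced by its leading monomial,
  for which the value is known.\<close>

lemma K_eq:
  assumes n: "large n"
  shows "K n = matrix_inv (u 0) ** Y n 0 ** (matrix_inv (u 0))\<^sup>\<dagger>"
proof -
  have n2: "n \<ge> 2" using n by (simp add: large_def)
  obtain m where m: "n = Suc m" using n2 by (cases n) auto
  have cx: "cont (\<lambda>x. x ^ m *\<^sub>R mat 1)" by (intro continuous_intros)
  have "K n = mform (\<lambda>x. (P n x - x ^ m *\<^sub>R mat 1) + x ^ m *\<^sub>R mat 1) (P n)" by (simp add: K_def)
  also have "\<dots> = mform (\<lambda>x. P n x - x ^ m *\<^sub>R mat 1) (P n) + mform (\<lambda>x. x ^ m *\<^sub>R mat 1) (P n)"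
    by (intro mform_add_left continuous_on_diff P_cont cx)
  also have "mform (\<lambda>x. P n x - x ^ m *\<^sub>R mat 1) (P n) = 0"
    by (rule deg_lt_orth[of m]) (auto simp: m intro: P_lead)
  also have "P n = (\<lambda>x. opoly n x ** matrix_inv (u_sharp 0))"
    by (simp add: opoly_P[OF n] mat_inv_r[OF u0_inv(2)] flip: matrix_mul_assoc)
  also have "mform (\<lambda>x. x ^ m *\<^sub>R mat 1) \<dots> = mform (\<lambda>x. x ^ m *\<^sub>R mat 1) (opoly n) ** matrix_inv (u_sharp 0)"
    by (intro mform_right cx deg_lt_continuous[OF opoly_deg_lt[OF n]])
  also have "\<dots> = matrix_inv (u 0) ** Y n 0 ** matrix_inv (u_sharp 0)"
    using mform_opoly_monom[OF n, of m] m by simp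
  finally show ?thesis by (simp add: u_sharp_0 matrix_inv_herm u0_inv)
qed

section \<open>Square roots of \<open>Y n 0\<close> and normalization\<close>

definition Y_dev :: "nat \<Rightarrow> complex^'l^'l" where "Y_dev n = Y n 0 - mat 1"
definition sqrt_dev :: "nat \<Rightarrow> complex^'l^'l" where
  "sqrt_dev n = (SOME s. s\<^sup>\<dagger> = s \<and> norm s \<le> norm (Y_dev n) \<and> (mat 1 + s) ** (mat 1 + s) = mat 1 + Y_dev n)"
definition sqrtY :: "nat \<Rightarrow> complex^'l^'l" where "sqrtY n = mat 1 + sqrt_dev n"
definition very_large :: "nat \<Rightarrow> bool" where "very_large n \<longleftrightarrow> large n \<and> norm (Y_dev n) \<le> 1/2"

lemma exp_decay_Y_dev: "exp_decay Y_dev" unfolding Y_dev_def by (rule exp_decay_Y)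

lemma ev_very_large: "\<forall>\<^sub>F n in sequentially. very_large n"
proof -
  have "\<forall>\<^sub>F n in sequentially. norm (Y_dev n) < 1/2"
    using tendsto_norm_zero[OF exp_decay_tendsto[OF exp_decay_Y_dev]] by (rule order_tendstoD) simp
  with ev_large show ?thesis by eventually_elim (simp add: very_large_def)
qed

text \<open>Through the Gram matrix, \<open>Y n 0\<close> turns out to be Hermitian and invertible,
  which its partial fractions do not show.\<close>

lemma Y0_eq: "large n \<Longrightarrow> Y n 0 = u 0 ** K n ** (u 0)\<^sup>\<dagger>"
proof -
  assume n: "large n"
  have "u 0 ** K n ** (u 0)\<^sup>\<dagger> = (u 0 ** matrix_inv (u 0)) ** Y n 0 ** (u 0 ** matrix_inv (u 0))\<^sup>\<dagger>"
    unfolding K_eq[OF n] herm_mult by (simp add: matrix_mul_assoc)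
  thus ?thesis by (simp add: mat_inv_r u0_inv)
qed

lemma Y0_inv: "large n \<Longrightarrow> invertible (Y n 0)"
  unfolding Y0_eq using u0_inv invertible_herm K_inv[of n]
  by (intro invertible_mult) (auto simp: large_def)

lemma Y_dev_herm: "large n \<Longrightarrow> (Y_dev n)\<^sup>\<dagger> = Y_dev n"
  by (simp add: Y_dev_def herm_diff Y0_eq herm_mult K_herm matrix_mul_assoc)

lemma sqrtY_props:
  assumes "very_large n"
  shows "(sqrt_dev n)\<^sup>\<dagger> = sqrt_dev n" "norm (sqrt_dev n) \<le> norm (Y_dev n)" "sqrtY n ** sqrtY n = Y n 0" "(sqrtY n)\<^sup>\<dagger> = sqrtY n" "invertible (sqrtY n)"
proof -
  have g: "large n" using assms by (simp add: very_large_def)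
  have "\<exists>s. s\<^sup>\<dagger> = s \<and> norm s \<le> norm (Y_dev n) \<and> (mat 1 + s) ** (mat 1 + s) = mat 1 + Y_dev n"
    using assms by (intro hermitian_sqrt_near_1 Y_dev_herm) (auto simp: very_large_def)
  from someI_ex[OF this, folded sqrt_dev_def]
  show 1: "(sqrt_dev n)\<^sup>\<dagger> = sqrt_dev n" "norm (sqrt_dev n) \<le> norm (Y_dev n)" and 2: "sqrtY n ** sqrtY n = Y n 0"
    by (auto simp: sqrtY_def Y_dev_def)
  show "(sqrtY n)\<^sup>\<dagger> = sqrtY n" by (simp add: sqrtY_def herm_add 1)
  show "invertible (sqrtY n)" using Y0_inv[OF g] 2 invertible_mult_cancel by metis
qed

definition N :: nat where "N = (SOME N. \<forall>n\<ge>N. very_large n)"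

lemma N_very_large: "n \<ge> N \<Longrightarrow> very_large n"
  using someI_ex[OF ev_very_large[unfolded eventually_sequentially], folded N_def] by blast

lemma N_ge_2: "N \<ge> 2"
  using N_very_large[of N] by (simp add: very_large_def large_def)

lemma exp_decay_sqrt_dev: "exp_decay sqrt_dev"
  by (rule exp_decay_le[OF exp_decay_Y_dev, of _ 1])
    (use N_very_large sqrtY_props(2) in \<open>auto intro!: eventually_sequentiallyI[of N]\<close>)

text \<open>The normalization is unique up to a unitary factor. For \<open>n \<ge> N\<close> it is chosen such that the Jost
  solution converges to \<open>z\<^sup>n\<close>, and the value \<open>1\<close> at \<open>n = 1\<close> corresponds to \<open>A\<^sub>0 = 1\<close>.\<close>

definition kappa :: "nat \<Rightarrow> complex^'l^'l" where
  "kappa n = (if n \<le> 1 then mat 1 else if N \<le> n then u_sharp 0 ** matrix_inv (sqrtY n)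
    else (SOME k. k ** k\<^sup>\<dagger> = matrix_inv (K n)))"

lemma K_1: "K 1 = mat 1"
proof -
  have "integral {0..pi} Wt = integral {0..pi} (\<lambda>t. (2 / pi) *\<^sub>R (sin t)\<^sup>2 *\<^sub>R matrix_inv ((u (cis t))\<^sup>\<dagger> ** u (cis t)))"
    \<comment> \<open>The two expressions may differ at the endpoints only, where \<open>u\<close>
      can be singular and \<open>matrix_inv\<close> unspecified.\<close>
    by (rule integral_spike[of "{0, pi}"]) (auto simp: Wt_eq)
  also have "\<dots> = (2 / pi) *\<^sub>R integral {0..pi} (\<lambda>t. (sin t)\<^sup>2 *\<^sub>R matrix_inv ((u (cis t))\<^sup>\<dagger> ** u (cis t)))"
    by (rule integral_cmul)
  finally show ?thesis using total by (simp add: K_def mform_def)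
qed

lemma kappa_eq:
  assumes n: "n \<ge> 1" shows "kappa n ** (kappa n)\<^sup>\<dagger> = matrix_inv (K n)"
proof (cases "n = 1")
  case True
  have "matrix_inv (mat 1 :: complex^'l^'l) = mat 1" by (rule matrix_inv_eqI) simp
  thus ?thesis using K_1 True by (simp add: kappa_def)
next
  case False
  show ?thesis
  proof (cases "N \<le> n")
    case True
    note S = sqrtY_props[OF N_very_large[OF True]]
    have g: "large n" using N_very_large[OF True] by (simp add: very_large_def)
    have "matrix_inv (K n) = u_sharp 0 ** (matrix_inv (Y n 0) ** u 0)"
      unfolding K_eq[OF g]
      using matrix_inv_mult[of "matrix_inv (u 0) ** Y n 0" "(matrix_inv (u 0))\<^sup>\<dagger>"]
        matrix_inv_mult[of "matrix_inv (u 0)" "Y n 0"] u0_inv Y0_inv[OF g]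
      by (simp add: invertible_inv invertible_herm invertible_mult matrix_inv_herm u_sharp_0
          matrix_inv_eqI[OF mat_inv_l])
    moreover have "matrix_inv (Y n 0) = matrix_inv (sqrtY n) ** matrix_inv (sqrtY n)"
      using matrix_inv_mult[OF S(5) S(5)] S(3) by simp
    moreover have "(matrix_inv (sqrtY n))\<^sup>\<dagger> = matrix_inv (sqrtY n)"
      using matrix_inv_herm[OF S(5)] S(4) by simp
    ultimately show ?thesis
      using True False n by (simp add: kappa_def herm_mult u_sharp_0 matrix_mul_assoc)
  next
    case F: False
    obtain M :: "complex^'l^'l" where M: "K n = M\<^sup>\<dagger> ** M" using psd_factor[OF K_psd] by blast
    have iM: "invertible M" using K_inv[OF n] invertible_mult_cancel unfolding M by blast
    have "matrix_inv M ** (matrix_inv M)\<^sup>\<dagger> = matrix_inv (K n)"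
      unfolding M by (simp add: matrix_inv_mult invertible_herm iM matrix_inv_herm)
    hence "\<exists>k :: complex^'l^'l. k ** k\<^sup>\<dagger> = matrix_inv (K n)" by blast
    from someI_ex[OF this] show ?thesis using False F n by (simp add: kappa_def)
  qed
qed

lemma kappa_inv: "invertible (kappa n)"
proof (cases "n \<ge> 1")
  case True
  thus ?thesis using kappa_eq[OF True] invertible_inv[OF K_inv[OF True]] invertible_mult_cancel by metis
next
  case False
  have "invertible (mat 1 :: complex^'l^'l)" by (auto simp: invertible_iff_r intro: exI[of _ "mat 1"])
  thus ?thesis using False by (simp add: kappa_def)
qed

lemma K_kappa: assumes n: "n \<ge> 1" shows "K n ** kappa n = matrix_inv ((kappa n)\<^sup>\<dagger>)"
proof -
  have "K n ** kappa n ** (kappa n)\<^sup>\<dagger> = mat 1"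
    by (simp add: kappa_eq[OF n] mat_inv_r[OF K_inv[OF n]] flip: matrix_mul_assoc)
  hence "(kappa n)\<^sup>\<dagger> ** (K n ** kappa n) = mat 1" by (simp add: matrix_left_right_inverse)
  thus ?thesis by (simp add: matrix_inv_eqI)
qed

text \<open>For n >= 1, \<open>A n\<close> and \<open>B n\<close> are the entries (n, n+1) and (n,
  n) of multiplication by x in the basis \<open>onp\<close>, where \<open>onp n\<close> has degree n
  - 1. \<open>A n\<close> is expressed by comparing leading coefficients.\<close>

definition A :: "nat \<Rightarrow> complex^'l^'l" where "A n = (matrix_inv (kappa (Suc n)) ** kappa n)\<^sup>\<dagger>"
definition B :: "nat \<Rightarrow> complex^'l^'l" where
  "B n = (kappa n)\<^sup>\<dagger> ** mform (P n) (\<lambda>x. x *\<^sub>R P n x) ** kappa n"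
definition onp :: "nat \<Rightarrow> real \<Rightarrow> complex^'l^'l" where "onp n x = P n x ** kappa n"

lemma A_inv: "invertible (A n)"
  unfolding A_def by (intro invertible_herm invertible_mult invertible_inv kappa_inv)

lemma B_herm: "(B n)\<^sup>\<dagger> = B n"
  unfolding B_def herm_mult mform_herm[OF P_cont cont_X[OF P_cont]] mform_scaleR
  by (simp add: matrix_mul_assoc)

lemma onp_rec: "x *\<^sub>R onp (Suc n) x = onp (Suc (Suc n)) x ** (A (Suc n))\<^sup>\<dagger> + onp (Suc n) x ** B (Suc n) + onp n x ** A n"
proof -
  have 1: "P (Suc (Suc n)) x ** kappa (Suc n) = onp (Suc (Suc n)) x ** (A (Suc n))\<^sup>\<dagger>"
    by (simp add: onp_def A_def matrix_mul_assoc cancel_right_inv[OF mat_inv_r[OF kappa_inv]])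
  have "kappa (Suc n) ** B (Suc n) = matrix_inv (K (Suc n)) ** mform (P (Suc n)) (\<lambda>x. x *\<^sub>R P (Suc n) x) ** kappa (Suc n)"
    by (simp add: B_def matrix_mul_assoc kappa_eq)
  hence 2: "P (Suc n) x ** bb (Suc n) ** kappa (Suc n) = onp (Suc n) x ** B (Suc n)"
    by (simp add: onp_def bb_def flip: matrix_mul_assoc)
  have 3: "P n x ** aa (Suc n) ** kappa (Suc n) = onp n x ** A n"
  proof (cases n)
    case 0 thus ?thesis by (simp add: onp_def)
  next
    case (Suc k)
    hence n: "n \<ge> 1" by simp
    have "A n = (kappa n)\<^sup>\<dagger> ** (K (Suc n) ** kappa (Suc n))"
      by (simp add: A_def herm_mult K_kappa matrix_inv_herm kappa_inv)
    hence "kappa n ** A n = matrix_inv (K n) ** K (Suc n) ** kappa (Suc n)"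
      by (simp add: matrix_mul_assoc kappa_eq[OF n])
    thus ?thesis by (simp add: onp_def aa_def flip: matrix_mul_assoc)
  qed
  have "x *\<^sub>R onp (Suc n) x = (x *\<^sub>R P (Suc n) x) ** kappa (Suc n)" by (simp add: onp_def mm.scaleR_left)
  also have "\<dots> = onp (Suc (Suc n)) x ** (A (Suc n))\<^sup>\<dagger> + onp (Suc n) x ** B (Suc n) + onp n x ** A n"
    unfolding xP mm.add_left 1 2 3 ..
  finally show ?thesis .
qed

lemma onp_cont: "cont (onp n)" unfolding onp_def[abs_def] by (intro cont_mult P_cont)

text \<open>The first block row of the resolvent of the Jacobi matrix, as Cauchy transforms of the
  orthonormal polynomials.\<close>

definition green :: "nat \<Rightarrow> complex \<Rightarrow> complex^'l^'l" where
  "green n E = mform (\<lambda>_. mat 1) (\<lambda>x. (1 / (of_real x - E)) *\<^sub>M onp n x)"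

lemma res_cont:
  assumes "E \<notin> \<real>" "cont F" shows "cont (\<lambda>x. (1 / (of_real x - E)) *\<^sub>M F x)"
  using assms by (intro cs.continuous_on continuous_intros) auto

lemma green_0: "green 0 E = 0" by (simp add: green_def onp_def cs.zero_right)

text \<open>Divide \<open>onp_rec\<close> by x - E and use x / (x - E) = 1 + E / (x - E). The
  summand 1 leaves the integral of \<open>onp (Suc n)\<close>, which is nonzero only for the
  constant polynomial.\<close>

lemma green_rec:
  assumes E: "E \<notin> \<real>"
  shows "green (Suc (Suc n)) E ** (A (Suc n))\<^sup>\<dagger> + green (Suc n) E ** (B (Suc n) - E *\<^sub>M mat 1) + green n E ** A n
     = (if n = 0 then mat 1 else 0)"
proof -
  note c = res_cont[OF E onp_cont]
  have c1: "cont (\<lambda>_. mat 1)" by (intro continuous_intros)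
  have "green (Suc (Suc n)) E ** (A (Suc n))\<^sup>\<dagger> + green (Suc n) E ** B (Suc n) + green n E ** A n
    = mform (\<lambda>_. mat 1) (\<lambda>x. (1 / (of_real x - E)) *\<^sub>M onp (Suc (Suc n)) x ** (A (Suc n))\<^sup>\<dagger>
       + (1 / (of_real x - E)) *\<^sub>M onp (Suc n) x ** B (Suc n) + (1 / (of_real x - E)) *\<^sub>M onp n x ** A n)"
    unfolding green_def
    by (subst mform_add, (intro c c1 cont_mult continuous_on_add)+, subst mform_add, (intro c c1 cont_mult)+)
      (simp add: mform_right c c1)
  also have "(\<lambda>x. (1 / (of_real x - E)) *\<^sub>M onp (Suc (Suc n)) x ** (A (Suc n))\<^sup>\<dagger>
       + (1 / (of_real x - E)) *\<^sub>M onp (Suc n) x ** B (Suc n) + (1 / (of_real x - E)) *\<^sub>M onp n x ** A n)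
     = (\<lambda>x. onp (Suc n) x + (1 / (of_real x - E)) *\<^sub>M onp (Suc n) x ** (E *\<^sub>M mat 1))"
  proof
    fix x
    have ne: "of_real x - E \<noteq> 0" using E by auto
    have "(1 / (of_real x - E)) *\<^sub>M onp (Suc (Suc n)) x ** (A (Suc n))\<^sup>\<dagger>
       + (1 / (of_real x - E)) *\<^sub>M onp (Suc n) x ** B (Suc n) + (1 / (of_real x - E)) *\<^sub>M onp n x ** A n
      = (1 / (of_real x - E)) *\<^sub>M (of_real x *\<^sub>M onp (Suc n) x)"
      unfolding cscale_of_real onp_rec by (simp add: cs.add_right cs_simps)
    also have "\<dots> = (1 + (1 / (of_real x - E)) * E) *\<^sub>M onp (Suc n) x"
      using ne by (simp add: field_simps)
    finally show "(1 / (of_real x - E)) *\<^sub>M onp (Suc (Suc n)) x ** (A (Suc n))\<^sup>\<dagger>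
       + (1 / (of_real x - E)) *\<^sub>M onp (Suc n) x ** B (Suc n) + (1 / (of_real x - E)) *\<^sub>M onp n x ** A n
      = onp (Suc n) x + (1 / (of_real x - E)) *\<^sub>M onp (Suc n) x ** (E *\<^sub>M mat 1)"
      by (simp add: cs.add_left cs_simps mult.commute)
  qed
  also have "mform (\<lambda>_. mat 1) \<dots> = mform (P 1) (onp (Suc n)) + green (Suc n) E ** (E *\<^sub>M mat 1)"
    unfolding green_def by (subst mform_add) (auto intro!: c c1 cont_mult onp_cont simp: mform_right c c1)
  also have "mform (P 1) (onp (Suc n)) = mform (P 1) (P (Suc n)) ** kappa (Suc n)"
    unfolding onp_def[abs_def] by (rule mform_right[OF P_cont P_cont])
  also have "\<dots> = (if n = 0 then mat 1 else 0)"
    using P_orth[of 1 "Suc n"] K_1 by (auto simp: K_def kappa_def)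
  finally show ?thesis by (simp add: mm.diff_right algebra_simps)
qed

lemma nonreal_E: "z \<notin> \<real> \<Longrightarrow> cmod z < 1 \<Longrightarrow> z + inverse z \<notin> \<real>"
proof
  assume z: "z \<notin> \<real>" "cmod z < 1" "z + inverse z \<in> \<real>"
  have i: "Im z \<noteq> 0" using z by (simp add: complex_is_Real_iff)
  have "(cmod z)\<^sup>2 < 1" using z(2) by (simp add: power_less_one_iff abs_square_less_1)
  moreover have "(cmod z)\<^sup>2 > 0" using i by auto
  ultimately have "1 - 1 / (cmod z)\<^sup>2 \<noteq> 0" by auto
  moreover have "Im (z + inverse z) = Im z * (1 - 1 / (cmod z)\<^sup>2)"
    by (simp add: cmod_power2 algebra_simps)
  ultimately show False using z(3) i by (simp add: complex_is_Real_iff)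
qed

text \<open>Take c = z in \<open>wint_opoly\<close>: at x = s + 1/s the kernel 1 / (x - E) equals s
  / ((s - z) (s - 1/z)), and 1/z lies outside the closed disk. For nonreal z the kernel is
  continuous on the real line and \<open>u z\<close> is invertible.\<close>

lemma green_eq:
  assumes n: "n \<ge> N" and z: "z \<notin> \<real>" "cmod z < 1"
  shows "green n (z + inverse z) = - (z ^ n *\<^sub>M (matrix_inv (u z) ** Y n z ** matrix_inv (sqrtY n)))"
proof -
  have g: "large n" using N_very_large[OF n] by (simp add: very_large_def)
  have n2: "n \<ge> 2" using N_ge_2 n by simp
  define E where "E = z + inverse z"
  have E: "E \<notin> \<real>" unfolding E_def by (rule nonreal_E[OF z])
  have z0: "z \<noteq> 0" using z by auto
  have zi: "cmod (inverse z) > 1" using z z0 by (simp add: norm_inverse one_less_inverse)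
  have "onp n x = opoly n x ** matrix_inv (sqrtY n)" for x
    using n n2 by (simp add: onp_def opoly_P[OF g] kappa_def matrix_mul_assoc)
  hence "green n E = mform (\<lambda>_. mat 1) (\<lambda>x. (1 / (of_real x - E)) *\<^sub>M opoly n x ** matrix_inv (sqrtY n))"
    by (simp add: green_def cs_simps)
  also have "\<dots> = wint (\<lambda>x. (1 / (of_real x - E)) *\<^sub>M opoly n x) ** matrix_inv (sqrtY n)"
    unfolding wint_mform
    by (rule mform_right) (intro continuous_intros res_cont[OF E] deg_lt_continuous[OF opoly_deg_lt[OF g]])+
  also have "wint (\<lambda>x. (1 / (of_real x - E)) *\<^sub>M opoly n x) =
      - (((z\<^sup>2 - 1) * (z ^ (n - 1) / (z - inverse z))) *\<^sub>M (matrix_inv (u z) ** Y n z))"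
  proof (rule wint_opoly[OF g, of z "- {inverse z}" "\<lambda>s. s ^ (n - 1) / (s - inverse z)"])
    show "z \<in> ball 0 1" "z \<notin> complex_of_real ` Z" using z by auto
    show "cball 0 1 \<subseteq> - {inverse z}" using zi by auto
    show "(\<lambda>s. s ^ (n - 1) / (s - inverse z)) holomorphic_on - {inverse z}"
      by (intro holomorphic_intros) auto
    show "invertible (u z)" using z by (intro u_inv) auto
    fix s :: complex and x assume s: "cmod s = 1 \<or> s \<in> of_real ` Z" "s + inverse s = of_real x"
    have s0: "s \<noteq> 0" using s(1) Z_props(2) by auto
    have "s ^ (n - 1) = s * s ^ (n - 2)"
      using n2 by (metis Suc_1 Suc_diff_Suc Suc_le_lessD One_nat_def power_Suc)
    moreover have "of_real x - E = (s - z) * (s - inverse z) / s"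
      unfolding s(2)[symmetric] E_def using s0 z0 by (simp add: field_simps)
    hence "1 / (of_real x - E) = s / ((s - z) * (s - inverse z))" by simp
    ultimately show "1 / (of_real x - E) * s ^ (n - 2) = s ^ (n - 1) / (s - inverse z) / (s - z)"
      by (simp add: mult.commute)
  qed auto
  also have "(z\<^sup>2 - 1) * (z ^ (n - 1) / (z - inverse z)) = z ^ n"
  proof -
    have "z - inverse z \<noteq> 0"
    proof
      assume "z - inverse z = 0"
      hence "cmod z = cmod (inverse z)" by simp
      thus False using z zi by linarith
    qed
    moreover have "z\<^sup>2 - 1 = z * (z - inverse z)" using z0 by (simp add: field_simps power2_eq_square)
    moreover have "z ^ n = z * z ^ (n - 1)" using n2 by (metis Suc_diff_1 less_le_trans pos2 power_Suc)
    ultimately show ?thesis by simp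
  qed
  finally show ?thesis by (simp add: E_def mm.minus_left cs_simps)
qed

end

section \<open>The Jost solution\<close>

text \<open>Clearing denominators gives a polynomial that vanishes on a punctured disk, hence
  everywhere. At 1/a every summand except that of a contains a zero factor.\<close>

lemma partial_fractions_indep:
  fixes c :: "real \<Rightarrow> complex"
  assumes Z: "finite Z" "0 \<notin> Z" "\<And>a. a \<in> Z \<Longrightarrow> \<bar>a\<bar> < 1"
    and eq: "\<And>z. 0 < cmod z \<Longrightarrow> cmod z < 1 \<Longrightarrow> (\<Sum>b\<in>Z. c b / (1 - z * of_real b)) = 0"
    and a: "a \<in> Z"
  shows "c a = 0"
proof -
  define p where "p = (\<Sum>b\<in>Z. smult (c b) (\<Prod>e\<in>Z - {b}. [:1, - of_real e:]))"
  have p: "poly p z = (\<Sum>b\<in>Z. c b * (\<Prod>e\<in>Z - {b}. 1 - z * of_real e))" for z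
    by (simp add: p_def poly_sum poly_prod)
  have zero: "poly p z = 0" if z: "0 < cmod z" "cmod z < 1" for z
  proof -
    have nz: "1 - z * of_real b \<noteq> 0" if "b \<in> Z" for b
    proof
      assume "1 - z * of_real b = 0"
      hence "cmod z * \<bar>b\<bar> = 1" by (metis norm_mult norm_of_real norm_one eq_iff_diff_eq_0)
      moreover have "cmod z * \<bar>b\<bar> < 1 * 1" using z Z(3)[OF that] by (intro mult_strict_mono) auto
      ultimately show False by simp
    qed
    have "poly p z = (\<Sum>b\<in>Z. (\<Prod>e\<in>Z. 1 - z * of_real e) * (c b / (1 - z * of_real b)))"
      unfolding p using Z(1) nz by (intro sum.cong refl) (simp add: prod.remove)
    also have "\<dots> = 0" unfolding sum_distrib_left[symmetric] eq[OF z] by simp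
    finally show ?thesis .
  qed
  have "infinite (ball (0::complex) 1 - {0})"
    by (intro uncountable_infinite uncountable_minus_countable uncountable_ball) auto
  moreover have "ball (0::complex) 1 - {0} \<subseteq> {z. poly p z = 0}" using zero by auto
  ultimately have "p = 0" using poly_roots_finite[of p] finite_subset by blast
  hence "0 = poly p (1 / of_real a)" by simp
  also have "\<dots> = (\<Sum>b\<in>Z. if b = a then c a * (\<Prod>e\<in>Z - {a}. 1 - of_real e / of_real a) else 0)"
    unfolding p
  proof (intro sum.cong refl)
    fix b assume b: "b \<in> Z"
    have "(\<Prod>e\<in>Z - {b}. 1 - 1 / of_real a * of_real e) = (0::complex)" if "b \<noteq> a"
      using Z a that by (intro prod_zero) (auto intro!: bexI[of _ a])
    thus "c b * (\<Prod>e\<in>Z - {b}. 1 - 1 / of_real a * of_real e) =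
      (if b = a then c a * (\<Prod>e\<in>Z - {a}. 1 - of_real e / of_real a) else 0)" by auto
  qed
  also have "\<dots> = c a * (\<Prod>e\<in>Z - {a}. 1 - of_real e / of_real a)" using Z a by simp
  finally have "c a = 0 \<or> (\<Prod>e\<in>Z - {a}. 1 - complex_of_real e / of_real a) = 0" by auto
  moreover have "(\<Prod>e\<in>Z - {a}. 1 - complex_of_real e / of_real a) \<noteq> 0"
    using Z a by (auto simp: field_simps)
  ultimately show ?thesis by blast
qed

lemma norm_diff_mult: "norm (E - y ** M) \<le> norm E + norm y * norm (M :: complex^'l^'m)"
  using norm_triangle_ineq4[of E "y ** M"] norm_matrix_mult[of y M] by linarith

context jost_data
begin

definition sqrtY_inv :: "nat \<Rightarrow> complex^'l^'l" where "sqrtY_inv n = matrix_inv (sqrtY n)"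

lemma sqrtY_inv: "n \<ge> N \<Longrightarrow> sqrtY_inv n ** sqrtY n = mat 1" "n \<ge> N \<Longrightarrow> sqrtY n ** sqrtY_inv n = mat 1" "n \<ge> N \<Longrightarrow> (sqrtY_inv n)\<^sup>\<dagger> = sqrtY_inv n"
  using sqrtY_props[OF N_very_large] matrix_inv_herm[of "sqrtY n"] by (auto simp: sqrtY_inv_def mat_inv_l mat_inv_r)

text \<open>The factor \<open>u_sharp 0\<close> is the same in \<open>kappa n\<close> and
  \<open>kappa (Suc n)\<close> and cancels.\<close>

lemma A_very_large: assumes n: "n \<ge> N" shows "A n = sqrtY_inv n ** sqrtY (Suc n)"
proof -
  have n2: "n \<ge> 2" using N_ge_2 n by simp
  have "matrix_inv (u_sharp 0 ** sqrtY_inv (Suc n)) = sqrtY (Suc n) ** matrix_inv (u_sharp 0)"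
    using n by (intro matrix_inv_eqI)
      (simp add: matrix_mul_assoc cancel_right_inv sqrtY_inv mat_inv_r u0_inv)
  hence "matrix_inv (kappa (Suc n)) ** kappa n = sqrtY (Suc n) ** (matrix_inv (u_sharp 0) ** u_sharp 0) ** sqrtY_inv n"
    using n n2 by (simp add: kappa_def matrix_mul_assoc sqrtY_inv_def)
  thus ?thesis using n sqrtY_props(4)[OF N_very_large, of "Suc n"]
    by (simp add: A_def mat_inv_l u0_inv herm_mult sqrtY_inv(3))
qed

definition Ue :: "nat \<Rightarrow> complex \<Rightarrow> complex^'l^'l" where
  "Ue n z = z ^ n *\<^sub>M (Y n z ** sqrtY_inv n)"

text \<open>\<open>V k\<close> is the Jost solution at index \<open>N + 1 - k\<close>, obtained by running the recurrence backwards.\<close>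

fun V :: "nat \<Rightarrow> complex \<Rightarrow> complex^'l^'l" where
  "V 0 z = Ue (Suc N) z"
| "V (Suc 0) z = Ue N z"
| "V (Suc (Suc k)) z = - ((V k z ** (A (N - k))\<^sup>\<dagger> + V (Suc k) z ** (B (N - k) - (z + inverse z) *\<^sub>M mat 1))
     ** matrix_inv ((A(0 := mat 1)) (N - k - 1)))"

definition U :: "nat \<Rightarrow> complex \<Rightarrow> complex^'l^'l" where
  "U n z = (if N \<le> n then Ue n z else V (Suc N - n) z)"

lemma Ue_eq:
  assumes n: "n \<ge> N" and z: "z \<notin> \<real>" "cmod z < 1"
  shows "Ue n z = - (u z ** green n (z + inverse z))"
proof -
  have "invertible (u z)" using z by (intro u_inv) auto
  thus ?thesis unfolding green_eq[OF assms] Ue_def sqrtY_inv_def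
    by (simp add: mm.minus_right cs_simps matrix_mul_assoc mat_inv_r)
qed

text \<open>Multiplication of \<open>green_rec\<close> by - \<open>u z\<close> turns its
  inhomogeneity at n = 0 into the value \<open>u z\<close> at index 0. This is why the backward
  recurrence ends in the prescribed Jost function.\<close>

lemma V_step:
  assumes z: "z \<notin> \<real>" "cmod z < 1" and n: "N - k = Suc n"
    and IH: "V k z = - (u z ** green (Suc (Suc n)) (z + inverse z))" "V (Suc k) z = - (u z ** green (Suc n) (z + inverse z))"
  shows "V (Suc (Suc k)) z ** (A(0 := mat 1)) n = (if n = 0 then u z else - (u z ** green n (z + inverse z) ** A n))"
proof -
  define A' where "A' = (A(0 := mat 1)) n"
  define M where "M = V k z ** (A (Suc n))\<^sup>\<dagger> + V (Suc k) z ** (B (Suc n) - (z + inverse z) *\<^sub>M mat 1)"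
  have inv: "invertible A'"
    using A_inv[of n] by (auto simp: A'_def invertible_iff_r intro: exI[of _ "mat 1"])
  have "V (Suc (Suc k)) z = - (M ** matrix_inv A')"
    unfolding V.simps n diff_Suc_1 A'_def M_def ..
  hence "V (Suc (Suc k)) z ** A' = - M"
    by (simp add: mm.minus_left cancel_right_inv[OF mat_inv_l[OF inv]])
  also have "- M = u z ** (green (Suc (Suc n)) (z + inverse z) ** (A (Suc n))\<^sup>\<dagger>
        + green (Suc n) (z + inverse z) ** (B (Suc n) - (z + inverse z) *\<^sub>M mat 1))"
    unfolding M_def IH by (simp add: mm.minus_left mm.add_right matrix_mul_assoc)
  also have "green (Suc (Suc n)) (z + inverse z) ** (A (Suc n))\<^sup>\<dagger>
        + green (Suc n) (z + inverse z) ** (B (Suc n) - (z + inverse z) *\<^sub>M mat 1)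
      = (if n = 0 then mat 1 else 0) - green n (z + inverse z) ** A n"
    using green_rec[OF nonreal_E[OF z], of n] by (simp add: algebra_simps)
  finally show ?thesis unfolding A'_def by (auto simp: mm.diff_right green_0 mm.zero_left matrix_mul_assoc)
qed

lemma V_eq:
  assumes z: "z \<notin> \<real>" "cmod z < 1"
  shows "k \<le> N \<Longrightarrow> V k z = - (u z ** green (Suc N - k) (z + inverse z))"
proof (induction k rule: induct_nat_012)
  case 0 thus ?case using z by (simp add: Ue_eq)
next
  case 1 thus ?case using z by (simp add: Ue_eq)
next
  case (ge2 k)
  define n where "n = N - k - 1"
  have n: "N - k = Suc n" "Suc N - k = Suc (Suc n)" "Suc N - Suc k = Suc n" "Suc N - Suc (Suc k) = n" "n \<noteq> 0"
    using ge2.prems by (auto simp: n_def)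
  have "V (Suc (Suc k)) z ** A n = - (u z ** green n (z + inverse z)) ** A n"
    using V_step[OF z n(1)] ge2 n by (simp add: mm.minus_left)
  hence "V (Suc (Suc k)) z ** A n ** matrix_inv (A n) = - (u z ** green n (z + inverse z)) ** A n ** matrix_inv (A n)"
    by simp
  thus ?case unfolding cancel_right_inv[OF mat_inv_r[OF A_inv]] n .
qed

lemma U_nonreal:
  assumes z: "z \<notin> \<real>" "cmod z < 1"
  shows "n \<ge> 1 \<Longrightarrow> U n z = - (u z ** green n (z + inverse z))" "U 0 z = u z"
proof -
  show "n \<ge> 1 \<Longrightarrow> U n z = - (u z ** green n (z + inverse z))"
    using Ue_eq[OF _ z, of n] V_eq[OF z, of "Suc N - n"] by (auto simp: U_def)
  obtain k where k: "N = Suc k" using N_ge_2 by (cases N) auto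
  have "V (Suc (Suc k)) z ** (A(0 := mat 1)) 0 = (if (0::nat) = 0 then u z else - (u z ** green 0 (z + inverse z) ** A 0))"
    by (rule V_step[OF z]) (use V_eq[OF z, of k] V_eq[OF z, of "Suc k"] k in \<open>auto simp: numeral_2_eq_2\<close>)
  thus "U 0 z = u z" using k by (simp add: U_def)
qed

lemma isCont_matI:
  "(\<And>i j. isCont (\<lambda>x. f x $ i $ j) a) \<Longrightarrow> isCont (f :: complex \<Rightarrow> complex^'l^'l) a"
  unfolding isCont_def by (intro tendsto_matI)

lemma isCont_Y: "cmod z < 1 \<Longrightarrow> isCont (Y n) z"
proof (rule isCont_matI)
  fix i j assume "cmod z < 1"
  hence "z \<in> SY" using SY_cball by auto
  thus "isCont (\<lambda>z. Y n z $ i $ j) z"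
    using holomorphic_on_imp_continuous_on[OF Y_holo] SY_open by (simp add: continuous_on_eq_continuous_at)
qed

lemma isCont_Ue: "cmod z < 1 \<Longrightarrow> isCont (Ue n) z"
  unfolding Ue_def[abs_def] by (intro mm.isCont cs.isCont isCont_Y continuous_intros)

lemma isCont_V: "z \<noteq> 0 \<Longrightarrow> cmod z < 1 \<Longrightarrow> isCont (V k) z"
proof (induction k rule: induct_nat_012)
  case (ge2 k)
  thus ?case
    unfolding V.simps(3)[abs_def]
    by (intro continuous_minus mm.isCont cs.isCont continuous_add continuous_diff continuous_const
       continuous_ident continuous_at_within_inverse) auto
qed (simp_all add: V.simps(1,2)[abs_def] isCont_Ue)

lemma isCont_U: "z \<noteq> 0 \<Longrightarrow> cmod z < 1 \<Longrightarrow> isCont (U n) z"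
  unfolding U_def[abs_def] by (cases "N \<le> n") (simp_all add: isCont_Ue isCont_V)

text \<open>A real point is the limit of points moved slightly upwards. The formulas through
  \<open>green\<close> hold off the real axis, while the Jost solution itself is continuous on the
  punctured disk.\<close>

lemma eq_by_nonreal:
  assumes f: "isCont f z" and g: "isCont g z" and z: "cmod z < 1"
    and eq: "\<And>s. s \<notin> \<real> \<Longrightarrow> cmod s < 1 \<Longrightarrow> f s = (g s :: complex^'l^'l)"
  shows "f z = g z"
proof (cases "z \<in> \<real>")
  case False thus ?thesis using eq z by blast
next
  case True
  define s where "s = (\<lambda>n. z + \<i> * of_real (inverse (real (Suc n))))"
  have "(\<lambda>n. z + \<i> * of_real (inverse (real (Suc n)))) \<longlonglongrightarrow> z + \<i> * of_real 0"
    by (intro tendsto_intros LIMSEQ_inverse_real_of_nat)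
  hence lim: "s \<longlonglongrightarrow> z" by (simp add: s_def)
  have ev: "\<forall>\<^sub>F n in sequentially. f (s n) = g (s n)"
  proof -
    have "\<forall>\<^sub>F n in sequentially. cmod (s n) < 1"
      using tendsto_norm[OF lim] z by (rule order_tendstoD)
    moreover have "s n \<notin> \<real>" for n
      using True by (simp add: s_def complex_is_Real_iff)
    ultimately show ?thesis using eq by (auto elim: eventually_mono)
  qed
  have "(\<lambda>n. f (s n)) \<longlonglongrightarrow> f z" "(\<lambda>n. g (s n)) \<longlonglongrightarrow> g z"
    using isCont_tendsto_compose[OF f lim] isCont_tendsto_compose[OF g lim] .
  moreover have "(\<lambda>n. g (s n)) \<longlonglongrightarrow> f z" using \<open>(\<lambda>n. f (s n)) \<longlonglongrightarrow> f z\<close> ev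
    by (rule Lim_transform_eventually)
  ultimately show ?thesis using LIMSEQ_unique by blast
qed

lemma U_0: "z \<noteq> 0 \<Longrightarrow> cmod z < 1 \<Longrightarrow> U 0 z = u z"
  by (rule eq_by_nonreal[OF isCont_U]) (use tendsto_u in \<open>auto simp: U_nonreal isCont_def\<close>)

lemma U_rec:
  assumes z: "z \<noteq> 0" "cmod z < 1"
  shows "U (Suc (Suc n)) z ** (A (Suc n))\<^sup>\<dagger> + U (Suc n) z ** (B (Suc n) - (z + inverse z) *\<^sub>M mat 1)
     + U n z ** (A(0 := mat 1)) n = 0"
proof (rule eq_by_nonreal[where f = "\<lambda>z. U (Suc (Suc n)) z ** (A (Suc n))\<^sup>\<dagger> + U (Suc n) z ** (B (Suc n) - (z + inverse z) *\<^sub>M mat 1)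
     + U n z ** (A(0 := mat 1)) n" and g = "\<lambda>_. 0"])
  show "isCont (\<lambda>z. U (Suc (Suc n)) z ** (A (Suc n))\<^sup>\<dagger> + U (Suc n) z ** (B (Suc n) - (z + inverse z) *\<^sub>M mat 1)
     + U n z ** (A(0 := mat 1)) n) z"
    using z by (intro mm.isCont cs.isCont isCont_U continuous_add continuous_diff continuous_const
       continuous_ident continuous_at_within_inverse)
  fix s :: complex assume s: "s \<notin> \<real>" "cmod s < 1"
  have "U (Suc (Suc n)) s ** (A (Suc n))\<^sup>\<dagger> + U (Suc n) s ** (B (Suc n) - (s + inverse s) *\<^sub>M mat 1) + U n s ** (A(0 := mat 1)) n
    = - (u s ** (green (Suc (Suc n)) (s + inverse s) ** (A (Suc n))\<^sup>\<dagger> + green (Suc n) (s + inverse s) ** (B (Suc n) - (s + inverse s) *\<^sub>M mat 1)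
        + green n (s + inverse s) ** A n)) + (if n = 0 then u s else 0)"
    using U_nonreal(1)[OF s, of "Suc n"] U_nonreal(1)[OF s, of "Suc (Suc n)"] U_nonreal(1)[OF s, of n] U_nonreal(2)[OF s]
    by (cases n) (simp_all add: green_0 mm.minus_left mm.add_right mm.zero_left matrix_mul_assoc)
  thus "U (Suc (Suc n)) s ** (A (Suc n))\<^sup>\<dagger> + U (Suc n) s ** (B (Suc n) - (s + inverse s) *\<^sub>M mat 1) + U n s ** (A(0 := mat 1)) n = 0"
    unfolding green_rec[OF nonreal_E[OF s]] by (auto simp: mm.zero_right)
qed (use z in auto)

section \<open>Decay of the Jacobi parameters\<close>

lemma sqrtY_inv_bounded: "Bseq sqrtY_inv"
proof (rule BfunI[where K = "2 * norm (mat 1 :: complex^'l^'l)"])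
  show "\<forall>\<^sub>F n in sequentially. norm (sqrtY_inv n) \<le> 2 * norm (mat 1 :: complex^'l^'l)"
  proof (rule eventually_sequentiallyI[of N])
    fix n assume n: "n \<ge> N"
    have "sqrtY_inv n + sqrtY_inv n ** sqrt_dev n = mat 1" using sqrtY_inv(1)[OF n] by (simp add: sqrtY_def mm.add_right)
    hence e: "mat 1 - sqrtY_inv n ** sqrt_dev n = sqrtY_inv n" by (simp add: algebra_simps)
    have "norm (sqrtY_inv n) \<le> norm (mat 1 :: complex^'l^'l) + norm (sqrtY_inv n) * norm (sqrt_dev n)"
      using norm_diff_mult[of "mat 1" "sqrtY_inv n" "sqrt_dev n"] unfolding e .
    moreover have "norm (sqrt_dev n) \<le> 1/2"
      using sqrtY_props(2)[OF N_very_large[OF n]] N_very_large[OF n] by (simp add: very_large_def)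
    hence "norm (sqrtY_inv n) * norm (sqrt_dev n) \<le> norm (sqrtY_inv n) * (1/2)" by (intro mult_left_mono) auto
    ultimately show "norm (sqrtY_inv n) \<le> 2 * norm (mat 1 :: complex^'l^'l)" by simp
  qed
qed

lemma exp_decay_sqrtY_inv: "exp_decay (\<lambda>n. sqrtY_inv n - mat 1)"
proof (rule exp_decay_cong)
  show "exp_decay (\<lambda>n. - (sqrtY_inv n ** sqrt_dev n))"
    by (intro exp_decay_minus exp_decay_mult_bounded exp_decay_sqrt_dev sqrtY_inv_bounded)
  show "\<forall>\<^sub>F n in sequentially. sqrtY_inv n - mat 1 = - (sqrtY_inv n ** sqrt_dev n)"
  proof (rule eventually_sequentiallyI[of N])
    fix n assume n: "n \<ge> N"
    have "sqrtY_inv n + sqrtY_inv n ** sqrt_dev n = mat 1" using sqrtY_inv(1)[OF n] by (simp add: sqrtY_def mm.add_right)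
    thus "sqrtY_inv n - mat 1 = - (sqrtY_inv n ** sqrt_dev n)" by (simp add: algebra_simps eq_neg_iff_add_eq_0)
  qed
qed

lemma exp_decay_Bseq: "exp_decay (\<lambda>n. f n - c) \<Longrightarrow> Bseq f"
proof -
  assume "exp_decay (\<lambda>n. f n - c)"
  hence "(\<lambda>n. f n - c) \<longlonglongrightarrow> 0" by (rule exp_decay_tendsto)
  hence "f \<longlonglongrightarrow> c" by (simp add: LIM_zero_iff)
  thus ?thesis by (intro convergent_imp_Bseq) (auto simp: convergent_def)
qed

lemma exp_decay_A: "exp_decay (\<lambda>n. A n - mat 1)"
proof (rule exp_decay_cong)
  show "exp_decay (\<lambda>n. sqrtY_inv n ** (sqrt_dev (Suc n) - sqrt_dev n))"
    by (intro exp_decay_mult_bounded exp_decay_diff exp_decay_Suc exp_decay_sqrt_dev sqrtY_inv_bounded)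
  show "\<forall>\<^sub>F n in sequentially. A n - mat 1 = sqrtY_inv n ** (sqrt_dev (Suc n) - sqrt_dev n)"
  proof (rule eventually_sequentiallyI[of N])
    fix n assume n: "n \<ge> N"
    have "A n - mat 1 = sqrtY_inv n ** sqrtY (Suc n) - sqrtY_inv n ** sqrtY n" using n by (simp add: A_very_large sqrtY_inv(1))
    thus "A n - mat 1 = sqrtY_inv n ** (sqrt_dev (Suc n) - sqrt_dev n)" by (simp add: sqrtY_def flip: mm.diff_right)
  qed
qed

lemma exp_decay_herm: "exp_decay f \<Longrightarrow> exp_decay (\<lambda>n. (f n :: complex^'l^'l)\<^sup>\<dagger>)"
  by (erule exp_decay_le[where c = 1]) auto

lemma exp_decay_1_AA: "exp_decay (\<lambda>n. mat 1 - A n ** (A n)\<^sup>\<dagger>)"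
proof -
  have b: "Bseq (\<lambda>n. (A n)\<^sup>\<dagger>)"
    using exp_decay_herm[OF exp_decay_A] by (intro exp_decay_Bseq[of _ "mat 1"]) (simp add: herm_diff)
  have "exp_decay (\<lambda>n. - ((A n - mat 1) ** (A n)\<^sup>\<dagger> + (A n - mat 1)\<^sup>\<dagger>))"
    by (intro exp_decay_minus exp_decay_add exp_decay_mult_bounded exp_decay_herm exp_decay_A b)
  moreover have "mat 1 - M ** M\<^sup>\<dagger> = - ((M - mat 1) ** M\<^sup>\<dagger> + (M - mat 1)\<^sup>\<dagger>)" for M :: "complex^'l^'l"
    by (simp add: mm.diff_left herm_diff)
  ultimately show ?thesis by simp
qed

lemma U_very_large: "n \<ge> N \<Longrightarrow> U n z = z ^ n *\<^sub>M (Y n z ** sqrtY_inv n)"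
  by (simp add: U_def Ue_def)

lemma exp_decay_YiS: "exp_decay (\<lambda>n. Y n z ** sqrtY_inv n - mat 1)"
proof -
  have "exp_decay (\<lambda>n. (Y n z - mat 1) ** sqrtY_inv n + (sqrtY_inv n - mat 1))"
    by (intro exp_decay_add exp_decay_mult_bounded exp_decay_Y exp_decay_sqrtY_inv sqrtY_inv_bounded)
  thus ?thesis by (simp add: mm.diff_left)
qed

lemma Y_rec:
  assumes n: "n \<ge> N" and z: "z \<noteq> 0" "cmod z < 1"
  shows "z *\<^sub>M (Y (Suc (Suc n)) z ** sqrtY_inv (Suc (Suc n)) ** (A (Suc n))\<^sup>\<dagger>)
     + Y (Suc n) z ** sqrtY_inv (Suc n) ** (B (Suc n) - (z + inverse z) *\<^sub>M mat 1)
     + inverse z *\<^sub>M (Y n z ** sqrtY_inv n ** A n) = 0" (is "?L = 0")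
proof -
  have "n \<noteq> 0" using n N_ge_2 by auto
  hence "0 = z ^ Suc (Suc n) *\<^sub>M (Y (Suc (Suc n)) z ** sqrtY_inv (Suc (Suc n)) ** (A (Suc n))\<^sup>\<dagger>)
     + z ^ Suc n *\<^sub>M (Y (Suc n) z ** sqrtY_inv (Suc n) ** (B (Suc n) - (z + inverse z) *\<^sub>M mat 1))
     + z ^ n *\<^sub>M (Y n z ** sqrtY_inv n ** A n)"
    using U_rec[OF z, of n] n by (simp add: U_very_large cs_simps)
  also have "\<dots> = z ^ Suc n *\<^sub>M ?L"
    using z by (simp add: cs.add_right mult_ac) (simp add: mult.assoc[symmetric])
  finally show ?thesis using z by simp
qed

lemma B_small:
  fixes M :: "complex^'l^'l"
  assumes "(mat 1 + y) ** M = e" "norm y \<le> 1/2" shows "norm M \<le> 2 * norm e"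
proof -
  have M: "e - y ** M = M" using assms(1) by (simp add: mm.add_left algebra_simps)
  have "norm M \<le> norm e + norm y * norm M"
    using norm_diff_mult[of e y M] unfolding M .
  also have "norm y * norm M \<le> 1/2 * norm M" using assms(2) by (intro mult_right_mono) auto
  finally show ?thesis by simp
qed

text \<open>At one fixed point z the recurrence can be solved for \<open>B\<close>: the constant
  terms cancel since z - (z + 1/z) + 1/z = 0, and every other term contains a decaying factor. The
  value 1/2 is an arbitrary choice in the punctured disk.\<close>

lemma exp_decay_B: "exp_decay B"
proof -
  define z where "z = complex_of_real (1/2)"
  have z: "z \<noteq> 0" "cmod z < 1" by (simp_all add: z_def norm_divide)
  define y where "y n = Y n z ** sqrtY_inv n - mat 1" for n
  have y: "exp_decay y" unfolding y_def by (rule exp_decay_YiS)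
  define e where "e n = (z + inverse z) *\<^sub>M y (Suc n)
     - z *\<^sub>M (y (Suc (Suc n)) ** (A (Suc n))\<^sup>\<dagger> + (A (Suc n) - mat 1)\<^sup>\<dagger>)
     - inverse z *\<^sub>M (y n ** A n + (A n - mat 1))" for n
  have bA: "Bseq A" "Bseq (\<lambda>n. (A (Suc n))\<^sup>\<dagger>)"
    using exp_decay_A exp_decay_herm[OF exp_decay_Suc[OF exp_decay_A]]
    by (auto intro!: exp_decay_Bseq[of _ "mat 1"] simp: herm_diff)
  have "exp_decay e" unfolding e_def
    by (intro exp_decay_diff exp_decay_cscale exp_decay_add exp_decay_mult_bounded exp_decay_herm exp_decay_A
        exp_decay_Suc[OF exp_decay_A] exp_decay_Suc[OF y] exp_decay_Suc[OF exp_decay_Suc[OF y]] y bA)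
  moreover have "\<forall>\<^sub>F n in sequentially. norm (B (Suc n)) \<le> 2 * norm (e n)"
  proof -
    have "\<forall>\<^sub>F n in sequentially. norm (y (Suc n)) < 1/2"
      using tendsto_norm_zero[OF exp_decay_tendsto[OF exp_decay_Suc[OF y]]] by (rule order_tendstoD) simp
    thus ?thesis using eventually_ge_at_top[of N]
    proof eventually_elim
      case (elim n)
      have Yi: "Y k z ** sqrtY_inv k = mat 1 + y k" for k by (simp add: y_def)
      have "(mat 1 + y (Suc n)) ** B (Suc n) = e n"
        using Y_rec[OF elim(2) z] unfolding Yi e_def
        by (simp add: mm.add_left mm.add_right mm.diff_right mm.diff_left cs_simps cs.add_right
          cs.add_left cs.diff_right herm_diff algebra_simps eq_neg_iff_add_eq_0)
      thus ?case using elim by (intro B_small) auto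
    qed
  qed
  ultimately have "exp_decay (\<lambda>n. B (Suc n))" by (rule exp_decay_le)
  thus ?thesis by (simp add: exp_decay_Suc_iff)
qed

lemma block_jacobi: "block_jacobi A B"
  unfolding block_jacobi_def
proof (intro conjI allI impI)
  have "Bseq A" "Bseq B" using exp_decay_A exp_decay_B by (auto intro: exp_decay_Bseq[of _ "mat 1"] exp_decay_Bseq[of _ 0])
  hence "bounded (range A)" "bounded (range B)" by (simp_all add: Bseq_eq_bounded)
  thus "bounded (A ` {1..})" "bounded (B ` {1..})" by (auto elim: bounded_subset)
qed (auto simp: A_inv B_herm)

lemma jost_function: "jost_function A B u"
  unfolding jost_function_def jost_solution_def
proof (intro exI[of _ U] conjI allI impI)
  fix z :: complex and n :: nat assume z: "0 < cmod z \<and> cmod z < 1" and n: "1 \<le> n"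
  obtain m where m: "n = Suc m" using n by (cases n) auto
  show "U (n + 1) z ** (A n)\<^sup>\<dagger> + U n z ** (B n - (z + inverse z) *\<^sub>M mat 1) + U (n - 1) z ** (A(0 := mat 1)) (n - 1) = 0"
    using U_rec[of z m] z by (simp add: m)
next
  fix z :: complex assume z: "0 < cmod z \<and> cmod z < 1"
  have "(\<lambda>n. Y n z ** sqrtY_inv n - mat 1) \<longlonglongrightarrow> 0" by (rule exp_decay_tendsto[OF exp_decay_YiS])
  hence "(\<lambda>n. Y n z ** sqrtY_inv n) \<longlonglongrightarrow> mat 1" by (simp add: LIM_zero_iff)
  moreover have "\<forall>\<^sub>F n in sequentially. Y n z ** sqrtY_inv n = inverse (z ^ n) *\<^sub>M U n z"
    using eventually_ge_at_top[of N] by eventually_elim (use z in \<open>auto simp: U_very_large\<close>)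
  ultimately show "(\<lambda>n. inverse (z ^ n) *\<^sub>M U n z) \<longlonglongrightarrow> mat 1" by (rule Lim_transform_eventually)
qed (auto simp: U_0)

lemma exp_converging: "exp_converging A B"
  unfolding exp_converging_def
  by (intro exp_decay_limsup_root exp_decay_add exp_decay_norm exp_decay_B exp_decay_1_AA) auto

section \<open>Canonical weights and eventually free parameters\<close>

lemma T_zero_iff: assumes a: "a \<in> Z" shows "T a = 0 \<longleftrightarrow> Q a = 0"
proof
  assume "T a = 0" thus "Q a = 0" using w_D_T[OF a] Z_props[OF a] by (simp add: mm.zero_right)
next
  assume "Q a = 0"
  hence wG: "w a ** G a = 0" using Q_G[OF a] by simp
  \<comment> \<open>The chosen \<open>G a\<close> need not vanish together with \<open>Q a\<close>.
    But \<open>R a\<close> also factors through \<open>w a\<close>, so only the product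
    \<open>w a ** G a\<close> matters.\<close>
  obtain H where "R a = w a ** H" using w_range[OF a u_R(1)[OF a]] by blast
  hence "(R a)\<^sup>\<dagger> ** G a = H\<^sup>\<dagger> ** (w a ** G a)" by (simp add: herm_mult w_props[OF a] matrix_mul_assoc)
  thus "T a = 0" by (simp add: T_def wG mm.zero_right)
qed

lemma free_if_canonical:
  assumes "\<And>a. a \<in> Z \<Longrightarrow> Q a = 0" and n: "n \<ge> Suc N"
  shows "A n = mat 1" "B n = 0"
proof -
  have "X n a = 0" if "n \<ge> N" "a \<in> Z" for n a
    using N_very_large[OF that(1)] that(2) assms(1) T_zero_iff[OF that(2)] by (simp add: very_large_def large_def mm.zero_left)
  hence Y1: "Y n z = mat 1" if "n \<ge> N" for n z using that by (simp add: Y_def cs.zero_right)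
  have "sqrt_dev n = 0" if "n \<ge> N" for n
    using sqrtY_props(2)[OF N_very_large[OF that]] Y1[OF that] by (simp add: Y_dev_def)
  hence S1: "sqrtY n = mat 1" if "n \<ge> N" for n using that by (simp add: sqrtY_def)
  have i1: "sqrtY_inv n = mat 1" if "n \<ge> N" for n using sqrtY_inv(1)[OF that] S1[OF that] by simp
  have A1: "A n = mat 1" if "n \<ge> N" for n using that by (simp add: A_very_large i1 S1)
  show "A n = mat 1" using A1 n by simp
  obtain m where m: "n = Suc m" "m \<ge> N" using n by (cases n) auto
  \<comment> \<open>The recurrence at z = 1/2, where z + 1/z = 5/2 and every factor other than
    \<open>B n\<close> is the identity.\<close>
  have "(1 / 2) *\<^sub>M mat 1 + (B n - (5 / 2) *\<^sub>M mat 1) + 2 *\<^sub>M mat 1 = B n"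
    by (rule mat_eqI) (simp add: field_simps)
  moreover have "(1 / 2) *\<^sub>M mat 1 + (B n - (5 / 2) *\<^sub>M mat 1) + 2 *\<^sub>M mat 1 = 0"
    using Y_rec[OF m(2), of "1/2"] m(2) by (simp add: m(1) Y1 i1 A1 norm_divide)
  ultimately show "B n = 0" by simp
qed

text \<open>If \<open>A n\<close> is unitary, the square roots give
  \<open>Y (Suc n) 0 = Y n 0\<close>, so \<open>Y n 0\<close> is constant and equals its limit 1;
  hence \<open>A n\<close> itself is 1. Then the recurrence is free, and the differences of
  successive \<open>Y n z\<close> satisfy \<open>\<delta> n = z^2 \<delta> (Suc n)\<close>: they
  cannot shrink with n, yet they tend to 0, so they vanish. Thus \<open>Y n\<close> is 1, its
  partial fraction coefficients are 0, and evaluation at a yields \<open>T a = 0\<close>.\<close>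

lemma canonical_if_free:
  assumes free: "\<And>n. n \<ge> M \<Longrightarrow> mat 1 - A n ** (A n)\<^sup>\<dagger> = 0 \<and> B n = 0" and a: "a \<in> Z"
  shows "Q a = 0"
proof -
  define M' where "M' = max M N"
  have "Y (Suc n) 0 = Y n 0" if n: "n \<ge> M'" for n
  proof -
    have nN: "n \<ge> N" using n by (simp add: M'_def)
    have "sqrtY_inv n ** sqrtY (Suc n) ** (sqrtY (Suc n) ** sqrtY_inv n) = mat 1"
      using free[of n] n nN sqrtY_props(4)[OF N_very_large, of "Suc n"]
      by (simp add: A_very_large herm_mult sqrtY_inv(3) M'_def)
    hence "sqrtY n ** (sqrtY_inv n ** sqrtY (Suc n) ** (sqrtY (Suc n) ** sqrtY_inv n)) ** sqrtY n = sqrtY n ** sqrtY n" by simp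
    hence "(sqrtY n ** sqrtY_inv n) ** (sqrtY (Suc n) ** sqrtY (Suc n)) ** (sqrtY_inv n ** sqrtY n) = sqrtY n ** sqrtY n"
      by (simp add: matrix_mul_assoc)
    thus ?thesis
      using sqrtY_props(3)[OF N_very_large[OF nN]] sqrtY_props(3)[OF N_very_large, of "Suc n"] nN by (simp add: sqrtY_inv)
  qed
  hence const: "Y (M' + k) 0 = Y M' 0" for k by (induction k) auto
  have Y01: "Y n 0 = mat 1" if "n \<ge> M'" for n
  proof -
    have "(\<lambda>n. Y n 0) \<longlonglongrightarrow> mat 1" using exp_decay_tendsto[OF exp_decay_Y[of 0]] by (simp add: LIM_zero_iff)
    hence "(\<lambda>k. Y (M' + k) 0) \<longlonglongrightarrow> mat 1" using LIMSEQ_ignore_initial_segment[of _ _ M'] by (simp add: add.commute)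
    hence "Y M' 0 = mat 1" unfolding const using LIMSEQ_unique tendsto_const by blast
    thus ?thesis using const[of "n - M'"] that by simp
  qed
  have "sqrt_dev n = 0" if "n \<ge> M'" for n
    using sqrtY_props(2)[OF N_very_large, of n] Y01[OF that] that by (simp add: Y_dev_def M'_def)
  hence S1: "sqrtY n = mat 1" if "n \<ge> M'" for n using that by (simp add: sqrtY_def)
  have i1: "sqrtY_inv n = mat 1" if "n \<ge> M'" for n using sqrtY_inv(1)[of n] S1[OF that] that by (simp add: M'_def)
  have A1: "A n = mat 1" if "n \<ge> M'" for n using that by (simp add: A_very_large i1 S1 M'_def)
  have Y1: "Y M' z = mat 1" if z: "z \<noteq> 0" "cmod z < 1" for z
  proof -
    define \<delta> where "\<delta> n = Y (Suc n) z - Y n z" for n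
    have step: "\<delta> n = z\<^sup>2 *\<^sub>M \<delta> (Suc n)" if n: "n \<ge> M'" for n
    proof -
      have "z *\<^sub>M (z *\<^sub>M Y (Suc (Suc n)) z - (z + inverse z) *\<^sub>M Y (Suc n) z + inverse z *\<^sub>M Y n z) = z *\<^sub>M 0"
        using Y_rec[of n z] z n free[of "Suc n"]
        by (simp add: i1 A1 M'_def cs_simps mm.minus_right)
      hence "z\<^sup>2 *\<^sub>M Y (Suc (Suc n)) z - (z\<^sup>2 + 1) *\<^sub>M Y (Suc n) z + Y n z = 0"
        using z by (simp add: cs.add_right cs.diff_right power2_eq_square distrib_left cs.zero_right)
      thus ?thesis by (simp add: \<delta>_def cs.diff_right cs.add_left algebra_simps)
    qed
    have "norm (\<delta> n) \<le> norm (\<delta> (n + k))" if "n \<ge> M'" for n k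
    proof (induction k)
      case (Suc k)
      have "norm (\<delta> (n + k)) = (cmod z)\<^sup>2 * norm (\<delta> (Suc (n + k)))"
        using step[of "n + k"] that by (simp add: norm_power)
      also have "\<dots> \<le> 1 * norm (\<delta> (Suc (n + k)))"
        using z by (intro mult_right_mono) (auto simp: abs_square_le_1)
      finally show ?case using Suc by simp
    qed simp
    moreover have "(\<lambda>k. norm (\<delta> (n + k))) \<longlonglongrightarrow> 0" for n
    proof -
      have "exp_decay \<delta>" unfolding \<delta>_def using exp_decay_diff[OF exp_decay_Suc[OF exp_decay_Y] exp_decay_Y, of z z] by simp
      from LIMSEQ_ignore_initial_segment[OF tendsto_norm_zero[OF exp_decay_tendsto[OF this]], of n]
      show ?thesis by (simp add: add.commute)
    qed
    ultimately have "norm (\<delta> n) \<le> 0" if "n \<ge> M'" for n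
      using that by (intro LIMSEQ_le_const[of "\<lambda>k. norm (\<delta> (n + k))"]) auto
    hence "Y (Suc n) z = Y n z" if "n \<ge> M'" for n using that by (simp add: \<delta>_def)
    hence const: "Y (M' + k) z = Y M' z" for k by (induction k) auto
    have "(\<lambda>n. Y n z) \<longlonglongrightarrow> mat 1" using exp_decay_tendsto[OF exp_decay_Y[of z]] by (simp add: LIM_zero_iff)
    hence "(\<lambda>k. Y (M' + k) z) \<longlonglongrightarrow> mat 1" using LIMSEQ_ignore_initial_segment[of _ _ M'] by (simp add: add.commute)
    thus "Y M' z = mat 1" unfolding const using LIMSEQ_unique tendsto_const by blast
  qed
  have "X M' a = 0"
  proof (rule mat_eqI)
    fix i j
    have "X M' a $ i $ j = 0"
    proof (rule partial_fractions_indep[OF finite_Z _ _ _ a, of "\<lambda>b. X M' b $ i $ j"])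
      fix z :: complex assume z: "0 < cmod z" "cmod z < 1"
      have "(\<Sum>b\<in>Z. (1 / (1 - z * of_real b)) *\<^sub>M X M' b) = 0" using Y1[of z] z by (simp add: Y_def)
      from arg_cong[OF this, of "\<lambda>M. M $ i $ j"]
      show "(\<Sum>b\<in>Z. X M' b $ i $ j / (1 - z * of_real b)) = 0" by simp
    qed (use Z_props in auto)
    thus "X M' a $ i $ j = 0 $ i $ j" by simp
  qed
  moreover have "large M'" using N_very_large[of M'] by (simp add: very_large_def M'_def)
  ultimately have "T a ** Y M' (of_real a) = 0"
    using a Z_props[OF a] by (simp add: large_def)
  thus ?thesis using Y1[of "of_real a"] Z_props[OF a] T_zero_iff[OF a] by simp
qed

lemma free_iff_canonical:
  "(\<exists>N. \<forall>n\<ge>N. mat 1 - A n ** (A n)\<^sup>\<dagger> = 0 \<and> B n = 0) \<longleftrightarrow>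
       (\<forall>x\<in>Z. canonical u (of_real x) (w x))"
proof
  assume "\<exists>N. \<forall>n\<ge>N. mat 1 - A n ** (A n)\<^sup>\<dagger> = 0 \<and> B n = 0"
  then obtain M where "\<And>n. n \<ge> M \<Longrightarrow> mat 1 - A n ** (A n)\<^sup>\<dagger> = 0 \<and> B n = 0" by blast
  from canonical_if_free[OF this] show "\<forall>x\<in>Z. canonical u (of_real x) (w x)" by (simp add: canonical_iff)
next
  assume "\<forall>x\<in>Z. canonical u (of_real x) (w x)"
  hence "\<And>a. a \<in> Z \<Longrightarrow> Q a = 0" by (simp add: canonical_iff)
  from free_if_canonical[OF this]
  show "\<exists>N. \<forall>n\<ge>N. mat 1 - A n ** (A n)\<^sup>\<dagger> = 0 \<and> B n = 0" by (intro exI[of _ "Suc N"]) simp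
qed

end

section \<open>The spectral measure\<close>

lemma exp_decay_summable_sq:
  assumes "exp_decay (f :: nat \<Rightarrow> 'a::real_normed_vector)" shows "summable (\<lambda>n. (norm (f n))\<^sup>2)"
proof -
  obtain q C where q: "0 < q" "q < 1" "0 \<le> C" "\<forall>\<^sub>F n in sequentially. norm (f n) \<le> C * q ^ n"
    using assms by (rule expdecE)
  have "\<forall>\<^sub>F n in sequentially. norm ((norm (f n))\<^sup>2) \<le> C\<^sup>2 * (q\<^sup>2) ^ n"
    using q(4)
  proof eventually_elim
    case (elim n)
    have "(norm (f n))\<^sup>2 \<le> (C * q ^ n)\<^sup>2" using elim by (intro power_mono) auto
    thus ?case by (simp add: power_mult_distrib power_even_eq mult.commute flip: power_mult)
  qed
  moreover have "summable (\<lambda>n. C\<^sup>2 * (q\<^sup>2) ^ n)"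
    using q by (intro summable_mult summable_geometric) (simp add: abs_square_less_1)
  ultimately show ?thesis by (rule summable_comparison_test_ev)
qed

text \<open>The roots of z^2 - E z + 1 have product 1. If one had modulus 1, the other would be its
  conjugate and their sum E would be real; so one of them lies inside the disk.\<close>

lemma joukowski_preimage:
  assumes "E \<notin> \<real>" shows "\<exists>z. z \<notin> \<real> \<and> cmod z < 1 \<and> z + inverse z = E"
proof -
  define s where "s = csqrt (E\<^sup>2 - 4)"
  define z where "z = (E + s) / 2"
  have s: "s\<^sup>2 = E\<^sup>2 - 4" by (simp add: s_def)
  have zz: "z * (E - z) = 1"
  proof -
    have "z * (E - z) = (E\<^sup>2 - s\<^sup>2) / 4" by (simp add: z_def field_simps power2_eq_square)
    thus ?thesis by (simp add: s)
  qed
  hence z0: "z \<noteq> 0" by auto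
  have sum: "z + inverse z = E" using inverse_unique[OF zz] by simp
  have nr: "z \<notin> \<real>" using sum assms by (metis Reals_add Reals_inverse)
  have "cmod z \<noteq> 1"
  proof
    assume "cmod z = 1"
    hence "z * cnj z = 1" by (simp flip: complex_norm_square)
    hence "inverse z = cnj z" by (rule inverse_unique)
    thus False using sum assms by (auto simp: complex_add_cnj)
  qed
  then consider "cmod z < 1" | "cmod (inverse z) < 1" using z0 by (cases "cmod z < 1") (auto simp: norm_inverse inverse_less_1_iff)
  thus ?thesis
  proof cases
    case 1 thus ?thesis using sum nr by blast
  next
    case 2
    have "inverse z \<notin> \<real>" using nr by (metis Reals_inverse inverse_inverse_eq)
    thus ?thesis using 2 sum by (intro exI[of _ "inverse z"]) (auto simp: add.commute)
  qed
qed

text \<open>Each point mass is spread over a unit interval to the right of \<open>\<pi>\<close>, so that the spectral measure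
  is the image of a density on the line and all integrals become Lebesgue integrals.\<close>

definition glue :: "nat \<Rightarrow> (real \<Rightarrow> 'b) \<Rightarrow> (nat \<Rightarrow> 'b) \<Rightarrow> real \<Rightarrow> 'b::real_vector" where
  "glue m F c t = (if t \<in> {0..pi} then F t else if t \<in> {5..<5 + real m} then c (nat \<lfloor>t - 5\<rfloor>) else 0)"

lemma glue_sum:
  "glue m F c t = indicator {0..pi} t *\<^sub>R F t + (\<Sum>k<m. indicator {5 + real k..<6 + real k} t *\<^sub>R c k)"
proof -
  \<comment> \<open>Separates the interval of the continuous part from the intervals of the point
    masses.\<close>
  have pi5: "pi < 5" using pi_less_4 by simp
  show ?thesis
  proof (cases "t \<in> {5..<5 + real m}")
    case True
    define k where "k = nat \<lfloor>t - 5\<rfloor>"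
    have k: "k < m" "t \<in> {5 + real k..<6 + real k}" using True by (auto simp: k_def) linarith+
    have "(\<Sum>i<m. indicator {5 + real i..<6 + real i} t *\<^sub>R c i) = (\<Sum>i<m. if i = k then c k else 0)"
      using k by (intro sum.cong refl) (auto simp: indicator_def)
    thus ?thesis using True k pi5 by (auto simp: glue_def k_def)
  next
    case False
    have "(\<Sum>i<m. indicator {5 + real i..<6 + real i} t *\<^sub>R c i) = 0"
      using False by (intro sum.neutral) (auto simp: indicator_def)
    thus ?thesis using False by (auto simp: glue_def)
  qed
qed

lemma glue_integral:
  fixes F :: "real \<Rightarrow> 'b::euclidean_space"
  assumes "continuous_on {0..pi} F"
  shows "has_bochner_integral lborel (glue m F c) (integral {0..pi} F + (\<Sum>k<m. c k))"
proof -
  have si: "set_integrable lborel {0..pi} F" by (rule borel_integrable_atLeastAtMost'[OF assms])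
  have "has_bochner_integral lborel (\<lambda>t. indicator {0..pi} t *\<^sub>R F t) (integral {0..pi} F)"
    using si set_borel_integral_eq_integral(2)[OF si]
    by (simp add: has_bochner_integral_iff set_integrable_def set_lebesgue_integral_def)
  moreover have "has_bochner_integral lborel (\<lambda>t. indicator {5 + real k..<6 + real k} t *\<^sub>R c k) (1 *\<^sub>R c k)" for k
    by (intro has_bochner_integral_scaleR_left)
      (use has_bochner_integral_real_indicator[of "{5 + real k..<6 + real k}" lborel] in simp)
  ultimately have "has_bochner_integral lborel
      (\<lambda>t. indicator {0..pi} t *\<^sub>R F t + (\<Sum>k<m. indicator {5 + real k..<6 + real k} t *\<^sub>R c k))
      (integral {0..pi} F + (\<Sum>k<m. 1 *\<^sub>R c k))"
    by (intro has_bochner_integral_add has_bochner_integral_sum)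
  thus ?thesis by (simp add: glue_sum[abs_def])
qed

context jost_data
begin

text \<open>Green's identity: the imaginary part of \<open>\<langle>\<delta>, (J - E) \<delta>\<rangle>\<close> telescopes to a boundary term tending to \<open>0\<close>.\<close>

lemma jacobi_injective:
  assumes E: "E \<notin> \<real>"
  shows "inj_on (\<lambda>\<phi> n. jacobi_op A B \<phi> n - E *s \<phi> n) ell2"
proof (rule inj_onI)
  fix \<phi> \<psi> :: "nat \<Rightarrow> complex^'l"
  assume mem: "\<phi> \<in> ell2" "\<psi> \<in> ell2"
    and eq: "(\<lambda>n. jacobi_op A B \<phi> n - E *s \<phi> n) = (\<lambda>n. jacobi_op A B \<psi> n - E *s \<psi> n)"
  define \<delta> where "\<delta> n = \<phi> n - \<psi> n" for n
  have \<delta>0: "\<delta> 0 = 0" using mem by (simp add: \<delta>_def ell2_def)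
  have lin: "(A n)\<^sup>\<dagger> *v \<delta> n + B (Suc n) *v \<delta> (Suc n) + A (Suc n) *v \<delta> (Suc (Suc n)) = E *s \<delta> (Suc n)" for n
    using fun_cong[OF eq, of "Suc n"]
    by (simp add: jacobi_op_def \<delta>_def mv.diff_right algebra_simps vector_ssub_ldistrib)
  have "\<phi> \<longlonglongrightarrow> 0" "\<psi> \<longlonglongrightarrow> 0"
  proof -
    have *: "f \<longlonglongrightarrow> 0" if "f \<in> ell2" for f :: "nat \<Rightarrow> complex^'l"
    proof -
      have "(\<lambda>n. (norm (f n))\<^sup>2) \<longlonglongrightarrow> 0" using that by (intro summable_LIMSEQ_zero) (simp add: ell2_def)
      hence "(\<lambda>n. sqrt ((norm (f n))\<^sup>2)) \<longlonglongrightarrow> sqrt 0" by (intro tendsto_intros)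
      thus ?thesis by (simp add: tendsto_norm_zero_iff)
    qed
    show "\<phi> \<longlonglongrightarrow> 0" "\<psi> \<longlonglongrightarrow> 0" using * mem by auto
  qed
  hence \<delta>lim: "\<delta> \<longlonglongrightarrow> 0" unfolding \<delta>_def using tendsto_diff[of \<phi> 0 _ \<psi> 0] by simp
  define c where "c n = cinner (\<delta> n) (A n *v \<delta> (Suc n))" for n
  have step: "Im E * (norm (\<delta> (Suc n)))\<^sup>2 = Im (c (Suc n)) - Im (c n)" for n
  proof -
    have "E * of_real ((norm (\<delta> (Suc n)))\<^sup>2) = cinner (\<delta> (Suc n)) ((A n)\<^sup>\<dagger> *v \<delta> n)
        + qform (B (Suc n)) (\<delta> (Suc n)) + c (Suc n)"
      using arg_cong[OF lin[of n], of "cinner (\<delta> (Suc n))"]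
      by (simp add: cinner.add_right cinner_cscale cinner_self qform_cinner c_def)
    moreover have "cinner (\<delta> (Suc n)) ((A n)\<^sup>\<dagger> *v \<delta> n) = cnj (c n)"
      by (simp add: cinner_herm c_def cinner_commute)
    moreover have "Im (qform (B (Suc n)) (\<delta> (Suc n))) = 0"
      using herm_qform_real[OF B_herm] by (simp add: complex_is_Real_iff)
    ultimately have "Im (E * of_real ((norm (\<delta> (Suc n)))\<^sup>2)) = Im (c (Suc n)) - Im (c n)" by simp
    thus ?thesis by simp
  qed
  have c0: "c 0 = 0" by (simp add: c_def \<delta>0 cinner.zero_left)
  have sum: "Im E * (\<Sum>k<n. (norm (\<delta> (Suc k)))\<^sup>2) = Im (c n)" for n
    by (induction n) (simp_all add: c0 distrib_left step)
  have "c \<longlonglongrightarrow> 0"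
  proof -
    have A: "A \<longlonglongrightarrow> mat 1" using exp_decay_tendsto[OF exp_decay_A] by (simp add: LIM_zero_iff)
    have "c \<longlonglongrightarrow> cinner 0 ((mat 1 :: complex^'l^'l) *v 0)" unfolding c_def
      by (rule cinner.tendsto[OF \<delta>lim mv.tendsto[OF A LIMSEQ_Suc[OF \<delta>lim]]])
    thus ?thesis by (simp add: cinner.zero_left)
  qed
  hence "(\<lambda>n. \<bar>Im (c n)\<bar>) \<longlonglongrightarrow> 0" using tendsto_Im tendsto_rabs_zero by fastforce
  moreover have "\<bar>Im E\<bar> * (norm (\<delta> (Suc k)))\<^sup>2 \<le> \<bar>Im (c n)\<bar>" if "k < n" for k n
  proof -
    have "(norm (\<delta> (Suc k)))\<^sup>2 \<le> (\<Sum>k<n. (norm (\<delta> (Suc k)))\<^sup>2)"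
      using that by (intro member_le_sum[of k "{..<n}" "\<lambda>k. (norm (\<delta> (Suc k)))\<^sup>2"]) auto
    hence "\<bar>Im E\<bar> * (norm (\<delta> (Suc k)))\<^sup>2 \<le> \<bar>Im E\<bar> * (\<Sum>k<n. (norm (\<delta> (Suc k)))\<^sup>2)"
      by (intro mult_left_mono) auto
    also have "\<dots> = \<bar>Im (c n)\<bar>" unfolding sum[symmetric] by (simp add: abs_mult sum_nonneg)
    finally show ?thesis .
  qed
  ultimately have "\<bar>Im E\<bar> * (norm (\<delta> (Suc k)))\<^sup>2 \<le> 0" for k
    by (intro LIMSEQ_le_const[of "\<lambda>n. \<bar>Im (c n)\<bar>"]) (auto intro!: exI[of _ "Suc k"])
  moreover have "Im E \<noteq> 0" using E by (simp add: complex_is_Real_iff)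
  ultimately have "\<delta> (Suc k) = 0" for k by (simp add: mult_le_0_iff)
  hence "\<delta> n = 0" for n using \<delta>0 by (cases n) auto
  thus "\<phi> = \<psi>" by (simp add: \<delta>_def fun_eq_iff)
qed

section \<open>The resolvent block as a Cauchy transform\<close>

lemma exp_decay_green: assumes E: "E \<notin> \<real>" shows "exp_decay (\<lambda>n. green n E)"
proof -
  obtain z where z: "z \<notin> \<real>" "cmod z < 1" "z + inverse z = E" using joukowski_preimage[OF E] by blast
  have "Bseq (\<lambda>n. Y n z ** sqrtY_inv n)" by (rule exp_decay_Bseq[OF exp_decay_YiS])
  then obtain M where M: "\<And>n. norm (Y n z ** sqrtY_inv n) \<le> M" by (auto simp: Bseq_def)
  have "exp_decay (\<lambda>n. cmod z ^ n)" using z by (intro exp_decay_pow) auto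
  thus ?thesis
  proof (rule exp_decay_le[where c = "norm (matrix_inv (u z)) * M"], intro eventually_sequentiallyI[of N])
    fix n assume n: "n \<ge> N"
    have "norm (green n E) = cmod z ^ n * norm (matrix_inv (u z) ** (Y n z ** sqrtY_inv n))"
      using green_eq[OF n z(1,2)] by (simp add: z(3) norm_power sqrtY_inv_def matrix_mul_assoc)
    also have "\<dots> \<le> cmod z ^ n * (norm (matrix_inv (u z)) * M)"
      by (intro mult_left_mono order_trans[OF norm_matrix_mult] M) auto
    finally show "norm (green n E) \<le> norm (matrix_inv (u z)) * M * norm (cmod z ^ n)" by (simp add: mult.commute)
  qed
qed

text \<open>\<open>green_rec\<close> multiplies the parameters from the right, so taking adjoints
  turns it into the column equation and conjugates E. The resulting sequence is square summable and
  solves the equation explicitly; by injectivity it is the value of the inverse.\<close>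

lemma resolvent_block_eq:
  assumes E: "E \<notin> \<real>" shows "resolvent_block A B E = (green 1 (cnj E))\<^sup>\<dagger>"
proof (rule mat_eqI)
  fix i j
  have E': "cnj E \<notin> \<real>" using E by (metis Reals_cnj_iff complex_cnj_cnj)
  define \<psi> where "\<psi> n = (green n (cnj E))\<^sup>\<dagger> *v axis j 1" for n
  have "exp_decay \<psi>"
  proof (rule exp_decay_le[OF exp_decay_green[OF E']])
    have "norm (\<psi> n) \<le> norm (axis j 1 :: complex^'l) * norm (green n (cnj E))" for n
      using norm_mult_vec[of "(green n (cnj E))\<^sup>\<dagger>" "axis j 1"] by (simp add: \<psi>_def mult.commute)
    thus "\<forall>\<^sub>F n in sequentially. norm (\<psi> n) \<le> norm (axis j 1 :: complex^'l) * norm (green n (cnj E))"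
      by simp
  qed
  hence mem: "\<psi> \<in> ell2" by (simp add: ell2_def exp_decay_summable_sq) (simp add: \<psi>_def green_0 mv.zero_left)
  have "jacobi_op A B \<psi> n - E *s \<psi> n = (if n = 1 then axis j 1 else 0)" for n
  proof (cases n)
    case 0 thus ?thesis by (simp add: jacobi_op_def \<psi>_def green_0 mv.zero_left)
  next
    case (Suc k)
    have "A (Suc k) ** (green (Suc (Suc k)) (cnj E))\<^sup>\<dagger> + (B (Suc k) - E *\<^sub>M mat 1) ** (green (Suc k) (cnj E))\<^sup>\<dagger>
        + (A k)\<^sup>\<dagger> ** (green k (cnj E))\<^sup>\<dagger> = (if k = 0 then mat 1 else 0)"
      using arg_cong[OF green_rec[OF E', of k], of herm]
      by (auto simp: herm_add herm_mult herm_diff herm_cscale B_herm split: if_splits)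
    from arg_cong[OF this, of "\<lambda>M. M *v axis j 1"]
    have "A (Suc k) *v \<psi> (Suc (Suc k)) + (B (Suc k) *v \<psi> (Suc k) - E *s \<psi> (Suc k)) + (A k)\<^sup>\<dagger> *v \<psi> k
       = (if k = 0 then axis j 1 else 0)"
      by (auto simp: \<psi>_def mv.add_left mv.diff_left mm_vec cscale_vec mv.zero_left split: if_splits)
    thus ?thesis by (simp add: Suc jacobi_op_def algebra_simps)
  qed
  hence "resolvent A B E (\<lambda>n. if n = 1 then axis j 1 else 0) = \<psi>"
    unfolding resolvent_def using mem by (intro the_inv_into_f_eq[OF jacobi_injective[OF E]]) auto
  thus "resolvent_block A B E $ i $ j = (green 1 (cnj E))\<^sup>\<dagger> $ i $ j"
    by (simp add: resolvent_block_def \<psi>_def matrix_vector_mult_def axis_def if_distrib if_distribR cong: if_cong)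
qed

lemma resolvent_block_integral:
  assumes E: "E \<notin> \<real>"
  shows "resolvent_block A B E = integral {0..pi} (\<lambda>t. (1 / (of_real (2 * cos t) - E)) *\<^sub>M Wt t)
     + (\<Sum>a\<in>Z. (1 / (of_real (a + inverse a) - E)) *\<^sub>M w a)"
proof -
  have E': "cnj E \<notin> \<real>" using E by (metis Reals_cnj_iff complex_cnj_cnj)
  have c1: "cont (\<lambda>_. mat 1)" by (intro continuous_intros)
  have "green 1 (cnj E) = mform (\<lambda>_. mat 1) (\<lambda>x. (1 / (of_real x - cnj E)) *\<^sub>M mat 1)"
    by (simp add: green_def onp_def kappa_def)
  hence "resolvent_block A B E = mform (\<lambda>x. (1 / (of_real x - cnj E)) *\<^sub>M mat 1) (\<lambda>_. mat 1)"
    unfolding resolvent_block_eq[OF E] by (simp add: mform_herm res_cont[OF E'] c1)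
  thus ?thesis by (simp add: mform_def herm_cscale cs_simps add.commute)
qed

section \<open>The measure and its atoms\<close>

definition zero_enum :: "nat \<Rightarrow> real" where "zero_enum = (SOME e. bij_betw e {..<card Z} Z)"

lemma zero_enum: "bij_betw zero_enum {..<card Z} Z"
  unfolding zero_enum_def using someI_ex[OF ex_bij_betw_nat_finite[OF finite_Z]] by (simp add: atLeast0LessThan)

definition node :: "real \<Rightarrow> real" where
  "node = glue (card Z) (\<lambda>t. 2 * cos t) (\<lambda>k. zero_enum k + inverse (zero_enum k))"
definition dens :: "real \<Rightarrow> complex^'l^'l" where "dens = glue (card Z) Wt (\<lambda>k. w (zero_enum k))"

text \<open>Off their common support both \<open>node\<close> and \<open>dens\<close> are 0, so the
  composite vanishes there exactly if \<open>H 0 0\<close> does.\<close>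

lemma node_dens:
  assumes "H 0 0 = 0"
  shows "H (node t) (dens t) = glue (card Z) (\<lambda>t. H (2 * cos t) (Wt t)) (\<lambda>k. H (zero_enum k + inverse (zero_enum k)) (w (zero_enum k))) t"
  using assms by (simp add: node_def dens_def glue_def)

lemma node_dens_integral:
  fixes H :: "real \<Rightarrow> complex^'l^'l \<Rightarrow> 'b::euclidean_space"
  assumes "H 0 0 = 0" "continuous_on {0..pi} (\<lambda>t. H (2 * cos t) (Wt t))"
  shows "has_bochner_integral lborel (\<lambda>t. H (node t) (dens t))
    (integral {0..pi} (\<lambda>t. H (2 * cos t) (Wt t)) + (\<Sum>a\<in>Z. H (a + inverse a) (w a)))"
  unfolding node_dens[of H, OF assms(1)]
  using glue_integral[OF assms(2), of "card Z" "\<lambda>k. H (zero_enum k + inverse (zero_enum k)) (w (zero_enum k))"]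
    sum.reindex_bij_betw[OF zero_enum, of "\<lambda>a. H (a + inverse a) (w a)"] by simp

lemma dens_psd: "psd (dens t)"
proof (cases "t \<in> {5..<5 + real (card Z)}")
  case True
  hence "nat \<lfloor>t - 5\<rfloor> < card Z" by auto linarith
  hence "zero_enum (nat \<lfloor>t - 5\<rfloor>) \<in> Z" using bij_betwE[OF zero_enum] by auto
  thus ?thesis using Wt_psd w_props(1) by (simp add: dens_def glue_def)
qed (use Wt_psd in \<open>auto simp: dens_def glue_def\<close>)

lemma dens_integrable: "integrable lborel dens"
  using node_dens_integral[of "\<lambda>x M. M"] Wt_cont by (auto simp: has_bochner_integral_iff)

text \<open>Obtained as a by-product of integrability, which \<open>glue_integral\<close> already
  provides.\<close>

lemma node_measurable [measurable]: "node \<in> borel_measurable borel"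
proof -
  have "has_bochner_integral lborel node (integral {0..pi} (\<lambda>t. 2 * cos t) + (\<Sum>k<card Z. zero_enum k + inverse (zero_enum k)))"
    unfolding node_def by (intro glue_integral continuous_intros)
  thus ?thesis by (auto simp: has_bochner_integral_iff dest: borel_measurable_integrable)
qed

definition mu :: "real set \<Rightarrow> complex^'l^'l" where
  "mu S = (LINT t|lborel. indicator S (node t) *\<^sub>R dens t)"

lemma mu_integrable:
  assumes "S \<in> sets borel" shows "integrable lborel (\<lambda>t. indicator S (node t) *\<^sub>R dens t)"
proof -
  have "node -` S \<in> sets lborel" using measurable_sets[OF node_measurable assms] by simp
  from integrable_mult_indicator[OF this dens_integrable] show ?thesis
    by (simp add: indicator_def)
qed

lemma qform_dens_integrable:
  assumes "S \<in> sets borel" shows "integrable lborel (\<lambda>t. indicator S (node t) * Re (qform (dens t) v))"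
  using integrable_bounded_linear[OF bounded_linear_compose[OF bounded_linear_Re bounded_linear_qform] mu_integrable[OF assms], of v]
  by (simp add: qform_scaleR)

lemma Re_qform_mu:
  assumes "S \<in> sets borel"
  shows "Re (qform (mu S) v) = (LINT t|lborel. indicator S (node t) * Re (qform (dens t) v))"
  unfolding mu_def
  using integral_bounded_linear[OF bounded_linear_compose[OF bounded_linear_Re bounded_linear_qform] mu_integrable[OF assms], of v]
  by (simp add: qform_scaleR)

lemma mu_psd: assumes S: "S \<in> sets borel" shows "psd (mu S)"
  unfolding psd_def
proof (intro conjI allI)
  have "(dens t)\<^sup>\<dagger> = dens t" for t using dens_psd by (simp add: psd_def)
  thus "(mu S)\<^sup>\<dagger> = mu S" unfolding mu_def
    using integral_bounded_linear[OF bounded_linear_herm mu_integrable[OF S]] by (simp add: herm_scaleR)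
  fix v
  show "0 \<le> Re (qform (mu S) v)"
    unfolding Re_qform_mu[OF S] using dens_psd by (intro Bochner_Integration.integral_nonneg) (auto simp: psd_def)
qed

lemma mu_sums:
  assumes F: "range F \<subseteq> sets borel" "disjoint_family F"
  shows "(\<lambda>n. mu (F n)) sums mu (\<Union>n. F n)"
  unfolding sums_def
proof -
  have UN: "(\<Union>n. F n) \<in> sets borel" using F(1) by auto
  have part: "(\<Sum>i<n. mu (F i)) = (LINT t|lborel. indicator (\<Union>i<n. F i) (node t) *\<^sub>R dens t)" for n
  proof -
    have "(\<Sum>i<n. mu (F i)) = (LINT t|lborel. (\<Sum>i<n. indicator (F i) (node t) *\<^sub>R dens t))"
      unfolding mu_def using F(1) by (intro Bochner_Integration.integral_sum[symmetric] mu_integrable) auto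
    also have "(\<lambda>t. \<Sum>i<n. indicator (F i) (node t) *\<^sub>R dens t) = (\<lambda>t. indicator (\<Union>i<n. F i) (node t) *\<^sub>R dens t)"
    proof
      fix t
      have "disjoint_family_on F {..<n}" using F(2) by (auto simp: disjoint_family_on_def)
      from indicator_UN_disjoint[OF _ this, of "node t", where ?'c = real]
      show "(\<Sum>i<n. indicator (F i) (node t) *\<^sub>R dens t) = indicator (\<Union>i<n. F i) (node t) *\<^sub>R dens t"
        by (simp add: scaleR_sum_left)
    qed
    finally show ?thesis .
  qed
  show "(\<lambda>n. \<Sum>i<n. mu (F i)) \<longlonglongrightarrow> mu (\<Union>n. F n)"
    unfolding part mu_def[of "\<Union>n. F n"]
  proof (rule integral_dominated_convergence[where w = "\<lambda>t. norm (dens t)"])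
    show "(\<lambda>t. indicator (\<Union>n. F n) (node t) *\<^sub>R dens t) \<in> borel_measurable lborel"
      by (rule borel_measurable_integrable[OF mu_integrable[OF UN]])
    show "(\<lambda>t. indicator (\<Union>i<n. F i) (node t) *\<^sub>R dens t) \<in> borel_measurable lborel" for n
      using F(1) by (intro borel_measurable_integrable mu_integrable) auto
    show "integrable lborel (\<lambda>t. norm (dens t))" by (intro integrable_norm dens_integrable)
    show "AE t in lborel. (\<lambda>n. indicator (\<Union>i<n. F i) (node t) *\<^sub>R dens t) \<longlonglongrightarrow> indicator (\<Union>n. F n) (node t) *\<^sub>R dens t"
      by (intro AE_I2 tendsto_scaleR LIMSEQ_indicator_UN tendsto_const)
    show "AE t in lborel. norm (indicator (\<Union>i<n. F i) (node t) *\<^sub>R dens t) \<le> norm (dens t)" for n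
      by (intro AE_I2) (auto simp: indicator_def)
  qed
qed

lemma matrix_measure_mu: "matrix_measure mu"
  unfolding matrix_measure_def using mu_psd mu_sums by auto

text \<open>\<open>quad_measure\<close> is given by a set function. Written as the image of a
  density, it admits the change of variables needed for integrals.\<close>

lemma quad_measure_mu:
  "quad_measure mu v = distr (density lborel (\<lambda>t. ennreal (Re (qform (dens t) v)))) borel node"
proof -
  have Dm: "(\<lambda>t. Re (qform (dens t) v)) \<in> borel_measurable lborel"
    using borel_measurable_integrable[OF qform_dens_integrable[of UNIV v]] by simp
  have "quad_measure mu v = measure_of UNIV (sets borel)
     (\<lambda>S. emeasure (density lborel (\<lambda>t. ennreal (Re (qform (dens t) v)))) (node -` S \<inter> space (density lborel (\<lambda>t. ennreal (Re (qform (dens t) v))))))"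
    unfolding quad_measure_def
  proof (rule measure_of_eq)
    fix S :: "real set" assume "S \<in> sigma_sets UNIV (sets borel)"
    hence S: "S \<in> sets borel" using sets.sigma_sets_eq[of "borel :: real measure"] by simp
    have phS: "node -` S \<in> sets lborel" using measurable_sets[OF node_measurable S] by simp
    have "emeasure (density lborel (\<lambda>t. ennreal (Re (qform (dens t) v)))) (node -` S)
        = (\<integral>\<^sup>+ t. ennreal (Re (qform (dens t) v)) * indicator (node -` S) t \<partial>lborel)"
      using Dm phS by (intro emeasure_density) auto
    also have "\<dots> = (\<integral>\<^sup>+ t. ennreal (indicator S (node t) * Re (qform (dens t) v)) \<partial>lborel)"
      by (intro nn_integral_cong) (auto simp: indicator_def)
    also have "\<dots> = ennreal (LINT t|lborel. indicator S (node t) * Re (qform (dens t) v))"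
      using dens_psd by (intro nn_integral_eq_integral qform_dens_integrable S) (auto simp: psd_def)
    finally show "ennreal (Re (qform (mu S) v)) =
      emeasure (density lborel (\<lambda>t. ennreal (Re (qform (dens t) v)))) (node -` S \<inter> space (density lborel (\<lambda>t. ennreal (Re (qform (dens t) v)))))"
      by (simp add: Re_qform_mu[OF S])
  qed auto
  thus ?thesis by (simp add: distr_def)
qed

lemma mu_matrix_integral:
  assumes E: "E \<notin> \<real>"
  shows "has_matrix_integral mu (\<lambda>x. 1 / (of_real x - E)) (resolvent_block A B E)"
  unfolding has_matrix_integral_def
proof
  fix v
  define f where "f = (\<lambda>x::real. 1 / (of_real x - E))"
  have ne: "complex_of_real x - E \<noteq> 0" for x using E by auto
  have fc: "continuous_on UNIV f" unfolding f_def using ne by (intro continuous_intros) auto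
  have fm [measurable]: "f \<in> borel_measurable borel" by (rule borel_measurable_continuous_onI[OF fc])
  have Dm [measurable]: "(\<lambda>t. Re (qform (dens t) v)) \<in> borel_measurable borel"
    using borel_measurable_integrable[OF qform_dens_integrable[of UNIV v]] by simp
  have D0: "0 \<le> Re (qform (dens t) v)" for t using dens_psd by (simp add: psd_def)
  have fW: "continuous_on {0..pi} (\<lambda>t. f (2 * cos t) *\<^sub>M Wt t)"
    by (intro cs.continuous_on Wt_cont continuous_on_compose2[OF fc] continuous_intros) auto
  have "has_bochner_integral lborel (\<lambda>t. f (node t) *\<^sub>M dens t)
     (integral {0..pi} (\<lambda>t. f (2 * cos t) *\<^sub>M Wt t) + (\<Sum>a\<in>Z. f (a + inverse a) *\<^sub>M w a))"
    using fW by (intro node_dens_integral) (auto simp: cs.zero_right)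
  hence hb: "has_bochner_integral lborel (\<lambda>t. f (node t) *\<^sub>M dens t) (resolvent_block A B E)"
    by (simp add: resolvent_block_integral[OF E] f_def)
  have "qform (f (node t) *\<^sub>M dens t) v = Re (qform (dens t) v) *\<^sub>R f (node t)" for t
  proof -
    have "(dens t)\<^sup>\<dagger> = dens t" using dens_psd by (simp add: psd_def)
    hence "qform (dens t) v = of_real (Re (qform (dens t) v))" using herm_qform_real by (metis of_real_Re)
    moreover have "qform (f (node t) *\<^sub>M dens t) v = f (node t) * qform (dens t) v"
      by (simp add: qform_cinner cscale_vec cinner_cscale)
    ultimately show ?thesis by (simp add: scaleR_conv_of_real mult.commute)
  qed
  hence "has_bochner_integral lborel (\<lambda>t. Re (qform (dens t) v) *\<^sub>R f (node t)) (qform (resolvent_block A B E) v)"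
    using has_bochner_integral_bounded_linear[OF bounded_linear_qform hb, of v] by simp
  thus "integrable (quad_measure mu v) (\<lambda>x. 1 / (of_real x - E)) \<and>
    qform (resolvent_block A B E) v = (\<integral>x. 1 / (of_real x - E) \<partial>quad_measure mu v)"
    unfolding quad_measure_mu f_def[symmetric]
    by (subst integrable_distr_eq, simp, simp, subst integral_distr, simp, simp,
        subst integrable_density, simp, simp, simp add: D0, subst integral_density)
      (auto simp: D0 has_bochner_integral_iff)
qed

lemma mu_UNIV: "mu UNIV = mat 1"
proof -
  have "has_bochner_integral lborel dens (integral {0..pi} Wt + (\<Sum>a\<in>Z. w a))"
    using node_dens_integral[of "\<lambda>x M. M"] Wt_cont by simp
  moreover have "integral {0..pi} Wt + (\<Sum>a\<in>Z. w a) = K 1" by (simp add: K_def mform_def add.commute)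
  ultimately show ?thesis by (simp add: mu_def has_bochner_integral_iff K_1 del: One_nat_def)
qed

text \<open>These facts isolate the atoms: the points a + 1/a are distinct from each other and from
  the interval [-2, 2] that carries the continuous part.\<close>

lemma E_inj: "inj_on (\<lambda>a. a + inverse a) Z" and E_large: "a \<in> Z \<Longrightarrow> \<bar>a + inverse a\<bar> > 2"
proof -
  show "inj_on (\<lambda>a. a + inverse a) Z"
  proof (rule inj_onI)
    fix a b assume ab: "a \<in> Z" "b \<in> Z" "a + inverse a = b + inverse b"
    have nz: "a \<noteq> 0" "b \<noteq> 0" using Z_props ab by auto
    have "(a - b) * (a * b - 1) = 0" using ab(3) nz by (simp add: field_simps)
    moreover have "\<bar>a * b\<bar> < 1 * 1" unfolding abs_mult
      using Z_props(1)[OF ab(1)] Z_props(1)[OF ab(2)] by (intro mult_strict_mono') auto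
    hence "a * b \<noteq> 1" by auto
    ultimately show "a = b" by simp
  qed
  assume a: "a \<in> Z"
  have a0: "a \<noteq> 0" using Z_props(2)[OF a] .
  have "(\<bar>a\<bar> - 1)\<^sup>2 > 0" using Z_props(1)[OF a] by simp
  hence "\<bar>a\<bar> * 2 < \<bar>a\<bar> * \<bar>a\<bar> + 1" by (simp add: power2_eq_square algebra_simps)
  hence "2 < \<bar>a\<bar> + inverse \<bar>a\<bar>" using a0 by (simp add: field_simps)
  also have "\<dots> = \<bar>a + inverse a\<bar>"
  proof -
    have "a > 0 \<and> inverse a > 0 \<or> a < 0 \<and> inverse a < 0" using a0 by auto
    moreover have "inverse \<bar>a\<bar> = \<bar>inverse a\<bar>" by (simp add: abs_inverse)
    ultimately show ?thesis by linarith
  qed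
  finally show "\<bar>a + inverse a\<bar> > 2" .
qed

lemma mu_point: assumes x: "x \<in> Z" shows "mu {x + inverse x} = w x"
proof -
  have z: "indicator {x + inverse x} (2 * cos t) = (0::real)" for t
  proof -
    have "\<bar>2 * cos t\<bar> \<le> 2" using abs_cos_le_one[of t] by (simp add: abs_mult)
    thus ?thesis using E_large[OF x] by (auto simp: indicator_def)
  qed
  have "has_bochner_integral lborel (\<lambda>t. indicator {x + inverse x} (node t) *\<^sub>R dens t)
    (integral {0..pi} (\<lambda>t. indicator {x + inverse x} (2 * cos t) *\<^sub>R Wt t) +
     (\<Sum>a\<in>Z. indicator {x + inverse x} (a + inverse a) *\<^sub>R w a))"
    by (rule node_dens_integral) (simp_all add: z)
  hence "mu {x + inverse x} = (\<Sum>a\<in>Z. indicator {x + inverse x} (a + inverse a) *\<^sub>R w a)"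
    by (simp add: mu_def has_bochner_integral_iff z)
  also have "\<dots> = (\<Sum>a\<in>Z. if a = x then w x else 0)"
  proof (intro sum.cong refl)
    fix a assume a: "a \<in> Z"
    show "indicator {x + inverse x} (a + inverse a) *\<^sub>R w a = (if a = x then w x else 0)"
    proof (cases "a = x")
      case False
      hence "a + inverse a \<notin> {x + inverse x}" using inj_onD[OF E_inj _ a x] by blast
      thus ?thesis using False by simp
    qed simp
  qed
  finally show ?thesis using x finite_Z by simp
qed

lemma mu_compact: "\<exists>K. compact K \<and> mu (- K) = 0"
proof (intro exI conjI)
  define S where "S = {-2..2} \<union> (\<lambda>a. a + inverse a) ` Z"
  show "compact S" unfolding S_def using finite_Z by (intro compact_Un compact_Icc finite_imp_compact) auto
  have "node t \<in> S" for t
  proof (cases "t \<in> {5..<5 + real (card Z)}")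
    case True
    hence "nat \<lfloor>t - 5\<rfloor> < card Z" by auto linarith
    hence "zero_enum (nat \<lfloor>t - 5\<rfloor>) \<in> Z" using bij_betwE[OF zero_enum] by auto
    moreover have "\<not> t \<le> pi" using True pi_less_4 by auto
    ultimately show ?thesis using True by (auto simp: node_def glue_def S_def)
  qed (auto simp: node_def glue_def S_def)
  thus "mu (- S) = 0" by (simp add: mu_def indicator_def)
qed

lemma spectral_measure_mu: "spectral_measure A B mu"
  unfolding spectral_measure_def
  using matrix_measure_mu mu_compact mu_UNIV mu_matrix_integral by blast

end

theorem theorem3p6:
  fixes p :: "complex poly^'l^'l"
    and u :: "complex \<Rightarrow> complex^'l^'l"
    and w :: "real \<Rightarrow> complex^'l^'l"
  assumes poly: "u = eval_mat p"
    and sym: "\<And>z. z \<noteq> 0 \<Longrightarrow>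
      (u (1 / cnj z))\<^sup>\<dagger> ** u z = ((u (1 / z))\<^sup>\<dagger> ** u (cnj z))\<^sup>\<dagger>"
    and inv: "\<And>z. z \<in> (cball 0 1 - \<real>) \<union> {0} \<Longrightarrow> invertible (u z)"
    and simple: "\<And>z. z \<in> cball 0 1 \<inter> \<real> \<Longrightarrow> mat_zero u z \<Longrightarrow> simple_mat_zero u z"
    and weights: "\<And>x. x \<in> real_zeros u \<Longrightarrow>
      psd (w x) \<and> range ((*v) (w x)) = {v. u (of_real x) *v v = 0}"
    and total: "(\<Sum>x\<in>real_zeros u. w x) + (2 / pi) *\<^sub>R
      integral {0..pi} (\<lambda>\<theta>. (sin \<theta>)\<^sup>2 *\<^sub>R matrix_inv ((u (cis \<theta>))\<^sup>\<dagger> ** u (cis \<theta>))) = mat 1"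
  shows "\<exists>A B.
      block_jacobi A B \<and> jost_function A B u \<and>
      (\<exists>\<mu>. spectral_measure A B \<mu> \<and> (\<forall>x\<in>real_zeros u. \<mu> {x + inverse x} = w x)) \<and>
      exp_converging A B \<and>
      ((\<exists>N. \<forall>n\<ge>N. mat 1 - A n ** (A n)\<^sup>\<dagger> = 0 \<and> B n = 0) \<longleftrightarrow>
       (\<forall>x\<in>real_zeros u. canonical u (of_real x) (w x)))"
proof -
  interpret jost_data p u w
    by (unfold_locales) (fact assms)+
  show ?thesis
    using block_jacobi jost_function spectral_measure_mu mu_point exp_converging free_iff_canonical
    by (intro exI[of _ A] exI[of _ B] conjI exI[of _ mu] ballI) auto
qed

end
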